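(* Let $\alpha$ be an infinite ordinal. (i) Each endo-dimension-complemented algebra is inductive, and each inductive algebra is symmetric and representable, but the converses of these statements do not hold; i.e. $\mathsf{Edc}_\alpha\subset\mathsf{Ind}_\alpha\subset\mathsf{Sy}_\alpha\cap\mathsf{RCA}_\alpha$, where $\subset$ denotes proper inclusion. (ii) An algebra is inductive iff there is a locally finite dimensional cylindric algebra of dimension $\alpha$ with the same equational theory; i.e. for $\mathfrak A\in\mathsf{CA}_\alpha$, $\mathfrak A$ is inductive if and only if $\mathsf{Eq}(\mathfrak A)=\mathsf{Eq}(\mathfrak B)$ for some $\mathfrak B\in\mathsf{Lf}_\alpha$.
   Context: A cylindric algebra of dimension $\alpha$ (a $\mathsf{CA}_\alpha$) is an algebra $\langle A,+,-,c_i,d_{ij}: i,j\in\alpha\rangle$ such that $\langle A,+,-\rangle$ is a Boolean algebra and for all distinct $i,j,k\in\alpha$ and all $x,y\in A$: $c_ic_jx=c_jc_ix$, $x\le c_ix=c_ic_ix$, $c_i(x+y)=c_ix+c_iy$, $c_i-c_ix=-c_ix$, $d_{ii}=1$, $d_{ij}=d_{ji}$, $c_j(d_{ij}\cdot d_{jk})=d_{ik}$, $c_id_{ij}=1$, $d_{ij}\cdot c_i(d_{ij}\cdot x)=d_{ij}\cdot x$. For $V\subseteq{}^\alpha U$, the full cylindric set algebra with unit $V$ is $\langle \mathcal P(V),\cup,-,C_i^V,D_{ij}^V : i,j\in\alpha\rangle$, where $C_i^VX=\{s(i/u)\in V : s\in X,\ u\in U\}$ ($s(i/u)$ is $s$ with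 its value at $i$ changed to $u$) and $D_{ij}^V=\{s\in V : s_i=s_j\}$. $\mathsf{RCA}_\alpha$ (representable algebras) is the class of all algebras isomorphic to subalgebras of full cylindric set algebras whose unit is a disjoint union of sets of the form ${}^\alpha U$. $\mathsf{Lf}_\alpha$ is the class of locally finite dimensional $\mathsf{CA}_\alpha$s: those in which for each element $x$ we have $c_ix=x$ for all but finitely many $i\in\alpha$. For $\Gamma\subseteq\alpha$, the $\Gamma$-reduct of $\mathfrak A\in\mathsf{CA}_\alpha$ is $\langle A,+,-,c_i,d_{ij}\rangle_{i,j\in\Gamma}$. $\mathfrak A\in\mathsf{CA}_\alpha$ is endo-dimension-complemented if for each finite $\Gamma\subseteq\alpha$ and each nonzero $x\in A$ there are $\kappa\in\alpha-\Gamma$ and an endomorphism $h$ of the $\Gamma$-reduct of $\mathfrak A$ such that $h(x)\neq0$ and $c_\kappa h(a)=h(a)$ for all $a\in A$. $\mathsf{Edc}_\alpha$ is the class of these algebras. Equations are in the language of $\mathsf{CA}_\alpha$ and use a fixed countably infinite set of variables. $\mathsf{Eq}(\mathfrak A)$ is the set of all equations valid in $\mathfrak A$. An index $i\in\alpha$ occurs in an equation if $c_i$, or some $d_{ij}$ or $d_{ji}$, occurs in it. For a permutation $\rho$ of $\alpha$, $\rho(e)$ is the equation obtained from $e$ by replacing each index $i$ of an operation by $\rho(i)$. $\mathfrak A\in\mathsf{CA}_\alpha$ is symmetric if $\mathfrak A\models e$ implies $\mathfrak A\models\rho(e)$ for every equation $e$ and every permutation $\rho$ of $\alpha$; $\mathsf{Sy}_\alpha$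 is the class of symmetric $\mathsf{CA}_\alpha$s. $\mathfrak A\in\mathsf{CA}_\alpha$ is inductive if $\mathfrak A\models e(c_ix_1,\dots,c_ix_n)$ implies $\mathfrak A\models e(x_1,\dots,x_n)$ whenever $e$ is an equation (with variables $x_1,\dots,x_n$) and $i\in\alpha$ does not occur as an index of an operation in $e$; $\mathsf{Ind}_\alpha$ is the class of inductive $\mathsf{CA}_\alpha$s. *)

theory Defs
  imports Main
begin

section \<open>Cylindric algebras\<close>

text \<open>
  The dimension \<open>\<alpha>\<close> is the index type \<^typ>\<open>'i\<close>. An algebra has the
  signature \<open>\<langle>A, +, -, c\<^sub>i, d\<^sub>i\<^sub>j\<rangle>\<close>, with its universe given as a set, so
  the values of the operations outside the universe are irrelevant.
\<close>

record ('i, 'a) cyl_alg =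
  carr :: "'a set"
  bplus :: "'a \<Rightarrow> 'a \<Rightarrow> 'a"
  bneg :: "'a \<Rightarrow> 'a"
  cyl :: "'i \<Rightarrow> 'a \<Rightarrow> 'a"
  diag :: "'i \<Rightarrow> 'i \<Rightarrow> 'a"

definition closed_ops :: "('i, 'a) cyl_alg \<Rightarrow> bool" where
  "closed_ops A \<longleftrightarrow>
     carr A \<noteq> {} \<and>
     (\<forall>x\<in>carr A. \<forall>y\<in>carr A. bplus A x y \<in> carr A) \<and>
     (\<forall>x\<in>carr A. bneg A x \<in> carr A) \<and>
     (\<forall>i. \<forall>x\<in>carr A. cyl A i x \<in> carr A) \<and>
     (\<forall>i j. diag A i j \<in> carr A)"

definition bmult :: "('i, 'a) cyl_alg \<Rightarrow> 'a \<Rightarrow> 'a \<Rightarrow> 'a" where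
  "bmult A x y = bneg A (bplus A (bneg A x) (bneg A y))"

definition ble :: "('i, 'a) cyl_alg \<Rightarrow> 'a \<Rightarrow> 'a \<Rightarrow> bool" where
  "ble A x y \<longleftrightarrow> bplus A x y = y"

text \<open>The constants \<open>1\<close> and \<open>0\<close> are not in the signature; in a Boolean algebra
  \<open>1\<close> is the common value of all \<open>x + -x\<close>.\<close>

definition bone :: "('i, 'a) cyl_alg \<Rightarrow> 'a" where
  "bone A = (THE u. u \<in> carr A \<and> (\<forall>x\<in>carr A. bplus A x (bneg A x) = u))"

definition bzero :: "('i, 'a) cyl_alg \<Rightarrow> 'a" where
  "bzero A = bneg A (bone A)"

text \<open>Complemented distributive lattices; the one-element algebra is allowed.\<close>

definition boolean_alg :: "('i, 'a) cyl_alg \<Rightarrow> bool" where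
  "boolean_alg A \<longleftrightarrow>
     (\<forall>x\<in>carr A. \<forall>y\<in>carr A. bplus A x y = bplus A y x) \<and>
     (\<forall>x\<in>carr A. \<forall>y\<in>carr A. bmult A x y = bmult A y x) \<and>
     (\<forall>x\<in>carr A. \<forall>y\<in>carr A. \<forall>z\<in>carr A.
        bplus A (bplus A x y) z = bplus A x (bplus A y z)) \<and>
     (\<forall>x\<in>carr A. \<forall>y\<in>carr A. \<forall>z\<in>carr A.
        bmult A (bmult A x y) z = bmult A x (bmult A y z)) \<and>
     (\<forall>x\<in>carr A. \<forall>y\<in>carr A. bplus A x (bmult A x y) = x) \<and>
     (\<forall>x\<in>carr A. \<forall>y\<in>carr A. bmult A x (bplus A x y) = x) \<and>
     (\<forall>x\<in>carr A. \<forall>y\<in>carr A. \<forall>z\<in>carr A.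
        bmult A x (bplus A y z) = bplus A (bmult A x y) (bmult A x z)) \<and>
     (\<forall>x\<in>carr A. \<forall>y\<in>carr A. \<forall>z\<in>carr A.
        bplus A x (bmult A y z) = bmult A (bplus A x y) (bplus A x z)) \<and>
     (\<forall>x\<in>carr A. bplus A x (bneg A x) = bone A) \<and>
     (\<forall>x\<in>carr A. bmult A x (bneg A x) = bzero A)"

definition CA :: "('i, 'a) cyl_alg set" where
  "CA = {A. closed_ops A \<and> boolean_alg A \<and>
     (\<forall>i j k. i \<noteq> j \<and> j \<noteq> k \<and> i \<noteq> k \<longrightarrow>
       (\<forall>x\<in>carr A. \<forall>y\<in>carr A.
          cyl A i (cyl A j x) = cyl A j (cyl A i x) \<and>
          ble A x (cyl A i x) \<and> cyl A i x = cyl A i (cyl A i x) \<and>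
          cyl A i (bplus A x y) = bplus A (cyl A i x) (cyl A i y) \<and>
          cyl A i (bneg A (cyl A i x)) = bneg A (cyl A i x) \<and>
          diag A i i = bone A \<and>
          diag A i j = diag A j i \<and>
          cyl A j (bmult A (diag A i j) (diag A j k)) = diag A i k \<and>
          cyl A i (diag A i j) = bone A \<and>
          bmult A (diag A i j) (cyl A i (bmult A (diag A i j) x))
            = bmult A (diag A i j) x))}"

definition Lf :: "('i, 'a) cyl_alg set" where
  "Lf = {A \<in> CA. \<forall>x\<in>carr A. finite {i. cyl A i x \<noteq> x}}"


section \<open>Homomorphisms and endo-dimension-complemented algebras\<close>

text \<open>Homomorphisms from the \<open>\<Gamma>\<close>-reduct of \<open>A\<close> to that of \<open>B\<close>.\<close>

definition reduct_hom ::
    "'i set \<Rightarrow> ('i, 'a) cyl_alg \<Rightarrow> ('i, 'b) cyl_alg \<Rightarrow> ('a \<Rightarrow> 'b) \<Rightarrow> bool" where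
  "reduct_hom \<Gamma> A B h \<longleftrightarrow>
     (\<forall>x\<in>carr A. h x \<in> carr B) \<and>
     (\<forall>x\<in>carr A. \<forall>y\<in>carr A. h (bplus A x y) = bplus B (h x) (h y)) \<and>
     (\<forall>x\<in>carr A. h (bneg A x) = bneg B (h x)) \<and>
     (\<forall>i\<in>\<Gamma>. \<forall>x\<in>carr A. h (cyl A i x) = cyl B i (h x)) \<and>
     (\<forall>i\<in>\<Gamma>. \<forall>j\<in>\<Gamma>. h (diag A i j) = diag B i j)"

definition cyl_iso ::
    "('i, 'a) cyl_alg \<Rightarrow> ('i, 'b) cyl_alg \<Rightarrow> ('a \<Rightarrow> 'b) \<Rightarrow> bool" where
  "cyl_iso A B h \<longleftrightarrow> reduct_hom UNIV A B h \<and> bij_betw h (carr A) (carr B)"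

definition Edc :: "('i, 'a) cyl_alg set" where
  "Edc = {A \<in> CA. \<forall>\<Gamma>. finite \<Gamma> \<longrightarrow>
     (\<forall>x\<in>carr A. x \<noteq> bzero A \<longrightarrow>
       (\<exists>\<kappa> h. \<kappa> \<notin> \<Gamma> \<and> reduct_hom \<Gamma> A A h \<and> h x \<noteq> bzero A \<and>
          (\<forall>a\<in>carr A. cyl A \<kappa> (h a) = h a)))}"


section \<open>Set algebras and representability\<close>

definition seqs :: "'u set \<Rightarrow> ('i \<Rightarrow> 'u) set" where
  "seqs U = {s. \<forall>i. s i \<in> U}"

text \<open>The full cylindric set algebra with unit \<open>V \<subseteq> seqs U\<close>.\<close>

definition full_set_alg :: "'u set \<Rightarrow> ('i \<Rightarrow> 'u) set \<Rightarrow> ('i, ('i \<Rightarrow> 'u) set) cyl_alg" where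
  "full_set_alg U V =
     \<lparr>carr = Pow V,
      bplus = (\<lambda>X Y. X \<union> Y),
      bneg = (\<lambda>X. V - X),
      cyl = (\<lambda>i X. {s(i := u) | s u. s \<in> X \<and> u \<in> U \<and> s(i := u) \<in> V}),
      diag = (\<lambda>i j. {s \<in> V. s i = s j})\<rparr>"

definition is_subalgebra :: "('i, 'a) cyl_alg \<Rightarrow> ('i, 'a) cyl_alg \<Rightarrow> bool" where
  "is_subalgebra B A \<longleftrightarrow>
     (\<exists>S \<subseteq> carr A. B = A\<lparr>carr := S\<rparr> \<and> closed_ops B)"

text \<open>
  The unit is the disjoint union of the sets \<open>seqs W\<close>, \<open>W \<in> K\<close>. HOL requires a fixed
  type in which the bases live; the one used here is large enough for every representable
  algebra over \<^typ>\<open>'a\<close>. Indeed, suppose that \<open>A\<close> is representable and put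
  \<open>\<lambda> = (|A| + |\<alpha>|)\<^sup>|\<^sup>\<alpha>\<^sup>|\<close>. For \<open>a \<noteq> 0\<close> in \<open>A\<close> pick a component \<open>seqs W\<close> of the unit
  that meets the image of \<open>a\<close>. A Loewenheim-Skolem argument (close off under witnesses for
  the cylindrifications \<open>|\<alpha>|\<^sup>+\<close> many times, using \<open>\<lambda>\<^sup>|\<^sup>\<alpha>\<^sup>| = \<lambda>\<close>) gives \<open>W\<^sub>a \<subseteq> W\<close> of size at most
  \<open>\<lambda>\<close> such that intersection with \<open>seqs W\<^sub>a\<close> is a homomorphism that does not send \<open>a\<close> to
  \<open>0\<close>. Disjoint copies of these \<open>W\<^sub>a\<close>, one for each \<open>a\<close>, fit into
  \<^typ>\<open>'a \<times> ('i \<Rightarrow> 'a + 'i)\<close>.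
\<close>

definition RCA :: "('i, 'a) cyl_alg set" where
  "RCA = {A. closed_ops A \<and>
     (\<exists>(K :: ('a \<times> ('i \<Rightarrow> 'a + 'i)) set set) B h.
        (\<forall>W\<in>K. \<forall>W'\<in>K. W \<noteq> W' \<longrightarrow>
           (seqs W :: ('i \<Rightarrow> 'a \<times> ('i \<Rightarrow> 'a + 'i)) set) \<inter> seqs W' = {}) \<and>
        is_subalgebra B (full_set_alg (\<Union>K) (\<Union>W\<in>K. seqs W)) \<and>
        cyl_iso A B h)}"


section \<open>Equations, symmetric and inductive algebras\<close>

text \<open>Terms over the variables \<open>x\<^sub>0, x\<^sub>1, \<dots>\<close>. \<open>inds\<close> is the set of indices that occur in a
  term, and \<open>rename \<rho>\<close> replaces every index \<open>i\<close> by \<open>\<rho> i\<close>.\<close>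

datatype (inds: 'i) ca_term =
    Var nat
  | Plus "'i ca_term" "'i ca_term"
  | Neg "'i ca_term"
  | Cyl 'i "'i ca_term"
  | Diag 'i 'i
  for map: rename

type_synonym 'i equation = "'i ca_term \<times> 'i ca_term"

primrec tval :: "('i, 'a) cyl_alg \<Rightarrow> (nat \<Rightarrow> 'a) \<Rightarrow> 'i ca_term \<Rightarrow> 'a" where
  "tval A v (Var n) = v n"
| "tval A v (Plus s t) = bplus A (tval A v s) (tval A v t)"
| "tval A v (Neg t) = bneg A (tval A v t)"
| "tval A v (Cyl i t) = cyl A i (tval A v t)"
| "tval A v (Diag i j) = diag A i j"

definition valid :: "('i, 'a) cyl_alg \<Rightarrow> 'i equation \<Rightarrow> bool" where
  "valid A e \<longleftrightarrow> (\<forall>v. (\<forall>n. v n \<in> carr A) \<longrightarrow> tval A v (fst e) = tval A v (snd e))"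

definition Eq :: "('i, 'a) cyl_alg \<Rightarrow> 'i equation set" where
  "Eq A = {e. valid A e}"

definition eq_inds :: "'i equation \<Rightarrow> 'i set" where
  "eq_inds e = inds (fst e) \<union> inds (snd e)"

definition eq_rename :: "('i \<Rightarrow> 'i) \<Rightarrow> 'i equation \<Rightarrow> 'i equation" where
  "eq_rename \<rho> e = (rename \<rho> (fst e), rename \<rho> (snd e))"

text \<open>\<open>cyl_vars i\<close> substitutes \<open>c\<^sub>i x\<^sub>n\<close> for every variable \<open>x\<^sub>n\<close>.\<close>

primrec cyl_vars :: "'i \<Rightarrow> 'i ca_term \<Rightarrow> 'i ca_term" where
  "cyl_vars i (Var n) = Cyl i (Var n)"
| "cyl_vars i (Plus s t) = Plus (cyl_vars i s) (cyl_vars i t)"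
| "cyl_vars i (Neg t) = Neg (cyl_vars i t)"
| "cyl_vars i (Cyl j t) = Cyl j (cyl_vars i t)"
| "cyl_vars i (Diag j k) = Diag j k"

definition eq_cyl_vars :: "'i \<Rightarrow> 'i equation \<Rightarrow> 'i equation" where
  "eq_cyl_vars i e = (cyl_vars i (fst e), cyl_vars i (snd e))"

definition Sy :: "('i, 'a) cyl_alg set" where
  "Sy = {A \<in> CA. \<forall>e \<rho>. bij \<rho> \<longrightarrow> valid A e \<longrightarrow> valid A (eq_rename \<rho> e)}"

definition Ind :: "('i, 'a) cyl_alg set" where
  "Ind = {A \<in> CA. \<forall>e i. i \<notin> eq_inds e \<longrightarrow> valid A (eq_cyl_vars i e) \<longrightarrow> valid A e}"

end

theory Submission
  imports Defs
begin

text \<open>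
  On elements closed under \<open>c\<^sub>k\<close>, the substitution \<open>s\<^sup>i\<^sub>k x = c\<^sub>i (d\<^sub>i\<^sub>k x)\<close> is injective and commutes
  with all operations without the indices \<open>i, k\<close>. Hence the closed elements for different indices
  satisfy the same equations, which makes endo-dimension-complemented and locally finite algebras
  inductive, and inductive algebras symmetric. The locally finite algebra with the equations of an
  inductive \<open>A\<close> is free on generators of which the \<open>n\<close>-th has finite dimension set \<open>G n\<close>.

  Representability: inductivity makes the equations of \<open>A\<close>, the diagram of a \<open>\<Gamma>\<close>-reduct with
  \<open>\<Gamma>\<close> finite, and the equations saying that the generators have dimension set \<open>\<Gamma>\<close> consistent.
  Henkin's construction yields a representation of each finite reduct, and an ultraproduct over the
  finite sets \<open>\<Gamma>\<close> represents \<open>A\<close>.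

  Inductive but not endo-dimension-complemented: split the set of injective sequences into pieces
  each of which meets every line \<open>{s(i := u) | u}\<close>. There are \<open>2\<^sup>|\<^sup>\<alpha>\<^sup>|\<close> unions of pieces, they are
  separated by \<open>c\<^sub>0\<close>, but only \<open>|\<alpha>|\<close> elements are closed under some \<open>c\<^sub>k\<close>. A product with
  a small locally finite algebra makes the equations those of a full set algebra.

  Symmetric and representable but not inductive: take a relation on two coordinates which is a
  strict order without greatest elements, where the order depends generically on all but one of the
  other coordinates. Any element closed under an index that is not used in the axioms of order is
  too symmetric to be such an order. A product over all permutations of the indices makes the
  algebra symmetric.
\<close>

text \<open>The recurring obstacle is the supply of fresh indices. An element of an inductive
  algebra may depend on every index, which leaves none for a Henkin witness; over a finite
  \<open>\<Gamma>\<close> almost all indices are fresh, so finite reducts can be treated and are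
  glued afterwards. Both counterexamples use the base \<open>'i set\<close>, of size 2^|\<alpha>|:
  new entries with prescribed properties must exist outside sets of |\<alpha>| entries, and Cantor's
  theorem provides them. The first counterexample is refuted by counting: an endomorphism that does
  not kill the set of all injective sequences is injective on the unions of pieces, while its values
  are closed under one cylindrification and hence too few; the locally finite factor is built from
  terms, so it has at most |\<alpha>| elements and does not spoil the count. In the second, the
  order compares two entries of equal sort after all other sorts have been represented. One barred
  coordinate leaves exactly enough room for this, two do not.\<close>

text \<open>Zorn's lemma in the form shared by Boolean ultrafilters, Henkin sets and the ultrafilter
  of the ultraproduct. Consistency is only consulted on finite sets, so unions of chains stay
  admissible.\<close>

lemma maximal_consistent_set:
  fixes P :: "'t set \<Rightarrow> bool" and neg :: "'t \<Rightarrow> 't"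
  assumes mono: "\<And>X Y. finite X \<Longrightarrow> Y \<subseteq> X \<Longrightarrow> P X \<Longrightarrow> P Y"
    and ext: "\<And>X t. finite X \<Longrightarrow> X \<subseteq> U \<Longrightarrow> t \<in> U \<Longrightarrow> P X \<Longrightarrow> P (insert t X) \<or> P (insert (neg t) X)"
    and neg: "\<And>t. t \<in> U \<Longrightarrow> neg t \<in> U"
    and S: "\<And>X. finite X \<Longrightarrow> X \<subseteq> S \<Longrightarrow> P X" and SU: "S \<subseteq> U"
  obtains F where "S \<subseteq> F" "F \<subseteq> U" "\<And>X. finite X \<Longrightarrow> X \<subseteq> F \<Longrightarrow> P X"
    "\<And>t. t \<in> U \<Longrightarrow> t \<in> F \<or> neg t \<in> F"
proof -
  define \<A> where "\<A> = {F. S \<subseteq> F \<and> F \<subseteq> U \<and> (\<forall>X. finite X \<longrightarrow> X \<subseteq> F \<longrightarrow> P X)}"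
  have "\<exists>M\<in>\<A>. \<forall>X\<in>\<A>. M \<subseteq> X \<longrightarrow> X = M"
  proof (rule subset_Zorn_nonempty)
    show "\<A> \<noteq> {}" using S SU by (auto simp: \<A>_def)
    fix \<C> assume C: "\<C> \<noteq> {}" "subset.chain \<A> \<C>"
    have "P X" if X: "finite X" "X \<subseteq> \<Union>\<C>" for X
    proof -
      obtain Y where "Y \<in> \<C>" "X \<subseteq> Y"
        by (rule finite_subset_Union_chain[OF X C])
      then show ?thesis using C(2) X(1) by (auto simp: \<A>_def subset.chain_def)
    qed
    moreover have "\<C> \<subseteq> \<A>" using C(2) by (simp add: subset.chain_def)
    then have "\<And>X. X \<in> \<C> \<Longrightarrow> S \<subseteq> X \<and> X \<subseteq> U" by (auto simp: \<A>_def)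
    then have "S \<subseteq> \<Union>\<C>" "\<Union>\<C> \<subseteq> U" using C(1) by auto
    ultimately show "\<Union>\<C> \<in> \<A>" unfolding \<A>_def by blast
  qed
  then obtain F where F: "F \<in> \<A>" "\<And>X. X \<in> \<A> \<Longrightarrow> F \<subseteq> X \<Longrightarrow> X = F" by blast
  have FP: "P X" if "finite X" "X \<subseteq> F" for X using F(1) that by (auto simp: \<A>_def)
  have FU: "F \<subseteq> U" "S \<subseteq> F" using F(1) by (auto simp: \<A>_def)
  have *: "\<exists>X. finite X \<and> X \<subseteq> F \<and> \<not> P (insert t X)" if "t \<in> U" "t \<notin> F" for t
  proof -
    have "insert t F \<notin> \<A>" using F(2)[of "insert t F"] that by blast
    then obtain X where X: "finite X" "X \<subseteq> insert t F" "\<not> P X"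
      using FU \<open>t \<in> U\<close> by (auto simp: \<A>_def)
    have "\<not> P (insert t (X - {t}))" using mono[of "insert t (X - {t})" X] X by auto
    then show ?thesis using X by (intro exI[of _ "X - {t}"]) auto
  qed
  have "t \<in> F \<or> neg t \<in> F" if "t \<in> U" for t
  proof (rule ccontr)
    assume n: "\<not> (t \<in> F \<or> neg t \<in> F)"
    obtain X where X: "finite X" "X \<subseteq> F" "\<not> P (insert t X)" using *[of t] n \<open>t \<in> U\<close> by blast
    obtain Y where Y: "finite Y" "Y \<subseteq> F" "\<not> P (insert (neg t) Y)" using *[of "neg t"] n neg[OF \<open>t \<in> U\<close>] by blast
    have "P (insert t (X \<union> Y)) \<or> P (insert (neg t) (X \<union> Y))"
      using ext[of "X \<union> Y" t] FP[of "X \<union> Y"] X Y that FU by auto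
    moreover have "\<not> P (insert t (X \<union> Y))"
      using mono[of "insert t (X \<union> Y)" "insert t X"] X Y by auto
    moreover have "\<not> P (insert (neg t) (X \<union> Y))"
      using mono[of "insert (neg t) (X \<union> Y)" "insert (neg t) Y"] X Y by auto
    ultimately show False by blast
  qed
  with FU FP show ?thesis by (intro that)
qed

section \<open>Ultrafilters of Boolean algebras\<close>

text \<open>The characteristic function is a Boolean homomorphism onto two elements; membership
  outside the carrier is left open.\<close>

definition ufilter :: "('i, 'a) cyl_alg \<Rightarrow> 'a set \<Rightarrow> bool" where
  "ufilter A F \<longleftrightarrow> (\<forall>x\<in>carr A. \<forall>y\<in>carr A. bplus A x y \<in> F \<longleftrightarrow> x \<in> F \<or> y \<in> F) \<and>
     (\<forall>x\<in>carr A. bneg A x \<in> F \<longleftrightarrow> x \<notin> F)"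

locale bool_alg =
  fixes A :: "('i, 'a) cyl_alg"
  assumes closed: "closed_ops A" and bool: "boolean_alg A"
begin

lemma nonempty: "carr A \<noteq> {}"
  and pl_in [simp]: "x \<in> carr A \<Longrightarrow> y \<in> carr A \<Longrightarrow> bplus A x y \<in> carr A"
  and ng_in [simp]: "x \<in> carr A \<Longrightarrow> bneg A x \<in> carr A"
  and cyl_in [simp]: "x \<in> carr A \<Longrightarrow> cyl A i x \<in> carr A"
  and diag_in [simp]: "diag A i j \<in> carr A"
  using closed by (auto simp: closed_ops_def)

lemma mt_in [simp]: "x \<in> carr A \<Longrightarrow> y \<in> carr A \<Longrightarrow> bmult A x y \<in> carr A"
  by (simp add: bmult_def)

lemma one_eq: "x \<in> carr A \<Longrightarrow> bplus A x (bneg A x) = bone A"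
  and zero_eq: "x \<in> carr A \<Longrightarrow> bmult A x (bneg A x) = bzero A"
  using bool by (auto simp: boolean_alg_def)

lemma one_in [simp]: "bone A \<in> carr A"
  using nonempty one_eq pl_in ng_in by (metis ex_in_conv)

lemma zero_in [simp]: "bzero A \<in> carr A"
  by (simp add: bzero_def)

lemma pl_comm: "x \<in> carr A \<Longrightarrow> y \<in> carr A \<Longrightarrow> bplus A x y = bplus A y x"
  and mt_comm: "x \<in> carr A \<Longrightarrow> y \<in> carr A \<Longrightarrow> bmult A x y = bmult A y x"
  and pl_assoc: "x \<in> carr A \<Longrightarrow> y \<in> carr A \<Longrightarrow> z \<in> carr A \<Longrightarrow>
      bplus A (bplus A x y) z = bplus A x (bplus A y z)"
  and mt_assoc: "x \<in> carr A \<Longrightarrow> y \<in> carr A \<Longrightarrow> z \<in> carr A \<Longrightarrow>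
      bmult A (bmult A x y) z = bmult A x (bmult A y z)"
  and absorb1: "x \<in> carr A \<Longrightarrow> y \<in> carr A \<Longrightarrow> bplus A x (bmult A x y) = x"
  and absorb2: "x \<in> carr A \<Longrightarrow> y \<in> carr A \<Longrightarrow> bmult A x (bplus A x y) = x"
  and distrib: "x \<in> carr A \<Longrightarrow> y \<in> carr A \<Longrightarrow> z \<in> carr A \<Longrightarrow>
      bmult A x (bplus A y z) = bplus A (bmult A x y) (bmult A x z)"
  using bool unfolding boolean_alg_def by meson+

lemma mt_idem: "x \<in> carr A \<Longrightarrow> bmult A x x = x"
  by (metis absorb1 absorb2 mt_in)

lemma mt_one: "x \<in> carr A \<Longrightarrow> bmult A x (bone A) = x"
  by (metis absorb2 one_eq ng_in)

lemma pl_zero: "x \<in> carr A \<Longrightarrow> bplus A x (bzero A) = x"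
  by (metis absorb1 zero_eq ng_in)

lemma mt_zero: "x \<in> carr A \<Longrightarrow> bmult A x (bzero A) = bzero A"
  by (metis mt_assoc mt_idem zero_eq ng_in)

lemma ng_ng: "x \<in> carr A \<Longrightarrow> bneg A (bneg A x) = x"
proof -
  assume x: "x \<in> carr A"
  let ?n = "bneg A x" and ?nn = "bneg A (bneg A x)"
  have "?nn = bmult A ?nn (bplus A x ?n)" using x by (simp add: one_eq mt_one)
  also have "\<dots> = bplus A (bmult A ?nn x) (bmult A ?nn ?n)" using x by (simp add: distrib)
  also have "bmult A ?nn ?n = bzero A" using x by (metis mt_comm ng_in zero_eq)
  finally have 1: "?nn = bmult A ?nn x" using x by (simp add: pl_zero)
  have "x = bmult A x (bplus A ?n ?nn)" using x by (simp add: one_eq mt_one)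
  also have "\<dots> = bplus A (bmult A x ?n) (bmult A x ?nn)" using x by (simp add: distrib)
  also have "\<dots> = bmult A x ?nn" using x by (metis zero_eq pl_zero pl_comm mt_in ng_in zero_in)
  finally show ?thesis using 1 x by (metis mt_comm ng_in)
qed

lemma ng_pl: "x \<in> carr A \<Longrightarrow> y \<in> carr A \<Longrightarrow>
  bneg A (bplus A x y) = bmult A (bneg A x) (bneg A y)"
  by (simp add: bmult_def ng_ng)

lemma mt_neg_zero_imp:
  assumes "x \<in> carr A" "y \<in> carr A" "bmult A x (bneg A y) = bzero A"
  shows "bmult A x y = x"
proof -
  have "x = bmult A x (bplus A y (bneg A y))" using assms by (simp add: one_eq mt_one)
  also have "\<dots> = bmult A x y" using assms by (simp add: distrib pl_zero)
  finally show ?thesis by simp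
qed

lemma ufilter_exists:
  assumes z: "z \<in> carr A" "z \<noteq> bzero A"
  shows "\<exists>F. ufilter A F \<and> z \<in> F"
proof -
  \<comment> \<open>Consistency of a set of elements: a nonzero lower bound
    \<open>m\<close>.\<close>
  define P where "P X \<longleftrightarrow> (\<exists>m\<in>carr A. m \<noteq> bzero A \<and> (\<forall>x\<in>X. x \<in> carr A \<longrightarrow> bmult A m x = m))" for X
  have ext: "P (insert t X) \<or> P (insert (bneg A t) X)" if t: "t \<in> carr A" and "P X" for t X
  proof -
    obtain m where m: "m \<in> carr A" "m \<noteq> bzero A" "\<And>x. x \<in> X \<Longrightarrow> x \<in> carr A \<Longrightarrow> bmult A m x = m"
      using \<open>P X\<close> by (auto simp: P_def)
    have *: "P (insert u X)" if u: "u \<in> carr A" "bmult A m u \<noteq> bzero A" for u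
    proof -
      have "bmult A (bmult A m u) x = bmult A m u" if "x \<in> insert u X" "x \<in> carr A" for x
      proof (cases "x = u")
        case True then show ?thesis using u m by (simp add: mt_assoc mt_idem)
      next
        case False
        then have "bmult A m x = m" using that m by auto
        then show ?thesis using u m that by (metis mt_assoc mt_comm)
      qed
      then show ?thesis unfolding P_def using u m by (intro bexI[of _ "bmult A m u"]) auto
    qed
    have "bmult A m t \<noteq> bzero A \<or> bmult A m (bneg A t) \<noteq> bzero A"
      using mt_neg_zero_imp[of m t] m t by metis
    then show ?thesis using * t by auto
  qed
  have sing: "P X" if "X \<subseteq> {z}" for X
    unfolding P_def using z that by (intro bexI[of _ z]) (auto simp: mt_idem)
  have mono: "P Y" if "Y \<subseteq> X" "P X" for X Y
    using that unfolding P_def by (meson subsetD)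
  obtain F where F: "{z} \<subseteq> F" "F \<subseteq> carr A" "\<And>X. finite X \<Longrightarrow> X \<subseteq> F \<Longrightarrow> P X"
    "\<And>t. t \<in> carr A \<Longrightarrow> t \<in> F \<or> bneg A t \<in> F"
  proof (rule maximal_consistent_set[of P "carr A" "bneg A" "{z}"])
    show "P Y" if "finite X" "Y \<subseteq> X" "P X" for X Y using mono that by blast
    show "P X" if "finite X" "X \<subseteq> {z}" for X using sing that by blast
    show "P (insert t X) \<or> P (insert (bneg A t) X)" if "t \<in> carr A" "P X" for t X using ext that by blast
  qed (use z in auto)
  \<comment> \<open>Three members at once, because primeness concerns a sum together with the
    complements of both summands.\<close>
  have no: False if "x \<in> carr A" "y \<in> carr A" "w \<in> carr A" "x \<in> F" "y \<in> F" "w \<in> F"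
    "bmult A x (bmult A y w) = bzero A" for x y w
  proof -
    have "P {x, y, w}" using F(3) that by simp
    then obtain m where m: "m \<in> carr A" "m \<noteq> bzero A" "bmult A m x = m" "bmult A m y = m" "bmult A m w = m"
      using \<open>x \<in> carr A\<close> \<open>y \<in> carr A\<close> \<open>w \<in> carr A\<close> unfolding P_def by blast
    have "m = bmult A m (bmult A x (bmult A y w))" using m that by (metis mt_assoc mt_in)
    then show False using m that by (simp add: mt_zero)
  qed
  have neg: "bneg A x \<in> F \<longleftrightarrow> x \<notin> F" if "x \<in> carr A" for x
    using no[of x "bneg A x" "bneg A x"] F(4) that by (auto simp: mt_idem zero_eq)
  have "bplus A x y \<in> F \<longleftrightarrow> x \<in> F \<or> y \<in> F" if xy: "x \<in> carr A" "y \<in> carr A" for x y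
  proof -
    have eq: "bmult A x (bneg A (bplus A x y)) = bzero A" if xy: "x \<in> carr A" "y \<in> carr A" for x y
      using xy by (simp add: ng_pl) (metis mt_assoc mt_comm mt_zero ng_in zero_eq)
    have 1: False if "x \<in> F" "bneg A (bplus A x y) \<in> F" "x \<in> carr A" "y \<in> carr A" for x y
      using no[of x "bneg A (bplus A x y)" "bneg A (bplus A x y)"] that eq by (auto simp: mt_idem)
    have 2: False if "bplus A x y \<in> F" "bneg A x \<in> F" "bneg A y \<in> F"
      using no[of "bplus A x y" "bneg A x" "bneg A y"] that xy by (simp add: ng_pl[symmetric] zero_eq)
    show ?thesis using 1[of x y] 1[of y x] 2 xy neg pl_comm by (metis pl_in)
  qed
  then show ?thesis using neg F(1) unfolding ufilter_def by (intro exI[of _ F]) auto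
qed

lemma uf_pl: "ufilter A F \<Longrightarrow> x \<in> carr A \<Longrightarrow> y \<in> carr A \<Longrightarrow> bplus A x y \<in> F \<longleftrightarrow> x \<in> F \<or> y \<in> F"
  and uf_ng: "ufilter A F \<Longrightarrow> x \<in> carr A \<Longrightarrow> bneg A x \<in> F \<longleftrightarrow> x \<notin> F"
  by (auto simp: ufilter_def)

lemma uf_mt: "ufilter A F \<Longrightarrow> x \<in> carr A \<Longrightarrow> y \<in> carr A \<Longrightarrow> bmult A x y \<in> F \<longleftrightarrow> x \<in> F \<and> y \<in> F"
  by (simp add: bmult_def uf_pl uf_ng)

lemma uf_one: "ufilter A F \<Longrightarrow> bone A \<in> F"
  using uf_pl uf_ng one_eq one_in ng_in by metis

lemma uf_zero: "ufilter A F \<Longrightarrow> bzero A \<notin> F"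
  by (simp add: bzero_def uf_ng uf_one)

lemmas uf = uf_pl uf_ng uf_mt uf_one uf_zero

text \<open>Stone duality in use: with the rules \<open>uf\<close>, Boolean identities become
  propositional statements about membership in ultrafilters.\<close>

lemma eqI:
  assumes "x \<in> carr A" "y \<in> carr A" "\<And>F. ufilter A F \<Longrightarrow> x \<in> F \<longleftrightarrow> y \<in> F"
  shows "x = y"
proof -
  have "bmult A x (bneg A y) = bzero A" if "x \<in> carr A" "y \<in> carr A"
    "\<And>F. ufilter A F \<Longrightarrow> x \<in> F \<longleftrightarrow> y \<in> F" for x y
    using ufilter_exists[of "bmult A x (bneg A y)"] that uf_mt uf_ng by (metis mt_in ng_in)
  then have "bmult A x y = x" "bmult A y x = y"
    using mt_neg_zero_imp assms by metis+
  then show ?thesis using mt_comm assms by metis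
qed

lemma ble_iff:
  assumes "x \<in> carr A" "y \<in> carr A"
  shows "ble A x y \<longleftrightarrow> (\<forall>F. ufilter A F \<longrightarrow> x \<in> F \<longrightarrow> y \<in> F)"
proof
  assume "ble A x y"
  then show "\<forall>F. ufilter A F \<longrightarrow> x \<in> F \<longrightarrow> y \<in> F" using assms uf_pl unfolding ble_def by metis
next
  assume "\<forall>F. ufilter A F \<longrightarrow> x \<in> F \<longrightarrow> y \<in> F"
  then show "ble A x y" unfolding ble_def using assms by (intro eqI) (auto simp: uf)
qed

end

section \<open>Substitutions in cylindric algebras\<close>

definition sub :: "('i, 'a) cyl_alg \<Rightarrow> 'i \<Rightarrow> 'i \<Rightarrow> 'a \<Rightarrow> 'a" where
  "sub A i j x = cyl A i (bmult A (diag A i j) x)"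

locale cylindric =
  fixes A :: "('i, 'a) cyl_alg"
  assumes CA: "A \<in> CA" and inf: "infinite (UNIV :: 'i set)"
begin

sublocale bool_alg A
  using CA by unfold_locales (auto simp: CA_def)

lemma fresh_index: "finite S \<Longrightarrow> \<exists>k. k \<notin> (S :: 'i set)"
  using inf by (rule ex_new_if_finite)

lemma axs:
  assumes "i \<noteq> j" "j \<noteq> k" "i \<noteq> k" "x \<in> carr A" "y \<in> carr A"
  shows "cyl A i (cyl A j x) = cyl A j (cyl A i x) \<and>
          ble A x (cyl A i x) \<and> cyl A i x = cyl A i (cyl A i x) \<and>
          cyl A i (bplus A x y) = bplus A (cyl A i x) (cyl A i y) \<and>
          cyl A i (bneg A (cyl A i x)) = bneg A (cyl A i x) \<and>
          diag A i i = bone A \<and>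
          diag A i j = diag A j i \<and>
          cyl A j (bmult A (diag A i j) (diag A j k)) = diag A i k \<and>
          cyl A i (diag A i j) = bone A \<and>
          bmult A (diag A i j) (cyl A i (bmult A (diag A i j) x))
            = bmult A (diag A i j) x"
  using CA assms unfolding CA_def by blast

text \<open>The axioms are stated for three distinct indices; as the dimension is infinite, a third
  index can always be supplied.\<close>

lemma axs_pair:
  assumes "i \<noteq> j" "x \<in> carr A" "y \<in> carr A"
  shows "cyl A i (cyl A j x) = cyl A j (cyl A i x)"
    and "ble A x (cyl A i x)" and "cyl A i (cyl A i x) = cyl A i x"
    and "cyl A i (bplus A x y) = bplus A (cyl A i x) (cyl A i y)"
    and "cyl A i (bneg A (cyl A i x)) = bneg A (cyl A i x)"
    and "diag A i i = bone A"
    and "diag A i j = diag A j i"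
    and "cyl A i (diag A i j) = bone A"
    and "bmult A (diag A i j) (cyl A i (bmult A (diag A i j) x)) = bmult A (diag A i j) x"
proof -
  obtain k where "k \<noteq> i" "k \<noteq> j" using fresh_index[of "{i, j}"] by auto
  note a = axs[of i j k x y, OF assms(1) this(2)[symmetric] this(1)[symmetric] assms(2,3)]
  show "cyl A i (cyl A j x) = cyl A j (cyl A i x)"
    "ble A x (cyl A i x)" "cyl A i (cyl A i x) = cyl A i x"
    "cyl A i (bplus A x y) = bplus A (cyl A i x) (cyl A i y)"
    "cyl A i (bneg A (cyl A i x)) = bneg A (cyl A i x)"
    "diag A i i = bone A"
    "diag A i j = diag A j i"
    "cyl A i (diag A i j) = bone A"
    "bmult A (diag A i j) (cyl A i (bmult A (diag A i j) x)) = bmult A (diag A i j) x"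
    using a by auto
qed

lemma other_index: "\<exists>j. (i::'i) \<noteq> j"
  using fresh_index[of "{i}"] by auto

lemma cyl_comm: "x \<in> carr A \<Longrightarrow> cyl A i (cyl A j x) = cyl A j (cyl A i x)"
  using axs_pair(1)[of i j x x] by (cases "i = j") auto

lemma cyl_ge: "x \<in> carr A \<Longrightarrow> ble A x (cyl A i x)"
  using other_index[of i] axs_pair(2) by blast

lemma cyl_idem: "x \<in> carr A \<Longrightarrow> cyl A i (cyl A i x) = cyl A i x"
  using other_index[of i] axs_pair(3) by blast

lemma cyl_pl: "x \<in> carr A \<Longrightarrow> y \<in> carr A \<Longrightarrow> cyl A i (bplus A x y) = bplus A (cyl A i x) (cyl A i y)"
  using other_index[of i] axs_pair(4) by blast

lemma cyl_ng_cyl: "x \<in> carr A \<Longrightarrow> cyl A i (bneg A (cyl A i x)) = bneg A (cyl A i x)"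
  using other_index[of i] axs_pair(5) by blast

lemma diag_refl: "diag A i i = bone A"
  using other_index[of i] axs_pair(6) one_in by blast

lemma diag_sym: "diag A i j = diag A j i"
  using axs_pair(7)[of i j "bone A" "bone A"] by (cases "i = j") auto

lemma cyl_diag: "i \<noteq> j \<Longrightarrow> cyl A i (diag A i j) = bone A"
  using axs_pair(8)[of i j "bone A" "bone A"] by auto

lemma diag_cyl_diag: "i \<noteq> j \<Longrightarrow> x \<in> carr A \<Longrightarrow>
  bmult A (diag A i j) (cyl A i (bmult A (diag A i j) x)) = bmult A (diag A i j) x"
  using axs_pair(9)[of i j x x] by auto

lemma cyl_diag_diag:
  assumes "j \<noteq> i" "j \<noteq> k"
  shows "cyl A j (bmult A (diag A i j) (diag A j k)) = diag A i k"
proof (cases "i = k")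
  case True
  then show ?thesis using assms cyl_diag[of j i] by (simp add: diag_sym mt_idem diag_refl)
next
  case False
  then show ?thesis using axs[of i j k "bone A" "bone A"] assms by auto
qed

lemma cyl_mono: "x \<in> carr A \<Longrightarrow> y \<in> carr A \<Longrightarrow> ble A x y \<Longrightarrow> ble A (cyl A i x) (cyl A i y)"
  by (metis ble_def cyl_pl)

lemma uf_cyl: "ufilter A F \<Longrightarrow> x \<in> carr A \<Longrightarrow> x \<in> F \<Longrightarrow> cyl A i x \<in> F"
  using cyl_ge ble_iff by (metis cyl_in)

lemma cyl_one: "cyl A i (bone A) = bone A"
  by (rule eqI) (auto simp: uf uf_cyl)

lemma cyl_zero: "cyl A i (bzero A) = bzero A"
  using cyl_ng_cyl[of "bone A" i] by (simp add: cyl_one bzero_def)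

lemma cyl_eq_zero: "x \<in> carr A \<Longrightarrow> cyl A i x = bzero A \<longleftrightarrow> x = bzero A"
proof
  assume x: "x \<in> carr A" and c: "cyl A i x = bzero A"
  show "x = bzero A" using x c uf_cyl uf_zero by (intro eqI) (simp, simp, metis)
qed (simp add: cyl_zero)

lemma cyl_ng: "x \<in> carr A \<Longrightarrow> cyl A i x = x \<Longrightarrow> cyl A i (bneg A x) = bneg A x"
  using cyl_ng_cyl by metis

text \<open>Split x into its parts below y and below -y. Since -y is closed too, c_i of the second
  part stays below -y, so below y only the first part counts.\<close>

lemma cyl_mt_closed:
  assumes x: "x \<in> carr A" "y \<in> carr A" "cyl A i y = y"
  shows "cyl A i (bmult A x y) = bmult A (cyl A i x) y"
proof -
  have n: "ble A (cyl A i (bmult A x (bneg A y))) (bneg A y)"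
    using cyl_mono[of "bmult A x (bneg A y)" "bneg A y" i] x by (auto simp: ble_iff uf cyl_ng)
  have p: "ble A (cyl A i (bmult A x y)) (bmult A (cyl A i x) y)"
    using cyl_mono[of "bmult A x y" "y" i] cyl_mono[of "bmult A x y" "x" i] x by (auto simp: ble_iff uf)
  have "x = bplus A (bmult A x y) (bmult A x (bneg A y))"
    using x by (intro eqI) (auto simp: uf)
  then have "cyl A i x = bplus A (cyl A i (bmult A x y)) (cyl A i (bmult A x (bneg A y)))"
    using x cyl_pl by (metis mt_in ng_in)
  then show ?thesis using x n p by (intro eqI) (auto simp: uf ble_iff)
qed

lemma cyl_mt_closed': "x \<in> carr A \<Longrightarrow> y \<in> carr A \<Longrightarrow> cyl A i x = x \<Longrightarrow>
  cyl A i (bmult A x y) = bmult A x (cyl A i y)"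
  using cyl_mt_closed[of y x i] by (metis mt_comm cyl_in)

lemma cyl_mt: "x \<in> carr A \<Longrightarrow> y \<in> carr A \<Longrightarrow> cyl A i x = x \<Longrightarrow> cyl A i y = y \<Longrightarrow>
  cyl A i (bmult A x y) = bmult A x y"
  by (simp add: cyl_mt_closed)

lemma cyl_diag_other: "i \<noteq> j \<Longrightarrow> i \<noteq> k \<Longrightarrow> cyl A i (diag A j k) = diag A j k"
  by (metis cyl_diag_diag cyl_idem mt_in diag_in)

lemma sub_in [simp]: "x \<in> carr A \<Longrightarrow> sub A i j x \<in> carr A"
  by (simp add: sub_def)

lemma cyl_sub: "x \<in> carr A \<Longrightarrow> cyl A i (sub A i j x) = sub A i j x"
  by (simp add: sub_def cyl_idem)

lemma sub_pl: "x \<in> carr A \<Longrightarrow> y \<in> carr A \<Longrightarrow> sub A i j (bplus A x y) = bplus A (sub A i j x) (sub A i j y)"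
  by (simp add: sub_def distrib cyl_pl)

lemma sub_closed: "i \<noteq> j \<Longrightarrow> x \<in> carr A \<Longrightarrow> cyl A i x = x \<Longrightarrow> sub A i j x = x"
  by (simp add: sub_def cyl_mt_closed cyl_diag) (metis mt_comm mt_one one_in)

text \<open>Complements are unique: the two substituted values have sum 1 by additivity, and product
  0 because \<open>diag_cyl_diag\<close> removes the inner cylindrification.\<close>

lemma sub_ng:
  assumes ij: "i \<noteq> j" and x: "x \<in> carr A"
  shows "sub A i j (bneg A x) = bneg A (sub A i j x)"
proof -
  have 1: "bplus A (sub A i j x) (sub A i j (bneg A x)) = bone A"
    using sub_pl[of x "bneg A x" i j] x ij by (simp add: one_eq sub_closed cyl_one)
  have "bmult A (sub A i j x) (sub A i j (bneg A x))
      = cyl A i (bmult A (bmult A (diag A i j) x) (sub A i j (bneg A x)))"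
    using x by (simp add: cyl_mt_closed cyl_sub) (simp add: sub_def)
  also have "bmult A (bmult A (diag A i j) x) (sub A i j (bneg A x))
      = bmult A x (bmult A (diag A i j) (cyl A i (bmult A (diag A i j) (bneg A x))))"
    using x by (intro eqI) (auto simp: uf sub_def)
  also have "\<dots> = bzero A" using x ij by (subst diag_cyl_diag) (auto simp: uf intro!: eqI)
  finally have 2: "bmult A (sub A i j x) (sub A i j (bneg A x)) = bzero A" by (simp add: cyl_zero)
  show ?thesis
  proof (rule eqI)
    fix F assume F: "ufilter A F"
    have "bplus A (sub A i j x) (sub A i j (bneg A x)) \<in> F" unfolding 1 using F by (rule uf_one)
    moreover have "bmult A (sub A i j x) (sub A i j (bneg A x)) \<notin> F" unfolding 2 using F by (rule uf_zero)
    ultimately show "sub A i j (bneg A x) \<in> F \<longleftrightarrow> bneg A (sub A i j x) \<in> F"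
      using F x by (auto simp: uf)
  qed (use x in auto)
qed

lemma sub_cyl_other:
  assumes "i \<noteq> j" "l \<noteq> i" "l \<noteq> j" "x \<in> carr A"
  shows "sub A i j (cyl A l x) = cyl A l (sub A i j x)"
proof -
  have "cyl A l (sub A i j x) = cyl A i (cyl A l (bmult A (diag A i j) x))"
    unfolding sub_def using assms cyl_comm by (metis mt_in diag_in)
  then show ?thesis using assms by (simp add: sub_def cyl_mt_closed' cyl_diag_other)
qed

lemma sub_cyl_same: "i \<noteq> j \<Longrightarrow> x \<in> carr A \<Longrightarrow> sub A i j (cyl A i x) = cyl A i x"
  by (simp add: sub_closed cyl_idem)

lemma sub_sub_comm:
  assumes "i \<noteq> k" "i \<noteq> j" "i \<noteq> l" "k \<noteq> j" "k \<noteq> l" "x \<in> carr A"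
  shows "sub A i j (sub A k l x) = sub A k l (sub A i j x)"
proof -
  have "sub A i j (sub A k l x) = cyl A i (cyl A k (bmult A (diag A i j) (bmult A (diag A k l) x)))"
    using assms by (simp add: sub_def cyl_mt_closed' cyl_diag_other)
  also have "bmult A (diag A i j) (bmult A (diag A k l) x) = bmult A (diag A k l) (bmult A (diag A i j) x)"
    using assms by (metis mt_assoc mt_comm diag_in)
  also have "cyl A i (cyl A k \<dots>) = cyl A k (cyl A i \<dots>)" using assms by (simp add: cyl_comm)
  also have "\<dots> = sub A k l (sub A i j x)"
    using assms by (simp add: sub_def cyl_mt_closed' cyl_diag_other)
  finally show ?thesis .
qed

lemma sub_diag: "i \<noteq> j \<Longrightarrow> i \<noteq> k \<Longrightarrow> sub A i j (diag A i k) = diag A j k"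
  unfolding sub_def using cyl_diag_diag[of i j k] by (simp add: diag_sym)

lemma sub_diag_other: "i \<noteq> j \<Longrightarrow> i \<noteq> k \<Longrightarrow> i \<noteq> l \<Longrightarrow> sub A i j (diag A k l) = diag A k l"
  by (simp add: sub_closed cyl_diag_other)

lemma sub_one: "i \<noteq> j \<Longrightarrow> sub A i j (bone A) = bone A"
  by (simp add: sub_closed cyl_one)

text \<open>The left inverse behind the injectivity of substitution on c_k-closed elements.\<close>

lemma sub_sub_back:
  assumes "i \<noteq> k" "x \<in> carr A" "cyl A k x = x"
  shows "sub A k i (sub A i k x) = x"
proof -
  have "sub A k i (sub A i k x) = cyl A k (bmult A (diag A i k) x)"
    using assms diag_cyl_diag[of i k x] by (simp add: sub_def diag_sym)
  also have "\<dots> = x" using assms sub_closed[of k i x] by (simp add: sub_def diag_sym)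
  finally show ?thesis .
qed

text \<open>Change of a bound variable: after k has been replaced by i, quantifying over i is the
  same as quantifying over k before. Renaming of indices and elimination of Henkin witnesses rest on
  it.\<close>

lemma cyl_sub_swap:
  assumes "i \<noteq> k" "x \<in> carr A" "cyl A i x = x"
  shows "cyl A i (sub A k i x) = cyl A k x"
proof -
  have "cyl A i (sub A k i x) = cyl A k (cyl A i (bmult A (diag A i k) x))"
    using assms by (simp add: sub_def diag_sym cyl_comm)
  also have "cyl A i (bmult A (diag A i k) x) = x"
    using assms sub_closed[of i k x] by (simp add: sub_def)
  finally show ?thesis .
qed

lemma diag_trans: "ufilter A F \<Longrightarrow> diag A i j \<in> F \<Longrightarrow> diag A j k \<in> F \<Longrightarrow> diag A i k \<in> F"
proof -
  assume F: "ufilter A F" "diag A i j \<in> F" "diag A j k \<in> F"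
  then have "bmult A (diag A i j) (diag A j k) \<in> F" by (simp add: uf)
  then have "cyl A j (bmult A (diag A i j) (diag A j k)) \<in> F" using F uf_cyl by simp
  then show ?thesis using cyl_diag_diag[of j i k] F by (cases "j = i"; cases "j = k") auto
qed

lemma diag_sub_le:
  assumes "i \<noteq> j" "i \<noteq> k" "x \<in> carr A"
  shows "ble A (bmult A (diag A j k) (sub A i j x)) (sub A i k x)"
proof -
  have "bmult A (diag A j k) (sub A i j x) = cyl A i (bmult A (diag A j k) (bmult A (diag A i j) x))"
    using assms by (simp add: sub_def cyl_mt_closed' cyl_diag_other)
  moreover have "ble A (bmult A (diag A j k) (bmult A (diag A i j) x)) (bmult A (diag A i k) x)"
    using assms diag_trans by (auto simp: ble_iff uf)
  ultimately show ?thesis unfolding sub_def using assms by (auto intro: cyl_mono)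
qed

lemma diag_le_sub:
  assumes "x \<in> carr A"
  shows "ble A (bmult A (diag A i j) x) (sub A i j x)"
  using assms by (simp add: sub_def cyl_ge)

end

section \<open>Terms and equations\<close>

primrec tvars :: "'i ca_term \<Rightarrow> nat set" where
  "tvars (Var n) = {n}"
| "tvars (Plus s t) = tvars s \<union> tvars t"
| "tvars (Neg t) = tvars t"
| "tvars (Cyl i t) = tvars t"
| "tvars (Diag i j) = {}"

primrec subst :: "(nat \<Rightarrow> 'i ca_term) \<Rightarrow> 'i ca_term \<Rightarrow> 'i ca_term" where
  "subst \<sigma> (Var n) = \<sigma> n"
| "subst \<sigma> (Plus s t) = Plus (subst \<sigma> s) (subst \<sigma> t)"
| "subst \<sigma> (Neg t) = Neg (subst \<sigma> t)"
| "subst \<sigma> (Cyl i t) = Cyl i (subst \<sigma> t)"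
| "subst \<sigma> (Diag i j) = Diag i j"

lemma finite_inds [simp]: "finite (inds t)"
  by (induction t) auto

lemma finite_eq_inds [simp]: "finite (eq_inds e)"
  by (simp add: eq_inds_def)

lemma finite_tvars [simp]: "finite (tvars t)"
  by (induction t) auto

lemma tval_cong: "(\<And>n. n \<in> tvars t \<Longrightarrow> v n = w n) \<Longrightarrow> tval A v t = tval A w t"
  by (induction t) auto

lemma tval_in: "closed_ops A \<Longrightarrow> (\<And>n. v n \<in> carr A) \<Longrightarrow> tval A v t \<in> carr A"
  by (induction t) (auto simp: closed_ops_def)

lemma tval_cyl_vars: "tval A v (cyl_vars i t) = tval A (\<lambda>n. cyl A i (v n)) t"
  by (induction t) auto

lemma tval_subst: "tval A v (subst \<sigma> t) = tval A (\<lambda>n. tval A v (\<sigma> n)) t"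
  by (induction t) auto

lemma inds_cyl_vars: "inds (cyl_vars i t) \<subseteq> insert i (inds t)"
  by (induction t) auto

lemma eq_inds_cyl_vars: "eq_inds (eq_cyl_vars i e) \<subseteq> insert i (eq_inds e)"
  using inds_cyl_vars by (fastforce simp: eq_inds_def eq_cyl_vars_def)

lemma eq_inds_rename: "eq_inds (eq_rename \<rho> e) = \<rho> ` eq_inds e"
  by (auto simp: eq_inds_def eq_rename_def ca_term.set_map)

lemma eq_rename_comp: "eq_rename \<rho> (eq_rename \<rho>' e) = eq_rename (\<rho> \<circ> \<rho>') e"
  by (simp add: eq_rename_def ca_term.map_comp)

lemma eq_rename_cong: "(\<And>i. i \<in> eq_inds e \<Longrightarrow> \<rho> i = \<rho>' i) \<Longrightarrow> eq_rename \<rho> e = eq_rename \<rho>' e"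
  by (auto simp: eq_rename_def eq_inds_def intro!: ca_term.map_cong)

lemma eq_rename_id: "(\<And>i. i \<in> eq_inds e \<Longrightarrow> \<rho> i = i) \<Longrightarrow> eq_rename \<rho> e = e"
  using eq_rename_cong[of e \<rho> id] by (simp add: eq_rename_def ca_term.map_id)

lemma validD: "valid A e \<Longrightarrow> (\<And>n. v n \<in> carr A) \<Longrightarrow> tval A v (fst e) = tval A v (snd e)"
  by (auto simp: valid_def)

lemma tval_hom:
  assumes h: "reduct_hom \<Gamma> A B h" and A: "closed_ops A" and v: "\<And>n. v n \<in> carr A" and i: "inds t \<subseteq> \<Gamma>"
  shows "tval B (h \<circ> v) t = h (tval A v t)"
  using i
proof (induction t)
  case (Plus s t)
  then show ?case using h tval_in[OF A, of v s] tval_in[OF A, of v t] v by (auto simp: reduct_hom_def)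
next
  case (Neg t)
  then show ?case using h tval_in[OF A, of v t] v by (auto simp: reduct_hom_def)
next
  case (Cyl i t)
  then show ?case using h tval_in[OF A, of v t] v by (auto simp: reduct_hom_def)
qed (use h in \<open>auto simp: reduct_hom_def\<close>)

text \<open>\<open>bone\<close> is a definite description and no equation can mention it, so the
  laws for 1 are replaced by the equality of all x + -x.\<close>

lemma boolean_algI:
  fixes B :: "('i, 'b) cyl_alg"
  assumes cl: "closed_ops B"
    and E: "\<And>x y z. x \<in> carr B \<Longrightarrow> y \<in> carr B \<Longrightarrow> z \<in> carr B \<Longrightarrow>
      bplus B x y = bplus B y x \<and> bmult B x y = bmult B y x \<and>
      bplus B (bplus B x y) z = bplus B x (bplus B y z) \<and>
      bmult B (bmult B x y) z = bmult B x (bmult B y z) \<and>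
      bplus B x (bmult B x y) = x \<and> bmult B x (bplus B x y) = x \<and>
      bmult B x (bplus B y z) = bplus B (bmult B x y) (bmult B x z) \<and>
      bplus B x (bmult B y z) = bmult B (bplus B x y) (bplus B x z) \<and>
      bplus B x (bneg B x) = bplus B y (bneg B y) \<and>
      bmult B x (bneg B x) = bneg B (bplus B x (bneg B x))"
  shows "boolean_alg B"
proof -
  obtain y0 where y0: "y0 \<in> carr B" using cl by (auto simp: closed_ops_def)
  have c: "\<And>x y. x \<in> carr B \<Longrightarrow> y \<in> carr B \<Longrightarrow> bplus B x y \<in> carr B" "\<And>x. x \<in> carr B \<Longrightarrow> bneg B x \<in> carr B"
    using cl by (auto simp: closed_ops_def)
  have one: "bone B = bplus B x (bneg B x)" if "x \<in> carr B" for x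
    unfolding bone_def using that E c by (intro the_equality) (blast, metis)
  show ?thesis unfolding boolean_alg_def bzero_def
    apply (intro conjI ballI)
    subgoal using E by blast
    subgoal using E by blast
    subgoal using E by blast
    subgoal using E by blast
    subgoal using E by blast
    subgoal using E by blast
    subgoal using E by blast
    subgoal using E by blast
    subgoal using one by simp
    subgoal for x using E[of x x x] one by simp
    done
qed

text \<open>The class of cylindric algebras is equational, so it is inherited along \<open>Eq\<close>.\<close>

lemma CA_if_Eq:
  fixes A :: "('i, 'a) cyl_alg" and B :: "('i, 'b) cyl_alg"
  assumes A: "A \<in> CA" and inf: "infinite (UNIV :: 'i set)" and cl: "closed_ops B"
    and Eq: "\<And>e. valid A e \<Longrightarrow> valid B e"
  shows "B \<in> CA"
proof -
  interpret cylindric A using A inf by unfold_locales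
  define w :: "'b \<Rightarrow> 'b \<Rightarrow> 'b \<Rightarrow> nat \<Rightarrow> 'b" where
    "w x y z n = (if n = 0 then x else if n = 1 then y else z)" for x y z n
  have w: "w x y z 0 = x" "w x y z (Suc 0) = y" "w x y z 2 = z" for x y z by (auto simp: w_def)
  have T: "tval B (w x y z) s = tval B (w x y z) t"
    if "\<And>v. (\<And>n. v n \<in> carr A) \<Longrightarrow> tval A v s = tval A v t" "x \<in> carr B" "y \<in> carr B" "z \<in> carr B" for x y z s t
  proof -
    have "valid A (s, t)" using that by (auto simp: valid_def)
    from validD[OF Eq[OF this], of "w x y z"] show ?thesis using that by (auto simp: w_def)
  qed
  define X Y Z :: "'i ca_term" where XYZ: "X = Var 0" "Y = Var 1" "Z = Var 2"
  define M where "M s t = Neg (Plus (Neg s) (Neg t))" for s t :: "'i ca_term"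
  have tM: "tval B v (M s t) = bmult B (tval B v s) (tval B v t)" for v s t by (simp add: M_def bmult_def)
  have tM': "tval A v (M s t) = bmult A (tval A v s) (tval A v t)" for v s t by (simp add: M_def bmult_def)
  note ts = tM w XYZ
  have distrib': "bplus A x (bmult A y z) = bmult A (bplus A x y) (bplus A x z)"
    if "x \<in> carr A" "y \<in> carr A" "z \<in> carr A" for x y z
    using that by (intro eqI) (auto simp: uf)
  have E: "bplus B x y = bplus B y x \<and> bmult B x y = bmult B y x \<and>
      bplus B (bplus B x y) z = bplus B x (bplus B y z) \<and>
      bmult B (bmult B x y) z = bmult B x (bmult B y z) \<and>
      bplus B x (bmult B x y) = x \<and> bmult B x (bplus B x y) = x \<and>
      bmult B x (bplus B y z) = bplus B (bmult B x y) (bmult B x z) \<and>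
      bplus B x (bmult B y z) = bmult B (bplus B x y) (bplus B x z) \<and>
      bplus B x (bneg B x) = bplus B y (bneg B y) \<and>
      bmult B x (bneg B x) = bneg B (bplus B x (bneg B x))"
    if xyz: "x \<in> carr B" "y \<in> carr B" "z \<in> carr B" for x y z
  proof -
    have 0: "tval B (w x y z) (Plus X Y) = tval B (w x y z) (Plus Y X)"
      by (rule T[OF _ xyz]) (simp add: tM' XYZ pl_comm)
    have 1: "tval B (w x y z) (M X Y) = tval B (w x y z) (M Y X)"
      by (rule T[OF _ xyz]) (simp add: tM' XYZ mt_comm)
    have 2: "tval B (w x y z) (Plus (Plus X Y) Z) = tval B (w x y z) (Plus X (Plus Y Z))"
      by (rule T[OF _ xyz]) (simp add: tM' XYZ pl_assoc)
    have 3: "tval B (w x y z) (M (M X Y) Z) = tval B (w x y z) (M X (M Y Z))"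
      by (rule T[OF _ xyz]) (simp add: tM' XYZ mt_assoc)
    have 4: "tval B (w x y z) (Plus X (M X Y)) = tval B (w x y z) (X)"
      by (rule T[OF _ xyz]) (simp add: tM' XYZ absorb1)
    have 5: "tval B (w x y z) (M X (Plus X Y)) = tval B (w x y z) (X)"
      by (rule T[OF _ xyz]) (simp add: tM' XYZ absorb2)
    have 6: "tval B (w x y z) (M X (Plus Y Z)) = tval B (w x y z) (Plus (M X Y) (M X Z))"
      by (rule T[OF _ xyz]) (simp add: tM' XYZ distrib)
    have 7: "tval B (w x y z) (Plus X (M Y Z)) = tval B (w x y z) (M (Plus X Y) (Plus X Z))"
      by (rule T[OF _ xyz]) (simp add: tM' XYZ distrib')
    have 8: "tval B (w x y z) (Plus X (Neg X)) = tval B (w x y z) (Plus Y (Neg Y))"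
      by (rule T[OF _ xyz]) (simp add: tM' XYZ one_eq)
    have 9: "tval B (w x y z) (M X (Neg X)) = tval B (w x y z) (Neg (Plus X (Neg X)))"
      by (rule T[OF _ xyz]) (simp add: tM' XYZ one_eq zero_eq bzero_def)
    show ?thesis using 0 1 2 3 4 5 6 7 8 9 by (simp add: ts)
  qed
  have ba: "boolean_alg B" by (rule boolean_algI[OF cl E])
  interpret B: bool_alg B using cl ba by unfold_locales
  have "cyl B i (cyl B j x) = cyl B j (cyl B i x) \<and>
          ble B x (cyl B i x) \<and> cyl B i x = cyl B i (cyl B i x) \<and>
          cyl B i (bplus B x y) = bplus B (cyl B i x) (cyl B i y) \<and>
          cyl B i (bneg B (cyl B i x)) = bneg B (cyl B i x) \<and>
          diag B i i = bone B \<and>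
          diag B i j = diag B j i \<and>
          cyl B j (bmult B (diag B i j) (diag B j k)) = diag B i k \<and>
          cyl B i (diag B i j) = bone B \<and>
          bmult B (diag B i j) (cyl B i (bmult B (diag B i j) x)) = bmult B (diag B i j) x"
    if ijk: "i \<noteq> j" "j \<noteq> k" "i \<noteq> k" and xy: "x \<in> carr B" "y \<in> carr B" for i j k x y
  proof -
    note a = axs[OF ijk]
    note xyz = xy xy(1)
    have one: "bplus B x (bneg B x) = bone B" using xy B.one_eq by simp
    have 0: "tval B (w x y x) (Cyl i (Cyl j X)) = tval B (w x y x) (Cyl j (Cyl i X))"
      by (rule T[OF _ xyz]) (use a in \<open>auto simp: tM' XYZ ble_def one_eq\<close>)
    have 1: "tval B (w x y x) (Plus X (Cyl i X)) = tval B (w x y x) (Cyl i X)"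
      by (rule T[OF _ xyz]) (use a in \<open>auto simp: tM' XYZ ble_def one_eq\<close>)
    have 2: "tval B (w x y x) (Cyl i X) = tval B (w x y x) (Cyl i (Cyl i X))"
      by (rule T[OF _ xyz]) (use a in \<open>auto simp: tM' XYZ ble_def one_eq\<close>)
    have 3: "tval B (w x y x) (Cyl i (Plus X Y)) = tval B (w x y x) (Plus (Cyl i X) (Cyl i Y))"
      by (rule T[OF _ xyz]) (use a in \<open>auto simp: tM' XYZ ble_def one_eq\<close>)
    have 4: "tval B (w x y x) (Cyl i (Neg (Cyl i X))) = tval B (w x y x) (Neg (Cyl i X))"
      by (rule T[OF _ xyz]) (use a in \<open>auto simp: tM' XYZ ble_def one_eq\<close>)
    have 5: "tval B (w x y x) (Diag i i) = tval B (w x y x) (Plus X (Neg X))"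
      by (rule T[OF _ xyz]) (use a in \<open>auto simp: tM' XYZ ble_def one_eq\<close>)
    have 6: "tval B (w x y x) (Diag i j) = tval B (w x y x) (Diag j i)"
      by (rule T[OF _ xyz]) (use a in \<open>auto simp: tM' XYZ ble_def one_eq\<close>)
    have 7: "tval B (w x y x) (Cyl j (M (Diag i j) (Diag j k))) = tval B (w x y x) (Diag i k)"
      by (rule T[OF _ xyz]) (use a in \<open>auto simp: tM' XYZ ble_def one_eq\<close>)
    have 8: "tval B (w x y x) (Cyl i (Diag i j)) = tval B (w x y x) (Plus X (Neg X))"
      by (rule T[OF _ xyz]) (use a in \<open>auto simp: tM' XYZ ble_def one_eq\<close>)
    have 9: "tval B (w x y x) (M (Diag i j) (Cyl i (M (Diag i j) X))) = tval B (w x y x) (M (Diag i j) X)"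
      by (rule T[OF _ xyz]) (use a in \<open>auto simp: tM' XYZ ble_def one_eq\<close>)
    show ?thesis using 0 1 2 3 4 5 6 7 8 9 by (simp add: ts one ble_def)
  qed
  then show ?thesis using cl ba unfolding CA_def by blast
qed

section \<open>Inductive algebras\<close>

context cylindric
begin

lemma tval_in' [simp]: "(\<And>n. v n \<in> carr A) \<Longrightarrow> tval A v t \<in> carr A"
  by (rule tval_in[OF closed])

lemma tval_closed_at:
  assumes "k \<notin> inds t" "\<And>n. v n \<in> carr A" "\<And>n. n \<in> tvars t \<Longrightarrow> cyl A k (v n) = v n"
  shows "cyl A k (tval A v t) = tval A v t"
  using assms(1,3)
proof (induction t)
  case (Plus s t)
  then show ?case using assms(2) by (simp add: cyl_pl)
next
  case (Neg t)
  then show ?case using assms(2) by (simp add: cyl_ng)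
next
  case (Cyl i t)
  then show ?case using assms(2) cyl_comm[of "tval A v t" k i] by simp
next
  case (Diag i j)
  then show ?case by (cases "i = j") (auto simp: diag_refl cyl_one cyl_diag_other)
qed auto

lemma sub_reduct_hom: "i \<noteq> j \<Longrightarrow> reduct_hom (- {i, j}) A A (sub A i j)"
  unfolding reduct_hom_def by (auto simp: sub_pl sub_ng sub_cyl_other sub_diag_other)

text \<open>Move the arguments to c_i-closed ones by substitution, use the hypothesis there, and
  return with \<open>sub_sub_back\<close>; the way back needs the values of both sides to be
  c_k-closed, hence k outside e.\<close>

lemma eq_on_closed:
  assumes i: "i \<notin> eq_inds e" "valid A (eq_cyl_vars i e)"
    and k: "k \<notin> eq_inds e" and v: "\<And>n. v n \<in> carr A" "\<And>n. cyl A k (v n) = v n"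
  shows "tval A v (fst e) = tval A v (snd e)"
proof -
  have *: "tval A w (fst e) = tval A w (snd e)" if "\<And>n. w n \<in> carr A" "\<And>n. cyl A i (w n) = w n" for w
    using validD[OF i(2), of w] that by (simp add: eq_cyl_vars_def tval_cyl_vars)
  show ?thesis
  proof (cases "i = k")
    case True then show ?thesis using * v by auto
  next
    case False
    let ?w = "sub A i k \<circ> v"
    have "tval A ?w (fst e) = tval A ?w (snd e)" using v by (intro *) (auto simp: cyl_sub)
    moreover have "tval A ?w t = sub A i k (tval A v t)" if "inds t \<subseteq> eq_inds e" for t
      using tval_hom[OF sub_reduct_hom[OF False] closed, of v t] i k v that by auto
    ultimately have "sub A i k (tval A v (fst e)) = sub A i k (tval A v (snd e))"
      by (simp add: eq_inds_def)
    moreover have "cyl A k (tval A v t) = tval A v t" if "inds t \<subseteq> eq_inds e" for t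
      using that k v by (intro tval_closed_at) auto
    ultimately show ?thesis using sub_sub_back[OF False] v by (metis eq_inds_def sup_ge1 sup_ge2 tval_in')
  qed
qed

end

lemma Edc_subset_Ind:
  fixes A :: "('i, 'a) cyl_alg"
  assumes "infinite (UNIV :: 'i set)" "A \<in> Edc"
  shows "A \<in> Ind"
proof -
  interpret cylindric A using assms by unfold_locales (auto simp: Edc_def)
  have "tval A v (fst e) = tval A v (snd e)"
    if i: "i \<notin> eq_inds e" "valid A (eq_cyl_vars i e)" and v: "\<And>n. v n \<in> carr A" for e i v
  proof (rule ccontr)
    let ?s = "tval A v (fst e)" and ?t = "tval A v (snd e)"
    \<comment> \<open>The symmetric difference of the two sides. An endomorphism that keeps it
      nonzero carries the failure of e to c_k-closed arguments.\<close>
    let ?x = "bplus A (bmult A ?s (bneg A ?t)) (bmult A ?t (bneg A ?s))"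
    assume "?s \<noteq> ?t"
    have st: "?s \<in> carr A" "?t \<in> carr A" using v by auto
    have "?x \<noteq> bzero A"
    proof
      assume "?x = bzero A"
      then have "?x \<notin> F" if "ufilter A F" for F using uf_zero that by simp
      then have "?s = ?t" using st by (intro eqI) (auto simp: uf)
      then show False using \<open>?s \<noteq> ?t\<close> by simp
    qed
    then obtain k h where h: "k \<notin> eq_inds e" "reduct_hom (eq_inds e) A A h" "h ?x \<noteq> bzero A"
      "\<And>a. a \<in> carr A \<Longrightarrow> cyl A k (h a) = h a"
      using \<open>A \<in> Edc\<close> st unfolding Edc_def by (auto simp del: tval_in') (metis finite_eq_inds mt_in ng_in pl_in)
    have hin: "\<And>a. a \<in> carr A \<Longrightarrow> h a \<in> carr A" using h(2) by (auto simp: reduct_hom_def)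
    have "tval A (h \<circ> v) (fst e) = tval A (h \<circ> v) (snd e)"
      by (rule eq_on_closed[OF i h(1)]) (use h v hin in auto)
    then have "h ?s = h ?t" using tval_hom[OF h(2) closed v] by (simp add: eq_inds_def)
    moreover have hp: "h (bplus A a b) = bplus A (h a) (h b)" "h (bneg A a) = bneg A (h a)"
      if "a \<in> carr A" "b \<in> carr A" for a b using h(2) that by (auto simp: reduct_hom_def)
    have "h (bmult A a b) = bmult A (h a) (h b)" if "a \<in> carr A" "b \<in> carr A" for a b
      using that hp by (simp add: bmult_def)
    ultimately have "h ?x = bplus A (bmult A (h ?s) (bneg A (h ?s))) (bmult A (h ?s) (bneg A (h ?s)))"
      using st hp by simp
    also have "\<dots> = bzero A" using hin st by (simp add: zero_eq pl_zero)
    finally show False using h(3) by simp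
  qed
  then show ?thesis using CA by (auto simp: Ind_def valid_def)
qed

lemma Lf_subset_Ind:
  fixes A :: "('i, 'a) cyl_alg"
  assumes "infinite (UNIV :: 'i set)" "A \<in> Lf"
  shows "A \<in> Ind"
proof -
  interpret cylindric A using assms by unfold_locales (auto simp: Lf_def)
  have "tval A v (fst e) = tval A v (snd e)"
    if i: "i \<notin> eq_inds e" "valid A (eq_cyl_vars i e)" and v: "\<And>n. v n \<in> carr A" for e i v
  proof -
    let ?N = "tvars (fst e) \<union> tvars (snd e)"
    have "finite (eq_inds e \<union> (\<Union>n\<in>?N. {i. cyl A i (v n) \<noteq> v n}))"
      using v \<open>A \<in> Lf\<close> by (auto simp: Lf_def)
    then obtain k where k: "k \<notin> eq_inds e \<union> (\<Union>n\<in>?N. {i. cyl A i (v n) \<noteq> v n})"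
      using fresh_index by blast
    \<comment> \<open>Variables outside the equation get the value 1, which is closed under every
      cylindrification.\<close>
    let ?w = "\<lambda>n. if n \<in> ?N then v n else bone A"
    have "tval A ?w (fst e) = tval A ?w (snd e)"
      by (rule eq_on_closed[OF i]) (use k v in \<open>auto simp: cyl_one\<close>)
    moreover have "tval A ?w (fst e) = tval A v (fst e)" "tval A ?w (snd e) = tval A v (snd e)"
      by (auto intro!: tval_cong)
    ultimately show ?thesis by simp
  qed
  then show ?thesis using CA by (auto simp: Ind_def valid_def)
qed

section \<open>Renaming of indices in inductive algebras\<close>

locale inductive_alg =
  fixes A :: "('i, 'a) cyl_alg"
  assumes Ind: "A \<in> Ind" and inf: "infinite (UNIV :: 'i set)"
begin

sublocale cylindric A
  using Ind inf by unfold_locales (auto simp: Ind_def)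

lemma remove_cyl_vars: "i \<notin> eq_inds e \<Longrightarrow> valid A (eq_cyl_vars i e) \<Longrightarrow> valid A e"
  using Ind unfolding Ind_def by blast

text \<open>Inductivity, one index at a time: passing from e(x) to e(c_i x) lets the arguments be
  c_i-closed, and commuting cylindrifications preserve the closedness already obtained.\<close>

lemma inductive_finite:
  assumes "finite Z" "Z \<inter> eq_inds e = {}"
    and "\<And>w. (\<And>n. w n \<in> carr A) \<Longrightarrow> (\<And>n i. i \<in> Z \<Longrightarrow> cyl A i (w n) = w n) \<Longrightarrow>
      tval A w (fst e) = tval A w (snd e)"
  shows "valid A e"
  using assms
proof (induction Z arbitrary: e)
  case empty
  then show ?case by (auto simp: valid_def)
next
  case (insert i Z)
  have "valid A (eq_cyl_vars i e)"
  proof (rule insert.IH)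
    show "Z \<inter> eq_inds (eq_cyl_vars i e) = {}" using insert eq_inds_cyl_vars[of i e] by auto
    fix w :: "nat \<Rightarrow> 'a" assume w: "\<And>n. w n \<in> carr A" "\<And>n i. i \<in> Z \<Longrightarrow> cyl A i (w n) = w n"
    have "tval A (\<lambda>n. cyl A i (w n)) (fst e) = tval A (\<lambda>n. cyl A i (w n)) (snd e)"
    proof (rule insert.prems)
      show "cyl A j (cyl A i (w n)) = cyl A i (w n)" if "j \<in> insert i Z" for j n
        using that w cyl_comm[of "w n" j i] by (auto simp: cyl_idem)
    qed (use w in auto)
    then show "tval A w (fst (eq_cyl_vars i e)) = tval A w (snd (eq_cyl_vars i e))"
      by (simp add: eq_cyl_vars_def tval_cyl_vars)
  qed
  moreover have "i \<notin> eq_inds e" using insert.prems(1) by auto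
  ultimately show ?case using remove_cyl_vars by blast
qed

text \<open>Bound renaming for whole terms. The case of \<open>Cyl i\<close> is
  \<open>cyl_sub_swap\<close>, which applies because i is gone after renaming and the arguments are
  c_i-closed.\<close>

lemma tval_swap_index:
  assumes ik: "i \<noteq> k" and k: "k \<notin> inds t" and w: "\<And>n. w n \<in> carr A" "\<And>n. cyl A i (w n) = w n"
  shows "sub A k i (tval A w (rename (id(i := k)) t)) = tval A (\<lambda>n. sub A k i (w n)) t"
proof -
  define f where "f = id(i := k)"
  have f: "f i = k" "\<And>l. l \<noteq> i \<Longrightarrow> f l = l" by (auto simp: f_def)
  have "sub A k i (tval A w (rename f t)) = tval A (\<lambda>n. sub A k i (w n)) t"
    using k
  proof (induction t)
    case (Cyl l t)
    let ?y = "tval A w (rename f t)"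
    have "i \<notin> inds (rename f t)" using ik by (auto simp: ca_term.set_map f_def)
    then have "cyl A i ?y = ?y" using w by (intro tval_closed_at) auto
    then show ?case using Cyl ik w f
      by (cases "l = i") (auto simp: sub_cyl_same sub_cyl_other cyl_sub_swap simp flip: Cyl.IH)
  next
    case (Diag l m)
    then show ?case using ik sub_diag[of k i] diag_sym f
      by (cases "l = i"; cases "m = i") (auto simp: sub_diag_other diag_refl sub_one)
  qed (use ik w in \<open>auto simp: sub_pl sub_ng\<close>)
  then show ?thesis by (simp add: f_def)
qed

text \<open>The renamed equation has lost i, so by inductivity it may be tested at c_i-closed
  arguments. There \<open>sub A k i\<close> turns it into an instance of e, and
  \<open>sub A i k\<close> undoes this.\<close>

lemma valid_swap_index:
  assumes e: "valid A e" and k: "k \<notin> eq_inds e"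
  shows "valid A (eq_rename (id(i := k)) e)"
proof (cases "i = k")
  case True
  then show ?thesis using e by (simp add: eq_rename_id)
next
  case False
  have "i \<notin> eq_inds (eq_rename (id(i := k)) e)" using False by (auto simp: eq_inds_rename)
  moreover have "valid A (eq_cyl_vars i (eq_rename (id(i := k)) e))"
    unfolding valid_def
  proof (intro allI impI)
    fix v :: "nat \<Rightarrow> 'a" assume v: "\<forall>n. v n \<in> carr A"
    let ?w = "\<lambda>n. cyl A i (v n)"
    have w: "\<And>n. ?w n \<in> carr A" "\<And>n. cyl A i (?w n) = ?w n" using v by (auto simp: cyl_idem)
    have "tval A (\<lambda>n. sub A k i (?w n)) (fst e) = tval A (\<lambda>n. sub A k i (?w n)) (snd e)"
      using e v by (intro validD) auto
    then have eq: "sub A k i (tval A ?w (rename (id(i := k)) (fst e))) = sub A k i (tval A ?w (rename (id(i := k)) (snd e)))"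
      using tval_swap_index[OF False _ w] k by (simp add: eq_inds_def)
    have bk: "sub A i k (sub A k i (tval A ?w (rename (id(i := k)) t))) = tval A ?w (rename (id(i := k)) t)" for t
    proof (rule sub_sub_back)
      have "i \<notin> inds (rename (id(i := k)) t)" using False by (auto simp: ca_term.set_map)
      then show "cyl A i (tval A ?w (rename (id(i := k)) t)) = tval A ?w (rename (id(i := k)) t)"
        using w by (intro tval_closed_at) auto
    qed (use False w in auto)
    have "tval A ?w (rename (id(i := k)) (fst e)) = tval A ?w (rename (id(i := k)) (snd e))"
      using arg_cong[OF eq, of "sub A i k"] unfolding bk .
    then show "tval A v (fst (eq_cyl_vars i (eq_rename (id(i := k)) e)))
        = tval A v (snd (eq_cyl_vars i (eq_rename (id(i := k)) e)))"
      by (simp add: eq_cyl_vars_def eq_rename_def tval_cyl_vars)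
  qed
  ultimately show ?thesis by (rule remove_cyl_vars)
qed

lemma valid_rename_disjoint:
  assumes e: "valid A e" and \<rho>: "inj_on \<rho> (eq_inds e)" "\<rho> ` eq_inds e \<inter> eq_inds e = {}"
  shows "valid A (eq_rename \<rho> e)"
proof -
  have "valid A (eq_rename (\<lambda>x. if x \<in> S then \<rho> x else x) e)" if "finite S" "S \<subseteq> eq_inds e" for S
    using that
  proof (induction S)
    case empty
    then show ?case using e by (simp add: eq_rename_id)
  next
    case (insert i S)
    let ?f = "\<lambda>S x. if x \<in> S then \<rho> x else x"
    have "\<rho> i \<notin> \<rho> ` S" "\<rho> i \<notin> eq_inds e"
      using insert \<rho> by (auto dest: inj_onD)
    then have "\<rho> i \<notin> eq_inds (eq_rename (?f S) e)" by (auto simp: eq_inds_rename)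
    then have "valid A (eq_rename (id(i := \<rho> i)) (eq_rename (?f S) e))"
      using insert by (intro valid_swap_index) auto
    moreover have "(id(i := \<rho> i) \<circ> ?f S) x = ?f (insert i S) x" if "x \<in> eq_inds e" for x
      using that insert \<rho>(2) by auto
    ultimately show ?case unfolding eq_rename_comp using eq_rename_cong[of e "id(i := \<rho> i) \<circ> ?f S" "?f (insert i S)"] by simp
  qed
  from this[of "eq_inds e"] show ?thesis
    using eq_rename_cong[of e \<rho> "\<lambda>x. if x \<in> eq_inds e then \<rho> x else x"] by simp
qed

text \<open>Replacing one index at a time requires targets that do not occur, which fails for
  permutations. The detour leads through a set T disjoint from both the old and the new
  indices.\<close>

lemma valid_rename:
  assumes e: "valid A e" and \<rho>: "inj_on \<rho> (eq_inds e)"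
  shows "valid A (eq_rename \<rho> e)"
proof -
  let ?D = "eq_inds e" and ?N = "eq_inds e \<union> \<rho> ` eq_inds e"
  have "infinite (- ?N)" using inf by (simp add: Compl_eq_Diff_UNIV)
  then obtain T where T: "T \<subseteq> - ?N" "finite T" "card T = card ?D"
    using infinite_arbitrarily_large[of "- ?N" "card ?D"] by auto
  then obtain \<phi> where \<phi>: "bij_betw \<phi> ?D T"
    using finite_same_card_bij[of ?D T] by auto
  then have i\<phi>: "inj_on \<phi> ?D" "\<phi> ` ?D = T" by (auto simp: bij_betw_def)
  have v: "valid A (eq_rename \<phi> e)"
    using T by (intro valid_rename_disjoint[OF e i\<phi>(1)]) (auto simp: i\<phi>(2))
  let ?\<psi> = "\<rho> \<circ> the_inv_into ?D \<phi>"
  have \<psi>: "?\<psi> (\<phi> x) = \<rho> x" if "x \<in> ?D" for x using the_inv_into_f_f[OF i\<phi>(1) that] by simp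
  have "inj_on ?\<psi> T"
    using \<rho> \<psi> unfolding i\<phi>(2)[symmetric] by (auto intro!: inj_onI simp: inj_on_eq_iff simp del: o_apply)
  moreover have "?\<psi> ` T \<inter> T = {}" using T \<psi> unfolding i\<phi>(2)[symmetric] by (auto simp del: o_apply)
  ultimately have "valid A (eq_rename ?\<psi> (eq_rename \<phi> e))"
    by (intro valid_rename_disjoint v) (simp_all add: eq_inds_rename i\<phi>(2))
  then show ?thesis unfolding eq_rename_comp
    using eq_rename_cong[of e "?\<psi> \<circ> \<phi>" \<rho>] \<psi> by simp
qed

end

lemma Ind_subset_Sy:
  fixes A :: "('i, 'a) cyl_alg"
  assumes "infinite (UNIV :: 'i set)" "A \<in> Ind"
  shows "A \<in> Sy"
proof -
  interpret inductive_alg A using assms by unfold_locales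
  show ?thesis using CA valid_rename inj_on_subset[OF bij_is_inj subset_UNIV] unfolding Sy_def by blast
qed

lemma Ind_if_Eq:
  assumes "A \<in> CA" "B \<in> Ind" "Eq A = Eq B"
  shows "A \<in> Ind"
proof -
  have "valid A = valid B" using assms(3) by (intro ext) (auto simp: Eq_def set_eq_iff)
  then show ?thesis using assms unfolding Ind_def by simp
qed

section \<open>The locally finite algebra of terms\<close>

locale term_model = inductive_alg A for A :: "('i, 'a) cyl_alg" +
  fixes g :: "nat \<Rightarrow> 'i"
  assumes g: "inj g"
begin

text \<open>Growing sets: every finite part of the range of \<open>g\<close> lies in all but
  finitely many \<open>G n\<close>, so infinitely many generators are unrestricted on it.\<close>

definition G :: "nat \<Rightarrow> 'i set" where
  "G n = g ` {..n}"

definition ok :: "'i set \<Rightarrow> (nat \<Rightarrow> 'a) \<Rightarrow> bool" where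
  "ok \<Delta> v \<longleftrightarrow> (\<forall>n. v n \<in> carr A) \<and> (\<forall>n. \<forall>i\<in>\<Delta> - G n. cyl A i (v n) = v n)"

text \<open>Derivability from the equations of A and the relations c_i x_n = x_n for i outside
  \<open>G n\<close>. Compactness is built in by the finite \<open>\<Delta>\<close>, since A may
  have too few elements that satisfy infinitely many of these relations.\<close>

definition teq :: "'i ca_term \<Rightarrow> 'i ca_term \<Rightarrow> bool" where
  "teq s t \<longleftrightarrow> (\<exists>\<Delta>. finite \<Delta> \<and> (\<forall>v. ok \<Delta> v \<longrightarrow> tval A v s = tval A v t))"

definition cls :: "'i ca_term \<Rightarrow> 'i ca_term set" where
  "cls s = {t. teq s t}"

definition rep :: "'i ca_term set \<Rightarrow> 'i ca_term" where
  "rep X = (SOME t. cls t = X)"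

definition TM :: "('i, 'i ca_term set) cyl_alg" where
  "TM = \<lparr>carr = range cls,
    bplus = (\<lambda>X Y. cls (Plus (rep X) (rep Y))),
    bneg = (\<lambda>X. cls (Neg (rep X))),
    cyl = (\<lambda>i X. cls (Cyl i (rep X))),
    diag = (\<lambda>i j. cls (Diag i j))\<rparr>"

lemma ok_mono: "\<Delta> \<subseteq> \<Delta>' \<Longrightarrow> ok \<Delta>' v \<Longrightarrow> ok \<Delta> v"
  unfolding ok_def by blast

lemma teqI: "(\<And>v. (\<And>n. v n \<in> carr A) \<Longrightarrow> tval A v s = tval A v t) \<Longrightarrow> teq s t"
  unfolding teq_def ok_def by blast

lemma teq2:
  assumes "teq s s'" "teq t t'"
  obtains \<Delta> where "finite \<Delta>" "\<And>v. ok \<Delta> v \<Longrightarrow> tval A v s = tval A v s' \<and> tval A v t = tval A v t'"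
proof -
  obtain D E where "finite D" "\<And>v. ok D v \<Longrightarrow> tval A v s = tval A v s'"
    "finite E" "\<And>v. ok E v \<Longrightarrow> tval A v t = tval A v t'"
    using assms unfolding teq_def by blast
  then show ?thesis
    using that[of "D \<union> E"] ok_mono[of D "D \<union> E"] ok_mono[of E "D \<union> E"] by auto
qed

lemma teq_refl: "teq t t"
  by (rule teqI) simp

lemma teq_sym: "teq s t \<Longrightarrow> teq t s"
  unfolding teq_def by metis

lemma teq_trans: "teq s t \<Longrightarrow> teq t u \<Longrightarrow> teq s u"
  by (elim teq2[of s t t u]) (auto simp: teq_def)

lemma teq_Plus: "teq s s' \<Longrightarrow> teq t t' \<Longrightarrow> teq (Plus s t) (Plus s' t')"
  by (elim teq2[of s s' t t']) (auto simp: teq_def)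

lemma teq_Neg: "teq s s' \<Longrightarrow> teq (Neg s) (Neg s')"
  by (auto simp: teq_def)

lemma teq_Cyl: "teq s s' \<Longrightarrow> teq (Cyl i s) (Cyl i s')"
  by (auto simp: teq_def)

lemma cls_eq: "cls s = cls t \<longleftrightarrow> teq s t"
  unfolding cls_def using teq_refl teq_sym teq_trans by blast

lemma teq_rep: "teq (rep (cls t)) t"
  unfolding cls_eq[symmetric] rep_def by (rule someI) simp

lemma TM_ops:
  "bplus TM (cls s) (cls t) = cls (Plus s t)"
  "bneg TM (cls s) = cls (Neg s)"
  "cyl TM i (cls s) = cls (Cyl i s)"
  "diag TM i j = cls (Diag i j)"
  by (simp_all add: TM_def cls_eq teq_Plus teq_Neg teq_Cyl teq_rep)

lemma closed_TM: "closed_ops TM"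
  unfolding closed_ops_def by (auto simp: TM_def)

lemma tval_TM: "tval TM (\<lambda>n. cls (\<sigma> n)) t = cls (subst \<sigma> t)"
  by (induction t) (auto simp: TM_ops)

lemma carr_TM: "(\<And>n. v n \<in> carr TM) \<Longrightarrow> \<exists>\<sigma>. v = (\<lambda>n. cls (\<sigma> n))"
  by (simp add: TM_def image_iff) metis

lemma valid_TM: "valid A e \<Longrightarrow> valid TM e"
  unfolding valid_def[of TM]
proof (intro allI impI)
  fix v :: "nat \<Rightarrow> 'i ca_term set" assume e: "valid A e" and "\<forall>n. v n \<in> carr TM"
  then obtain \<sigma> where "v = (\<lambda>n. cls (\<sigma> n))" using carr_TM by auto
  moreover have "teq (subst \<sigma> (fst e)) (subst \<sigma> (snd e))"
    using e by (intro teqI) (auto simp: tval_subst intro: validD)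
  ultimately show "tval TM v (fst e) = tval TM v (snd e)" by (simp add: tval_TM cls_eq)
qed

lemma TM_CA: "TM \<in> CA"
  by (rule CA_if_Eq[OF CA inf closed_TM valid_TM])

lemma TM_Lf: "TM \<in> Lf"
proof -
  have "finite {i. cyl TM i (cls t) \<noteq> cls t}" for t
  proof (rule finite_subset)
    show "finite (inds t \<union> (\<Union>n\<in>tvars t. G n))" by (simp add: G_def)
    have "cyl TM i (cls t) = cls t" if i: "i \<notin> inds t \<union> (\<Union>n\<in>tvars t. G n)" for i
    proof -
      have "cyl A i (tval A v t) = tval A v t" if "ok {i} v" for v
        using that i by (intro tval_closed_at) (auto simp: ok_def)
      then have "teq (Cyl i t) t" unfolding teq_def by (intro exI[of _ "{i}"]) simp
      then show ?thesis by (simp add: TM_ops cls_eq)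
    qed
    then show "{i. cyl TM i (cls t) \<noteq> cls t} \<subseteq> inds t \<union> (\<Union>n\<in>tvars t. G n)" by blast
  qed
  then show ?thesis using TM_CA by (auto simp: Lf_def TM_def)
qed

text \<open>Test the renamed equation at the generators m, m+1, ..., whose dimension sets contain
  all its indices. The finitely many relations used then concern indices outside \<open>G m\<close>,
  hence outside the equation, and \<open>inductive_finite\<close> removes them.\<close>

lemma valid_if_valid_TM:
  assumes e: "valid TM e"
  shows "valid A e"
proof -
  interpret T: inductive_alg TM
    using Lf_subset_Ind[OF inf TM_Lf] inf by unfold_locales
  \<comment> \<open>The sets \<open>G n\<close> only exhaust the range of \<open>g\<close>, so the
    indices of e are first renamed into it; in both algebras validity survives injective
    renaming.\<close>
  obtain f :: "'i \<Rightarrow> nat" and m where f: "f ` eq_inds e = {i. i < m}" "inj_on f (eq_inds e)"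
    using finite_imp_inj_to_nat_seg[OF finite_eq_inds[of e]] by blast
  let ?\<rho> = "g \<circ> f"
  have \<rho>: "inj_on ?\<rho> (eq_inds e)" using f(2) g by (auto intro: comp_inj_on inj_on_subset)
  let ?e = "eq_rename ?\<rho> e"
  have "valid TM ?e" using T.valid_rename[OF e \<rho>] .
  moreover have "cls (Var (m + n)) \<in> carr TM" for n by (simp add: TM_def)
  ultimately have "tval TM (\<lambda>n. cls (Var (m + n))) (fst ?e) = tval TM (\<lambda>n. cls (Var (m + n))) (snd ?e)"
    by (intro validD)
  then have "teq (subst (\<lambda>n. Var (m + n)) (fst ?e)) (subst (\<lambda>n. Var (m + n)) (snd ?e))"
    by (simp only: tval_TM cls_eq)
  then obtain D where D: "finite D"
    "\<And>v. ok D v \<Longrightarrow> tval A (\<lambda>n. v (m + n)) (fst ?e) = tval A (\<lambda>n. v (m + n)) (snd ?e)"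
    by (auto simp: teq_def tval_subst)
  have "f x < m" if "x \<in> eq_inds e" for x using f(1) that by (auto simp: set_eq_iff)
  then have "eq_inds ?e \<subseteq> G m" by (force simp: eq_inds_rename G_def)
  have "valid A ?e"
  proof (rule inductive_finite)
    show "finite (D - G m)" "(D - G m) \<inter> eq_inds ?e = {}" using D(1) \<open>eq_inds ?e \<subseteq> G m\<close> by auto
    fix w :: "nat \<Rightarrow> 'a" assume w: "\<And>n. w n \<in> carr A" "\<And>n i. i \<in> D - G m \<Longrightarrow> cyl A i (w n) = w n"
    \<comment> \<open>Generators below m do not occur in the equation; 1 satisfies all their
      relations.\<close>
    let ?v = "\<lambda>n. if m \<le> n then w (n - m) else bone A"
    have "i \<notin> G m" if "m \<le> n" "i \<notin> G n" for n i using that by (auto simp: G_def)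
    then have "ok D ?v" using w by (auto simp: ok_def cyl_one)
    then show "tval A w (fst ?e) = tval A w (snd ?e)" using D(2)[of ?v] by simp
  qed
  then have "valid A (eq_rename (the_inv_into (eq_inds e) ?\<rho>) ?e)"
    by (rule valid_rename) (unfold eq_inds_rename, rule inj_on_the_inv_into[OF \<rho>])
  moreover have "eq_rename (the_inv_into (eq_inds e) ?\<rho>) ?e = e"
    unfolding eq_rename_comp using the_inv_into_f_f[OF \<rho>] by (intro eq_rename_id) simp
  ultimately show ?thesis by simp
qed

lemma Eq_TM: "Eq A = Eq TM"
  unfolding Eq_def using valid_TM valid_if_valid_TM by blast

end

text \<open>The clause on \<open>carr B\<close> bounds the size of B by the number of terms, that is
  by |\<alpha>|; a later counting argument depends on it.\<close>

lemma Ind_has_Lf: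
  fixes A :: "('i, 'a) cyl_alg"
  assumes inf: "infinite (UNIV :: 'i set)" and "A \<in> Ind"
  shows "\<exists>B \<in> (Lf :: ('i, 'i ca_term set) cyl_alg set). Eq A = Eq B \<and>
    (\<exists>f :: 'i ca_term \<Rightarrow> 'i ca_term set. carr B = range f)"
proof -
  obtain g :: "nat \<Rightarrow> 'i" where "inj g" using infinite_countable_subset[OF inf] by auto
  then interpret term_model A g using assms by unfold_locales
  have "carr TM = range cls" by (simp add: TM_def)
  then show ?thesis using TM_Lf Eq_TM by blast
qed

section \<open>Representing finite reducts of inductive algebras\<close>

text \<open>The numerical tag separates the constructors when a datatype over \<open>'x\<close> is
  coded in \<open>'x\<close>.\<close>

lemma infinite_pairing:
  assumes "infinite (UNIV :: 'x set)"
  obtains p :: "nat \<Rightarrow> 'x \<Rightarrow> 'x \<Rightarrow> 'x"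
  where "\<And>m x y n x' y'. p m x y = p n x' y' \<longleftrightarrow> m = n \<and> x = x' \<and> y = y'"
proof -
  have "(card_of (UNIV \<times> UNIV :: ('x \<times> 'x) set), card_of (UNIV :: 'x set)) \<in> ordLeq"
    using card_of_Times_same_infinite[OF assms] by (rule ordIso_imp_ordLeq)
  then obtain q :: "'x \<times> 'x \<Rightarrow> 'x" where q: "inj q"
    unfolding card_of_ordLeq[symmetric] by auto
  obtain c :: "nat \<Rightarrow> 'x" where "inj c" using infinite_countable_subset[OF assms] by auto
  then show thesis
    using that[of "\<lambda>n x y. q (c n, q (x, y))"] q by (simp add: inj_eq)
qed

text \<open>Indices of a Henkin language: \<open>Wit j t\<close> is a witness for \<open>c\<^sub>j t\<close>.\<close>

datatype ('i, 'v) ix = Base 'i | Wit "('i, 'v) ix" "('i, 'v) tm"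
  and ('i, 'v) tm = TVar 'v | TPlus "('i, 'v) tm" "('i, 'v) tm" | TNeg "('i, 'v) tm"
  | TCyl "('i, 'v) ix" "('i, 'v) tm" | TDiag "('i, 'v) ix" "('i, 'v) ix"

lemma tm_induct [case_names TVar TPlus TNeg TCyl TDiag]:
  assumes "\<And>v. P (TVar v)" "\<And>s t. P s \<Longrightarrow> P t \<Longrightarrow> P (TPlus s t)" "\<And>t. P t \<Longrightarrow> P (TNeg t)"
    "\<And>j t. P t \<Longrightarrow> P (TCyl j t)" "\<And>j k. P (TDiag j k)"
  shows "P t"
  by (rule tm.induct[of "\<lambda>_. True" P]) (use assms in auto)

primrec code_ix :: "(nat \<Rightarrow> 'x \<Rightarrow> 'x \<Rightarrow> 'x) \<Rightarrow> ('i \<Rightarrow> 'x) \<Rightarrow> ('v \<Rightarrow> 'x) \<Rightarrow> ('i, 'v) ix \<Rightarrow> 'x"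
  and code_tm :: "(nat \<Rightarrow> 'x \<Rightarrow> 'x \<Rightarrow> 'x) \<Rightarrow> ('i \<Rightarrow> 'x) \<Rightarrow> ('v \<Rightarrow> 'x) \<Rightarrow> ('i, 'v) tm \<Rightarrow> 'x" where
  "code_ix p b a (Base i) = p 0 (b i) (b i)"
| "code_ix p b a (Wit j t) = p 1 (code_ix p b a j) (code_tm p b a t)"
| "code_tm p b a (TVar v) = p 0 (a v) (a v)"
| "code_tm p b a (TPlus s t) = p 1 (code_tm p b a s) (code_tm p b a t)"
| "code_tm p b a (TNeg t) = p 2 (code_tm p b a t) (code_tm p b a t)"
| "code_tm p b a (TCyl j t) = p 3 (code_ix p b a j) (code_tm p b a t)"
| "code_tm p b a (TDiag j k) = p 4 (code_ix p b a j) (code_ix p b a k)"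

lemma code_inj:
  fixes x y :: "('i, 'v) ix" and s t :: "('i, 'v) tm"
  assumes p: "\<And>m x y n x' y'. p m x y = p n x' y' \<longleftrightarrow> m = n \<and> x = x' \<and> y = y'" and "inj b" "inj a"
  shows "code_ix p b a x = code_ix p b a y \<longleftrightarrow> x = y" "code_tm p b a s = code_tm p b a t \<longleftrightarrow> s = t"
proof (induction x and s arbitrary: y and t)
  case (Base i y) then show ?case using assms by (cases y) (auto simp: inj_eq)
next
  case (Wit j t y) then show ?case using assms by (cases y) auto
next
  case (TVar v t) then show ?case using assms by (cases t) (auto simp: inj_eq)
next
  case (TPlus r s t) then show ?case using assms by (cases t) auto
next
  case (TNeg s t) then show ?case using assms by (cases t) auto
next
  case (TCyl j s t) then show ?case using assms by (cases t) auto
next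
  case (TDiag j k t) then show ?case using assms by (cases t) auto
qed

text \<open>Henkin indices become base points of representations, and \<open>RCA\<close> prescribes
  the type of the base; they therefore have to fit into \<open>'a + 'i\<close>.\<close>

lemma ix_embeds:
  assumes "infinite (UNIV :: 'i set)"
  obtains enc :: "('i, 'a) ix \<Rightarrow> 'a + 'i" where "inj enc"
proof -
  have "infinite (UNIV :: ('a + 'i) set)" using assms by simp
  then obtain p :: "nat \<Rightarrow> 'a + 'i \<Rightarrow> 'a + 'i \<Rightarrow> 'a + 'i"
    where "\<And>m x y n x' y'. p m x y = p n x' y' \<longleftrightarrow> m = n \<and> x = x' \<and> y = y'"
    by (rule infinite_pairing) blast
  from code_inj(1)[OF this, of Inr Inl] that[of "code_ix p Inr Inl"] show thesis
    by (auto simp: inj_def)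
qed

primrec tinds :: "('i, 'v) tm \<Rightarrow> ('i, 'v) ix set" where
  "tinds (TVar v) = {}"
| "tinds (TPlus s t) = tinds s \<union> tinds t"
| "tinds (TNeg t) = tinds t"
| "tinds (TCyl j t) = insert j (tinds t)"
| "tinds (TDiag j k) = {j, k}"

primrec tmvars :: "('i, 'v) tm \<Rightarrow> 'v set" where
  "tmvars (TVar v) = {v}"
| "tmvars (TPlus s t) = tmvars s \<union> tmvars t"
| "tmvars (TNeg t) = tmvars t"
| "tmvars (TCyl j t) = tmvars t"
| "tmvars (TDiag j k) = {}"

text \<open>Henkin terms are evaluated in A itself, with genuine indices assigned to Henkin indices.
  Only finitely many of them matter at a time, so the assignment can be injective on these.\<close>

primrec gv :: "('i, 'a) cyl_alg \<Rightarrow> (('i, 'v) ix \<Rightarrow> 'i) \<Rightarrow> ('v \<Rightarrow> 'a) \<Rightarrow> ('i, 'v) tm \<Rightarrow> 'a" where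
  "gv A \<rho> v (TVar b) = v b"
| "gv A \<rho> v (TPlus s t) = bplus A (gv A \<rho> v s) (gv A \<rho> v t)"
| "gv A \<rho> v (TNeg t) = bneg A (gv A \<rho> v t)"
| "gv A \<rho> v (TCyl j t) = cyl A (\<rho> j) (gv A \<rho> v t)"
| "gv A \<rho> v (TDiag j k) = diag A (\<rho> j) (\<rho> k)"

primrec to_ca :: "(('i, 'v) ix \<Rightarrow> 'i) \<Rightarrow> ('v \<Rightarrow> nat) \<Rightarrow> ('i, 'v) tm \<Rightarrow> 'i ca_term" where
  "to_ca \<rho> \<nu> (TVar b) = Var (\<nu> b)"
| "to_ca \<rho> \<nu> (TPlus s t) = Plus (to_ca \<rho> \<nu> s) (to_ca \<rho> \<nu> t)"
| "to_ca \<rho> \<nu> (TNeg t) = Neg (to_ca \<rho> \<nu> t)"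
| "to_ca \<rho> \<nu> (TCyl j t) = Cyl (\<rho> j) (to_ca \<rho> \<nu> t)"
| "to_ca \<rho> \<nu> (TDiag j k) = Diag (\<rho> j) (\<rho> k)"

lemma tval_to_ca: "tval A w (to_ca \<rho> \<nu> t) = gv A \<rho> (w \<circ> \<nu>) t"
  by (induction t rule: tm_induct) auto

lemma inds_to_ca: "inds (to_ca \<rho> \<nu> t) = \<rho> ` tinds t"
  by (induction t rule: tm_induct) auto

lemma finite_tinds [simp]: "finite (tinds t)"
  by (induction t rule: tm_induct) auto

lemma finite_tmvars [simp]: "finite (tmvars t)"
  by (induction t rule: tm_induct) auto

lemma gv_cong:
  "(\<And>j. j \<in> tinds t \<Longrightarrow> \<rho> j = \<rho>' j) \<Longrightarrow> (\<And>b. b \<in> tmvars t \<Longrightarrow> v b = v' b) \<Longrightarrow> gv A \<rho> v t = gv A \<rho>' v' t"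
  by (induction t rule: tm_induct) auto

lemma size_tinds: "k \<in> tinds t \<Longrightarrow> size k < size t"
  by (induction t rule: tm_induct) auto

definition tmt :: "('i, 'v) tm \<Rightarrow> ('i, 'v) tm \<Rightarrow> ('i, 'v) tm" where
  "tmt s t = TNeg (TPlus (TNeg s) (TNeg t))"

definition tsub :: "('i, 'v) ix \<Rightarrow> ('i, 'v) ix \<Rightarrow> ('i, 'v) tm \<Rightarrow> ('i, 'v) tm" where
  "tsub j k t = TCyl j (tmt (TDiag j k) t)"



text \<open>The Henkin axiom: c_j t implies the instance of t at its own witness.\<close>

definition hax :: "('i, 'v) ix \<Rightarrow> ('i, 'v) tm \<Rightarrow> ('i, 'v) tm" where
  "hax j t = TPlus (TNeg (TCyl j t)) (tsub j (Wit j t) t)"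

lemma gv_tmt: "gv A \<rho> v (tmt s t) = bmult A (gv A \<rho> v s) (gv A \<rho> v t)"
  by (simp add: tmt_def bmult_def)

lemma gv_tsub: "gv A \<rho> v (tsub j k t) = sub A (\<rho> j) (\<rho> k) (gv A \<rho> v t)"
  by (simp add: tsub_def sub_def gv_tmt)

lemma tinds_tmt [simp]: "tinds (tmt s t) = tinds s \<union> tinds t"
  by (simp add: tmt_def)

lemma tinds_tsub [simp]: "tinds (tsub j k t) = {j, k} \<union> tinds t"
  by (auto simp: tsub_def)

lemma tinds_hax [simp]: "tinds (hax j t) = {j, Wit j t} \<union> tinds t"
  by (auto simp: hax_def)

section \<open>Consistency of the Henkin axioms\<close>

locale henkin = inductive_alg A for A :: "('i, 'a) cyl_alg" +
  fixes \<Gamma> :: "'i set" and a :: 'a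
  assumes \<Gamma>: "finite \<Gamma>" and a: "a \<in> carr A" "a \<noteq> bzero A"
begin

abbreviation BG :: "('i, 'a) ix set" where "BG \<equiv> Base ` \<Gamma>"

definition v0 :: "'a \<Rightarrow> 'a" where "v0 b = (if b \<in> carr A then b else bone A)"

primrec \<rho>0 :: "('i, 'a) ix \<Rightarrow> 'i" where
  "\<rho>0 (Base i) = i"
| "\<rho>0 (Wit j t) = undefined"

text \<open>A as a partial model, seen through the indices in \<open>\<Delta>\<close>. Injectivity
  makes the cylindric laws for distinct indices available for distinct Henkin indices.\<close>

definition good :: "('i, 'a) ix set \<Rightarrow> (('i, 'a) ix \<Rightarrow> 'i) \<Rightarrow> ('a \<Rightarrow> 'a) \<Rightarrow> bool" where
  "good \<Delta> \<rho> v \<longleftrightarrow> inj_on \<rho> \<Delta> \<and> (\<forall>\<gamma>\<in>\<Gamma>. \<rho> (Base \<gamma>) = \<gamma>) \<and> (\<forall>b. v b \<in> carr A) \<and>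
     (\<forall>b. \<forall>j\<in>\<Delta> - BG. cyl A (\<rho> j) (v b) = v b)"

text \<open>\<open>nul p\<close>: the equation \<open>p = 0\<close> belongs to the diagram of the \<open>\<Gamma>\<close>-reduct.\<close>

definition nul :: "('i, 'a) tm \<Rightarrow> bool" where
  "nul p \<longleftrightarrow> tinds p \<subseteq> BG \<and> gv A \<rho>0 v0 p = bzero A"

text \<open>Consistency with the equations of \<open>A\<close>, the diagram of the \<open>\<Gamma>\<close>-reduct, and the
  equations \<open>c\<^sub>j x = x\<close> for the generators \<open>x\<close> and the indices \<open>j\<close> outside \<open>\<Gamma>\<close>.\<close>

definition con :: "('i, 'a) tm set \<Rightarrow> bool" where
  "con X \<longleftrightarrow> (\<forall>\<Delta> p. finite \<Delta> \<longrightarrow> BG \<subseteq> \<Delta> \<longrightarrow> nul p \<longrightarrow>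
     (\<exists>\<rho> v F. good \<Delta> \<rho> v \<and> ufilter A F \<and> (\<forall>t\<in>X. gv A \<rho> v t \<in> F) \<and> gv A \<rho> v p \<notin> F))"

lemma v0_in [simp]: "v0 b \<in> carr A"
  by (simp add: v0_def)

lemma good_mono: "\<Delta> \<subseteq> \<Delta>' \<Longrightarrow> good \<Delta>' \<rho> v \<Longrightarrow> good \<Delta> \<rho> v"
  unfolding good_def by (auto intro: inj_on_subset)

lemma gv_in [simp]: "(\<And>b. v b \<in> carr A) \<Longrightarrow> gv A \<rho> v t \<in> carr A"
  by (induction t rule: tm_induct) auto

lemma good_in [simp]: "good \<Delta> \<rho> v \<Longrightarrow> gv A \<rho> v t \<in> carr A"
  by (rule gv_in) (simp add: good_def)

lemma good_neq: "good \<Delta> \<rho> v \<Longrightarrow> j \<in> \<Delta> \<Longrightarrow> k \<in> \<Delta> \<Longrightarrow> j \<noteq> k \<Longrightarrow> \<rho> j \<noteq> \<rho> k"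
  by (auto simp: good_def inj_on_eq_iff)

lemma gv_closed:
  assumes "good \<Delta> \<rho> v" "k \<in> \<Delta>" "k \<notin> BG" "k \<notin> tinds t" "tinds t \<subseteq> \<Delta>"
  shows "cyl A (\<rho> k) (gv A \<rho> v t) = gv A \<rho> v t"
  using assms(4,5)
proof (induction t rule: tm_induct)
  case (TVar b)
  then show ?case using assms(1-3) by (simp add: good_def)
next
  case (TPlus s t)
  then show ?case using good_in[OF assms(1)] by (simp add: cyl_pl)
next
  case (TNeg t)
  then show ?case using good_in[OF assms(1)] by (simp add: cyl_ng)
next
  case (TCyl j t)
  then show ?case using good_in[OF assms(1)] cyl_comm[of "gv A \<rho> v t" "\<rho> k" "\<rho> j"] by simp
next
  case (TDiag i j)
  then show ?case using good_neq[OF assms(1,2)] by (simp add: cyl_diag_other)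
qed

definition zt :: "('i, 'a) tm" where
  "zt = TNeg (TPlus (TVar a) (TNeg (TVar a)))"

lemma gv_zt: "(\<And>b. v b \<in> carr A) \<Longrightarrow> gv A \<rho> v zt = bzero A"
  by (simp add: zt_def one_eq bzero_def)

lemma nul_zt: "nul zt"
  by (simp add: nul_def gv_zt) (simp add: zt_def)

lemma nul_TPlus: "nul p \<Longrightarrow> nul q \<Longrightarrow> nul (TPlus p q)"
  by (simp add: nul_def pl_zero)

lemma nul_TCyl: "nul p \<Longrightarrow> j \<in> BG \<Longrightarrow> nul (TCyl j p)"
  by (auto simp: nul_def cyl_zero)

lemma nul_closed: "nul p \<Longrightarrow> good \<Delta> \<rho> v \<Longrightarrow> BG \<subseteq> \<Delta> \<Longrightarrow> k \<in> \<Delta> \<Longrightarrow> k \<notin> BG \<Longrightarrow>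
  cyl A (\<rho> k) (gv A \<rho> v p) = gv A \<rho> v p"
  by (rule gv_closed[of \<Delta>]) (auto simp: nul_def)

lemma conD:
  assumes "con X" "finite \<Delta>" "nul p"
  obtains \<rho> v F where "good (\<Delta> \<union> BG) \<rho> v" "ufilter A F" "\<And>t. t \<in> X \<Longrightarrow> gv A \<rho> v t \<in> F" "gv A \<rho> v p \<notin> F"
proof -
  have "finite (\<Delta> \<union> BG)" using assms \<Gamma> by simp
  then show thesis using assms(1,3) that unfolding con_def by (metis sup_ge2)
qed

lemma not_conD:
  assumes "\<not> con X"
  obtains D p where "finite D" "BG \<subseteq> D" "nul p"
    "\<And>\<rho> v F. good D \<rho> v \<Longrightarrow> ufilter A F \<Longrightarrow> (\<And>t. t \<in> X \<Longrightarrow> gv A \<rho> v t \<in> F) \<Longrightarrow> gv A \<rho> v p \<in> F"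
proof -
  obtain D p where "finite D" "BG \<subseteq> D" "nul p"
    "\<not> (\<exists>\<rho> v F. good D \<rho> v \<and> ufilter A F \<and> (\<forall>t\<in>X. gv A \<rho> v t \<in> F) \<and> gv A \<rho> v p \<notin> F)"
    using assms unfolding con_def by fast
  then show thesis using that[of D p] by fast
qed

lemma con_mono: "con X \<Longrightarrow> Y \<subseteq> X \<Longrightarrow> con Y"
  unfolding con_def by (meson subsetD)

text \<open>Suppose (D, p) and (E, q) witness the two inconsistencies. Every ultrafilter decides t,
  so D \<union> E together with the null term p + q would refute X itself.\<close>

lemma con_ext:
  assumes "con X"
  shows "con (insert t X) \<or> con (insert (TNeg t) X)"
proof (rule ccontr)
  assume "\<not> ?thesis"
  then have n: "\<not> con (insert t X)" "\<not> con (insert (TNeg t) X)" by auto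
  obtain D p where D: "finite D" "BG \<subseteq> D" "nul p"
      "\<And>\<rho> v F. good D \<rho> v \<Longrightarrow> ufilter A F \<Longrightarrow> (\<And>s. s \<in> insert t X \<Longrightarrow> gv A \<rho> v s \<in> F) \<Longrightarrow> gv A \<rho> v p \<in> F"
    using not_conD[OF n(1)] by metis
  obtain E q where E: "finite E" "BG \<subseteq> E" "nul q"
      "\<And>\<rho> v F. good E \<rho> v \<Longrightarrow> ufilter A F \<Longrightarrow> (\<And>s. s \<in> insert (TNeg t) X \<Longrightarrow> gv A \<rho> v s \<in> F) \<Longrightarrow> gv A \<rho> v q \<in> F"
    using not_conD[OF n(2)] by metis
  obtain \<rho> v F where g: "good (D \<union> E \<union> BG) \<rho> v" "ufilter A F" "\<And>t. t \<in> X \<Longrightarrow> gv A \<rho> v t \<in> F"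
    "gv A \<rho> v (TPlus p q) \<notin> F"
    using conD[OF assms, of "D \<union> E" "TPlus p q"] D E nul_TPlus by (metis finite_UnI)
  have gD: "good D \<rho> v" and gE: "good E \<rho> v" using g(1) by (auto intro: good_mono[rotated])
  have "gv A \<rho> v t \<in> F \<or> gv A \<rho> v (TNeg t) \<in> F" using g gD by (simp add: uf)
  then have "gv A \<rho> v p \<in> F \<or> gv A \<rho> v q \<in> F" using D(4)[OF gD g(2)] E(4)[OF gE g(2)] g(3) by (metis insertE)
  then show False using g gD by (simp add: uf)
qed

lemma good_exists:
  assumes "finite \<Delta>"
  obtains \<rho> where "inj_on \<rho> (\<Delta> \<union> BG)" "\<And>\<gamma>. \<gamma> \<in> \<Gamma> \<Longrightarrow> \<rho> (Base \<gamma>) = \<gamma>"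
    "\<rho> ` (\<Delta> - BG) \<inter> \<Gamma> = {}"
proof -
  have "infinite (- \<Gamma>)" using inf \<Gamma> by (simp add: Compl_eq_Diff_UNIV)
  then obtain T where T: "finite T" "card T = card (\<Delta> - BG)" "T \<subseteq> - \<Gamma>"
    using infinite_arbitrarily_large[of "- \<Gamma>" "card (\<Delta> - BG)"] by auto
  then obtain \<phi> where "bij_betw \<phi> (\<Delta> - BG) T"
    using finite_same_card_bij[of "\<Delta> - BG" T] assms by auto
  then have \<phi>: "inj_on \<phi> (\<Delta> - BG)" "\<phi> ` (\<Delta> - BG) = T" by (auto simp: bij_betw_def)
  let ?\<rho> = "\<lambda>j. if j \<in> BG then \<rho>0 j else \<phi> j"
  have "inj_on ?\<rho> (\<Delta> - BG)" using \<phi>(1) by (auto simp: inj_on_def)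
  moreover have "inj_on ?\<rho> BG" by (auto simp: inj_on_def)
  moreover have im: "?\<rho> ` (\<Delta> - BG) = T" using \<phi>(2) by auto
  moreover have "?\<rho> ` BG = \<Gamma>" by force
  ultimately have "inj_on ?\<rho> ((\<Delta> - BG) \<union> BG)" using T(3) by (subst inj_on_Un) auto
  then show thesis using that[of ?\<rho>] im T(3) by auto
qed

text \<open>Inductivity enters here. A failure would put x_a below a null term p whenever the
  generators are closed under the indices of \<open>\<Delta>\<close> outside
  \<open>\<Gamma>\<close>. All indices of p come from \<open>\<Gamma>\<close>, so this inequality is
  valid in A outright; reading every generator as itself gives a \<le> 0.\<close>

lemma con_init: "con {TVar a}"
  unfolding con_def
proof (intro allI impI, rule ccontr)
  fix \<Delta> p assume D: "finite \<Delta>" "BG \<subseteq> \<Delta>" "nul p"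
    and n: "\<nexists>\<rho> v F. good \<Delta> \<rho> v \<and> ufilter A F \<and> (\<forall>t\<in>{TVar a}. gv A \<rho> v t \<in> F) \<and> gv A \<rho> v p \<notin> F"
  obtain \<rho> where \<rho>: "inj_on \<rho> (\<Delta> \<union> BG)" "\<And>\<gamma>. \<gamma> \<in> \<Gamma> \<Longrightarrow> \<rho> (Base \<gamma>) = \<gamma>"
    "\<rho> ` (\<Delta> - BG) \<inter> \<Gamma> = {}" using good_exists[OF D(1)] by blast
  let ?N = "insert a (tmvars p)"
  obtain \<nu> :: "'a \<Rightarrow> nat" where \<nu>: "inj_on \<nu> ?N"
    using finite_imp_inj_to_nat_seg[of ?N] by auto
  let ?e = "(Plus (Var (\<nu> a)) (to_ca \<rho>0 \<nu> p), to_ca \<rho>0 \<nu> p)"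
  have p: "tinds p \<subseteq> BG" "gv A \<rho>0 v0 p = bzero A" using D(3) by (auto simp: nul_def)
  have "eq_inds ?e \<subseteq> \<Gamma>" using p(1) by (force simp: eq_inds_def inds_to_ca)
  have "valid A ?e"
  proof (rule inductive_finite)
    show "finite (\<rho> ` (\<Delta> - BG))" using D(1) by simp
    show "\<rho> ` (\<Delta> - BG) \<inter> eq_inds ?e = {}" using \<rho>(3) \<open>eq_inds ?e \<subseteq> \<Gamma>\<close> by blast
    fix w :: "nat \<Rightarrow> 'a"
    assume w: "\<And>n. w n \<in> carr A" "\<And>n i. i \<in> \<rho> ` (\<Delta> - BG) \<Longrightarrow> cyl A i (w n) = w n"
    have g: "good \<Delta> \<rho> (w \<circ> \<nu>)"
      using \<rho> w by (auto simp: good_def intro: inj_on_subset)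
    then have "ble A ((w \<circ> \<nu>) a) (gv A \<rho> (w \<circ> \<nu>) p)"
      using n w(1) by (subst ble_iff) auto
    moreover have "gv A \<rho> (w \<circ> \<nu>) p = gv A \<rho>0 (w \<circ> \<nu>) p"
      by (rule gv_cong) (use p(1) \<rho>(2) in auto)
    ultimately show "tval A w (fst ?e) = tval A w (snd ?e)"
      by (simp add: ble_def tval_to_ca)
  qed
  \<comment> \<open>Undoes the numbering \<open>\<nu>\<close>, so that each generator involved takes
    its intended value \<open>v0\<close>.\<close>
  let ?w = "\<lambda>n. if n \<in> \<nu> ` ?N then v0 (the_inv_into ?N \<nu> n) else bone A"
  have w: "(?w \<circ> \<nu>) b = v0 b" if "b \<in> ?N" for b
    using that the_inv_into_f_f[OF \<nu> that] by auto
  have "tval A ?w (fst ?e) = tval A ?w (snd ?e)" by (rule validD[OF \<open>valid A ?e\<close>]) simp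
  moreover have "gv A \<rho>0 (?w \<circ> \<nu>) p = gv A \<rho>0 v0 p" by (rule gv_cong[OF refl w]) (rule insertI2)
  moreover have "?w (\<nu> a) = a" using w[of a] a by (simp add: v0_def)
  ultimately have "bplus A a (bzero A) = bzero A" using p(2) by (simp only: tval_to_ca tval.simps fst_conv snd_conv)
  then show False using a by (simp add: pl_zero)
qed

text \<open>Elimination of a fresh witness k. Let m be the product of X and suppose that m and the
  axiom together lie below a null p. Then m times s t lies below p, where s replaces j by k. Apply
  c_k, which fixes m and p and takes s t to c_j t: now m times c_j t lies below p. Off c_j t the
  axiom is true anyway, so m lies below p, against the consistency of X.\<close>

lemma con_hax:
  assumes X: "con X" "finite X" and fresh: "\<And>s. s \<in> X \<Longrightarrow> Wit j t \<notin> tinds s"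
  shows "con (insert (hax j t) X)"
  unfolding con_def
proof (intro allI impI, rule ccontr)
  let ?k = "Wit j t"
  fix \<Delta> p assume D: "finite \<Delta>" "BG \<subseteq> \<Delta>" "nul p"
    and n: "\<nexists>\<rho> v F. good \<Delta> \<rho> v \<and> ufilter A F \<and> (\<forall>t\<in>insert (hax j t) X. gv A \<rho> v t \<in> F) \<and> gv A \<rho> v p \<notin> F"
  \<comment> \<open>A witness is larger than all its parts and so cannot occur in the term it
    witnesses.\<close>
  have "size j < size ?k" "size t < size ?k" by auto
  then have k: "?k \<noteq> j" "?k \<notin> tinds t" "?k \<notin> BG" using size_tinds[of ?k t] by (metis less_irrefl, force, blast)
  let ?D = "\<Delta> \<union> {j, ?k} \<union> tinds t \<union> (\<Union>s\<in>X. tinds s)"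
  obtain \<rho> v F where g': "good (?D \<union> BG) \<rho> v" and F: "ufilter A F" "\<And>t. t \<in> X \<Longrightarrow> gv A \<rho> v t \<in> F" "gv A \<rho> v p \<notin> F"
    using conD[OF X(1) _ D(3), of ?D] D(1) X(2) by auto
  have g: "good \<Delta> \<rho> v" using g' by (rule good_mono[rotated]) auto
  note gin = good_in[OF g]
  \<comment> \<open>The product of X as one element, closed at the witness index because no member
    of X mentions it.\<close>
  have "\<exists>m\<in>carr A. cyl A (\<rho> ?k) m = m \<and> (\<forall>H. ufilter A H \<longrightarrow> m \<in> H \<longleftrightarrow> (\<forall>s\<in>Y. gv A \<rho> v s \<in> H))"
    if "finite Y" "Y \<subseteq> X" for Y
    using that
  proof (induction Y)
    case empty
    then show ?case by (intro bexI[of _ "bone A"]) (auto simp: cyl_one uf)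
  next
    case (insert s Y)
    then obtain m where m: "m \<in> carr A" "cyl A (\<rho> ?k) m = m"
      "\<And>H. ufilter A H \<Longrightarrow> m \<in> H \<longleftrightarrow> (\<forall>s\<in>Y. gv A \<rho> v s \<in> H)" by auto
    have "cyl A (\<rho> ?k) (gv A \<rho> v s) = gv A \<rho> v s"
      using insert.prems fresh k by (intro gv_closed[OF g']) auto
    then show ?case using m gin by (intro bexI[of _ "bmult A (gv A \<rho> v s) m"]) (auto simp: cyl_mt uf)
  qed
  from this[of X] X(2) obtain m where m: "m \<in> carr A" "cyl A (\<rho> ?k) m = m"
    "\<And>H. ufilter A H \<Longrightarrow> m \<in> H \<longleftrightarrow> (\<forall>s\<in>X. gv A \<rho> v s \<in> H)" by blast
  have mh: "gv A \<rho> v p \<in> H" if "ufilter A H" "m \<in> H" "gv A \<rho> v (hax j t) \<in> H" for H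
    using n g that m(3) by blast
  let ?x = "gv A \<rho> v t" and ?s = "gv A \<rho> v (tsub j ?k t)"
  have "ble A (bmult A m ?s) (gv A \<rho> v p)"
    using mh m(1) gin by (subst ble_iff) (auto simp: uf hax_def)
  then have "ble A (cyl A (\<rho> ?k) (bmult A m ?s)) (cyl A (\<rho> ?k) (gv A \<rho> v p))"
    using m(1) gin by (intro cyl_mono) auto
  moreover have "cyl A (\<rho> ?k) (gv A \<rho> v p) = gv A \<rho> v p"
    using D k by (intro nul_closed[OF _ g']) auto
  moreover have "cyl A (\<rho> ?k) (bmult A m ?s) = bmult A m (cyl A (\<rho> j) ?x)"
  proof -
    have "\<rho> ?k \<noteq> \<rho> j" using k(1) by (intro good_neq[OF g']) auto
    moreover have "cyl A (\<rho> ?k) ?x = ?x" using k by (intro gv_closed[OF g']) auto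
    ultimately have "cyl A (\<rho> ?k) ?s = cyl A (\<rho> j) ?x" using gin by (simp add: gv_tsub cyl_sub_swap)
    then show ?thesis using m gin by (simp add: cyl_mt_closed')
  qed
  ultimately have *: "ble A (bmult A m (cyl A (\<rho> j) ?x)) (gv A \<rho> v p)" by simp
  have "m \<in> F" using m(3)[OF F(1)] F(2) by simp
  show False
  proof (cases "cyl A (\<rho> j) ?x \<in> F")
    case True
    then have "bmult A m (cyl A (\<rho> j) ?x) \<in> F" using \<open>m \<in> F\<close> F m gin by (simp add: uf)
    then show False using * F m gin by (simp add: ble_iff)
  next
    case False
    then have "gv A \<rho> v (hax j t) \<in> F" using F gin by (simp add: uf hax_def)
    then show False using mh[OF F(1) \<open>m \<in> F\<close>] F(3) by simp
  qed
qed

text \<open>The axioms are added by increasing size of their witnesses. The newest witness is then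
  at least as large as the earlier ones and occurs in none of the earlier axioms, as
  \<open>con_hax\<close> demands.\<close>

lemma con_hax_finite:
  assumes "finite H"
  shows "con (insert (TVar a) ((\<lambda>(j, t). hax j t) ` H))"
  using assms
proof (induction H rule: finite_ranking_induct[where f = "\<lambda>(j, t). size (Wit j t)"])
  case empty
  then show ?case using con_init by simp
next
  case (insert x H)
  obtain j t where x: "x = (j, t)" by fastforce
  show ?case
  proof (cases "x \<in> H")
    case True then show ?thesis using insert by (simp add: insert_absorb)
  next
    case False
    have "Wit j t \<notin> tinds s" if s: "s \<in> insert (TVar a) ((\<lambda>(j, t). hax j t) ` H)" for s
    proof
      assume w: "Wit j t \<in> tinds s"
      then obtain j' t' where j': "(j', t') \<in> H" "s = hax j' t'" using s by auto
      then have le: "size (Wit j' t') \<le> size (Wit j t)" using insert.hyps(2)[of "(j', t')"] x by auto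
      have "Wit j t = j' \<or> Wit j t = Wit j' t' \<or> Wit j t \<in> tinds t'" using w j' by auto
      then show False using le size_tinds[of "Wit j t" t'] j' False x by auto
    qed
    then have "con (insert (hax j t) (insert (TVar a) ((\<lambda>(j, t). hax j t) ` H)))"
      using insert by (intro con_hax) auto
    then show ?thesis by (simp add: x insert_commute)
  qed
qed

lemma henkin_set:
  obtains F where "TVar a \<in> F" "\<And>j t. hax j t \<in> F" "\<And>X. finite X \<Longrightarrow> X \<subseteq> F \<Longrightarrow> con X"
    "\<And>t. t \<in> F \<or> TNeg t \<in> F"
proof -
  let ?S = "insert (TVar a) (range (\<lambda>(j, t). hax j t))"
  have S: "con X" if X: "finite X" "X \<subseteq> ?S" for X
  proof -
    have "finite (X - {TVar a})" "X - {TVar a} \<subseteq> (\<lambda>(j, t). hax j t) ` UNIV" using X by auto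
    then obtain H where "finite H" "X - {TVar a} = (\<lambda>(j, t). hax j t) ` H"
      using finite_subset_image by metis
    then show ?thesis using con_mono[OF con_hax_finite[of H], of X] by auto
  qed
  obtain F where "?S \<subseteq> F" "F \<subseteq> UNIV" "\<And>X. finite X \<Longrightarrow> X \<subseteq> F \<Longrightarrow> con X" "\<And>t. t \<in> UNIV \<Longrightarrow> t \<in> F \<or> TNeg t \<in> F"
  proof (rule maximal_consistent_set[of con UNIV TNeg ?S])
    show "con Y" if "Y \<subseteq> X" "con X" for X Y using con_mono that by blast
    show "con (insert t X) \<or> con (insert (TNeg t) X)" if "con X" for t X using con_ext that by blast
    show "con X" if "finite X" "X \<subseteq> ?S" for X using S that by blast
  qed auto
  moreover have "hax j t \<in> ?S" for j t by (force intro: rev_image_eqI[of "(j, t)"])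
  ultimately show thesis by (intro that[of F]) blast+
qed

end

lemma full_set_alg_sel [simp]:
  "carr (full_set_alg U V) = Pow V" "bplus (full_set_alg U V) = (\<union>)"
  "bneg (full_set_alg U V) X = V - X" "diag (full_set_alg U V) i j = {s \<in> V. s i = s j}"
  by (auto simp: full_set_alg_def)

lemma cyl_full_seqs:
  assumes "X \<subseteq> seqs U"
  shows "cyl (full_set_alg U (seqs U)) i X = {s \<in> seqs U. \<exists>u\<in>U. s(i := u) \<in> X}"
proof (intro set_eqI iffI)
  fix s assume "s \<in> cyl (full_set_alg U (seqs U)) i X"
  then obtain t u where t: "s = t(i := u)" "t \<in> X" "u \<in> U" "s \<in> seqs U"
    by (auto simp: full_set_alg_def)
  then have "s(i := t i) \<in> X" "t i \<in> U" using assms by (auto simp: seqs_def)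
  then show "s \<in> {s \<in> seqs U. \<exists>u\<in>U. s(i := u) \<in> X}" using t by blast
next
  fix s assume "s \<in> {s \<in> seqs U. \<exists>u\<in>U. s(i := u) \<in> X}"
  then obtain u where s: "s \<in> seqs U" "s(i := u) \<in> X" by auto
  have "s = (s(i := u))(i := s i)" "s i \<in> U" using s(1) by (auto simp: seqs_def)
  then show "s \<in> cyl (full_set_alg U (seqs U)) i X"
    unfolding full_set_alg_def cyl_alg.simps mem_Collect_eq
    using s by (intro exI[of _ "s(i := u)"] exI[of _ "s i"] conjI) simp_all
qed

section \<open>The set representation given by a Henkin set\<close>

locale henkin_model = henkin A \<Gamma> a for A :: "('i, 'a) cyl_alg" and \<Gamma> a +
  fixes F :: "('i, 'a) tm set"
  assumes aF: "TVar a \<in> F" and haxF: "hax j t \<in> F"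
    and conF: "finite X \<Longrightarrow> X \<subseteq> F \<Longrightarrow> con X" and ultF: "t \<in> F \<or> TNeg t \<in> F"
begin

lemma conX:
  assumes "con X" "finite \<Delta>" "nul p"
  shows "\<exists>\<rho> v H. good (\<Delta> \<union> BG) \<rho> v \<and> ufilter A H \<and> (\<forall>t\<in>X. gv A \<rho> v t \<in> H) \<and> gv A \<rho> v p \<notin> H"
  by (rule conD[OF assms]) metis

lemma F_entails:
  assumes D: "finite \<Delta>" and X: "finite X" "X \<subseteq> F"
    and E: "\<And>\<rho> v H. good \<Delta> \<rho> v \<Longrightarrow> ufilter A H \<Longrightarrow> (\<And>s. s \<in> X \<Longrightarrow> gv A \<rho> v s \<in> H) \<Longrightarrow> gv A \<rho> v t \<in> H"
  shows "t \<in> F"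
proof (rule ccontr)
  assume "t \<notin> F"
  then have c: "con (insert (TNeg t) X)" using ultF[of t] X by (intro conF) auto
  obtain \<rho> v H where g: "good (\<Delta> \<union> BG) \<rho> v" and H: "ufilter A H"
    "\<forall>s\<in>insert (TNeg t) X. gv A \<rho> v s \<in> H"
    using conX[OF c D nul_zt] by blast
  have g': "good \<Delta> \<rho> v" using g by (rule good_mono[rotated]) auto
  have "gv A \<rho> v t \<in> H" using H by (intro E[OF g']) auto
  moreover have "gv A \<rho> v (TNeg t) \<in> H" using H(2) by blast
  ultimately show False using H(1) good_in[OF g'] by (simp add: uf)
qed

lemma F_TNeg: "TNeg t \<in> F \<longleftrightarrow> t \<notin> F"
proof
  assume n: "TNeg t \<in> F"
  show "t \<notin> F"
  proof
    assume "t \<in> F"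
    then have c: "con {t, TNeg t}" using n by (intro conF) auto
    obtain \<rho> v H where g: "good ({} \<union> BG) \<rho> v" and H: "ufilter A H"
      "\<forall>s\<in>{t, TNeg t}. gv A \<rho> v s \<in> H"
      using conX[OF c finite.emptyI nul_zt] by blast
    have "gv A \<rho> v t \<in> H" "gv A \<rho> v (TNeg t) \<in> H" using H(2) by blast+
    then show False using H(1) good_in[OF g] by (simp add: uf)
  qed
qed (use ultF in blast)

lemma F_mono:
  assumes "s \<in> F" "finite \<Delta>" "\<And>\<rho> v. good \<Delta> \<rho> v \<Longrightarrow> ble A (gv A \<rho> v s) (gv A \<rho> v t)"
  shows "t \<in> F"
proof (rule F_entails[OF assms(2), of "{s}"])
  fix \<rho> v H assume "good \<Delta> \<rho> v" "ufilter A H" "\<And>r. r \<in> {s} \<Longrightarrow> gv A \<rho> v r \<in> H"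
  then show "gv A \<rho> v t \<in> H" using assms(3) ble_iff good_in by (meson singletonI)
qed (use assms(1) in auto)

lemma F_mono2:
  assumes "r \<in> F" "s \<in> F" "finite \<Delta>"
    "\<And>\<rho> v. good \<Delta> \<rho> v \<Longrightarrow> ble A (bmult A (gv A \<rho> v r) (gv A \<rho> v s)) (gv A \<rho> v t)"
  shows "t \<in> F"
proof (rule F_entails[OF assms(3), of "{r, s}"])
  fix \<rho> v H assume g: "good \<Delta> \<rho> v" "ufilter A H" "\<And>q. q \<in> {r, s} \<Longrightarrow> gv A \<rho> v q \<in> H"
  then have "bmult A (gv A \<rho> v r) (gv A \<rho> v s) \<in> H" using good_in by (auto simp: uf)
  then show "gv A \<rho> v t \<in> H" using assms(4)[OF g(1)] g ble_iff good_in by (meson mt_in)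
qed (use assms(1,2) in auto)

lemma F_TPlus: "TPlus s t \<in> F \<longleftrightarrow> s \<in> F \<or> t \<in> F"
proof
  assume st: "TPlus s t \<in> F"
  show "s \<in> F \<or> t \<in> F"
  proof (rule ccontr)
    assume "\<not> (s \<in> F \<or> t \<in> F)"
    then have "TNeg s \<in> F" using F_TNeg by blast
    have "t \<in> F" by (rule F_mono2[OF st \<open>TNeg s \<in> F\<close> finite.emptyI])
      (use good_in in \<open>auto simp: ble_iff uf\<close>)
    then show False using \<open>\<not> (s \<in> F \<or> t \<in> F)\<close> by blast
  qed
next
  assume "s \<in> F \<or> t \<in> F"
  then show "TPlus s t \<in> F"
    using F_mono[of s "{}" "TPlus s t"] F_mono[of t "{}" "TPlus s t"] good_in
    by (fastforce simp: ble_iff uf)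
qed

text \<open>Provable equality: the null term p collects the diagram equations used, and s and t
  agree off p. Related terms are interchangeable in F by \<open>F_cong\<close>.\<close>

definition teqv :: "('i, 'a) tm \<Rightarrow> ('i, 'a) tm \<Rightarrow> bool" (infix "\<approx>" 50) where
  "s \<approx> t \<longleftrightarrow> (\<exists>\<Delta> p. finite \<Delta> \<and> BG \<subseteq> \<Delta> \<and> nul p \<and> (\<forall>\<rho> v H. good \<Delta> \<rho> v \<longrightarrow> ufilter A H \<longrightarrow>
     gv A \<rho> v p \<notin> H \<longrightarrow> (gv A \<rho> v s \<in> H \<longleftrightarrow> gv A \<rho> v t \<in> H)))"

lemma teqvI:
  assumes "finite \<Delta>" "nul p"
    "\<And>\<rho> v H. good \<Delta> \<rho> v \<Longrightarrow> ufilter A H \<Longrightarrow> gv A \<rho> v p \<notin> H \<Longrightarrow> gv A \<rho> v s \<in> H \<longleftrightarrow> gv A \<rho> v t \<in> H"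
  shows "s \<approx> t"
  unfolding teqv_def
proof (intro exI conjI)
  show "finite (\<Delta> \<union> BG)" using assms(1) \<Gamma> by simp
  show "nul p" by fact
  show "\<forall>\<rho> v H. good (\<Delta> \<union> BG) \<rho> v \<longrightarrow> ufilter A H \<longrightarrow>
     gv A \<rho> v p \<notin> H \<longrightarrow> (gv A \<rho> v s \<in> H \<longleftrightarrow> gv A \<rho> v t \<in> H)"
    using assms(3) good_mono[of \<Delta> "\<Delta> \<union> BG"] by blast
qed auto

lemma teqv_eqI:
  assumes "finite \<Delta>" "\<And>\<rho> v. good \<Delta> \<rho> v \<Longrightarrow> gv A \<rho> v s = gv A \<rho> v t"
  shows "s \<approx> t"
  using assms by (intro teqvI[OF assms(1) nul_zt]) simp

lemma teqv_refl: "t \<approx> t"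
  by (rule teqv_eqI[of "{}"]) auto

lemma teqv_sym: "s \<approx> t \<Longrightarrow> t \<approx> s"
  unfolding teqv_def by metis

lemma teqv2:
  assumes "s \<approx> s'" "t \<approx> t'"
  obtains \<Delta> p where "finite \<Delta>" "BG \<subseteq> \<Delta>" "nul p"
    "\<And>\<rho> v H. good \<Delta> \<rho> v \<Longrightarrow> ufilter A H \<Longrightarrow> gv A \<rho> v p \<notin> H \<Longrightarrow>
      (gv A \<rho> v s \<in> H \<longleftrightarrow> gv A \<rho> v s' \<in> H) \<and> (gv A \<rho> v t \<in> H \<longleftrightarrow> gv A \<rho> v t' \<in> H)"
proof -
  obtain D p where D: "finite D" "BG \<subseteq> D" "nul p"
    "\<And>\<rho> v H. good D \<rho> v \<Longrightarrow> ufilter A H \<Longrightarrow> gv A \<rho> v p \<notin> H \<Longrightarrow> gv A \<rho> v s \<in> H \<longleftrightarrow> gv A \<rho> v s' \<in> H"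
    using assms(1) unfolding teqv_def by metis
  obtain E q where E: "finite E" "BG \<subseteq> E" "nul q"
    "\<And>\<rho> v H. good E \<rho> v \<Longrightarrow> ufilter A H \<Longrightarrow> gv A \<rho> v q \<notin> H \<Longrightarrow> gv A \<rho> v t \<in> H \<longleftrightarrow> gv A \<rho> v t' \<in> H"
    using assms(2) unfolding teqv_def by metis
  show thesis
  proof (rule that[of "D \<union> E" "TPlus p q"])
    fix \<rho> v H assume g: "good (D \<union> E) \<rho> v" "ufilter A H" "gv A \<rho> v (TPlus p q) \<notin> H"
    have gD: "good D \<rho> v" "good E \<rho> v" using g(1) by (auto intro: good_mono[rotated])
    then show "(gv A \<rho> v s \<in> H \<longleftrightarrow> gv A \<rho> v s' \<in> H) \<and> (gv A \<rho> v t \<in> H \<longleftrightarrow> gv A \<rho> v t' \<in> H)"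
      using g D(4)[OF gD(1) g(2)] E(4)[OF gD(2) g(2)] good_in[OF g(1)] by (simp add: uf)
  qed (use D E nul_TPlus in auto)
qed

lemma teqv2_cong:
  assumes "s \<approx> s'" "t \<approx> t'"
    and "\<And>\<rho> v H. good {} \<rho> v \<Longrightarrow> ufilter A H \<Longrightarrow> (gv A \<rho> v s \<in> H \<longleftrightarrow> gv A \<rho> v s' \<in> H) \<Longrightarrow>
      (gv A \<rho> v t \<in> H \<longleftrightarrow> gv A \<rho> v t' \<in> H) \<Longrightarrow> (gv A \<rho> v r \<in> H \<longleftrightarrow> gv A \<rho> v r' \<in> H)"
  shows "r \<approx> r'"
proof (rule teqv2[OF assms(1,2)])
  fix \<Delta> p assume D: "finite \<Delta>" "BG \<subseteq> \<Delta>" "nul p"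
    "\<And>\<rho> v H. good \<Delta> \<rho> v \<Longrightarrow> ufilter A H \<Longrightarrow> gv A \<rho> v p \<notin> H \<Longrightarrow>
      (gv A \<rho> v s \<in> H \<longleftrightarrow> gv A \<rho> v s' \<in> H) \<and> (gv A \<rho> v t \<in> H \<longleftrightarrow> gv A \<rho> v t' \<in> H)"
  show "r \<approx> r'"
  proof (rule teqvI[OF D(1,3)])
    fix \<rho> v H assume g: "good \<Delta> \<rho> v" "ufilter A H" "gv A \<rho> v p \<notin> H"
    have "good {} \<rho> v" using g(1) by (rule good_mono[rotated]) auto
    then show "gv A \<rho> v r \<in> H \<longleftrightarrow> gv A \<rho> v r' \<in> H"
      by (rule assms(3)[OF _ g(2)]) (use D(4)[OF g] in auto)
  qed
qed

lemma teqv_trans [trans]: "s \<approx> t \<Longrightarrow> t \<approx> u \<Longrightarrow> s \<approx> u"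
  by (rule teqv2_cong[of s t t u]) auto

lemma teqv_TPlus: "s \<approx> s' \<Longrightarrow> t \<approx> t' \<Longrightarrow> TPlus s t \<approx> TPlus s' t'"
  by (rule teqv2_cong[of s s' t t']) (auto simp: uf)

lemma teqv_TNeg: "s \<approx> s' \<Longrightarrow> TNeg s \<approx> TNeg s'"
  by (rule teqv2_cong[of s s' s s']) (auto simp: uf)

lemma teqv_TCyl:
  assumes "s \<approx> t"
  shows "TCyl j s \<approx> TCyl j t"
proof -
  obtain D p where D: "finite D" "BG \<subseteq> D" "nul p"
    "\<And>\<rho> v H. good D \<rho> v \<Longrightarrow> ufilter A H \<Longrightarrow> gv A \<rho> v p \<notin> H \<Longrightarrow> gv A \<rho> v s \<in> H \<longleftrightarrow> gv A \<rho> v t \<in> H"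
    using assms unfolding teqv_def by metis
  \<comment> \<open>Cylindrification could enlarge the error p. For an index of
    \<open>\<Gamma>\<close> the enlarged error is null again; any other c_j fixes p.\<close>
  let ?q = "if j \<in> BG then TCyl j p else p"
  show ?thesis
  proof (rule teqvI[of "insert j D" ?q])
    fix \<rho> v H assume g: "good (insert j D) \<rho> v" "ufilter A H" "gv A \<rho> v ?q \<notin> H"
    have gD: "good D \<rho> v" using g(1) by (rule good_mono[rotated]) auto
    note i = good_in[OF gD]
    have q: "cyl A (\<rho> j) (gv A \<rho> v p) = gv A \<rho> v ?q"
      using nul_closed[OF D(3) g(1)] D(2) by auto
    have *: "gv A \<rho> v (TCyl j t) \<in> H" if "gv A \<rho> v (TCyl j s) \<in> H"
      and st: "\<And>H. ufilter A H \<Longrightarrow> gv A \<rho> v p \<notin> H \<Longrightarrow> gv A \<rho> v s \<in> H \<longleftrightarrow> gv A \<rho> v t \<in> H" for s t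
    proof -
      have "ble A (gv A \<rho> v s) (bplus A (gv A \<rho> v t) (gv A \<rho> v p))"
        using st i by (subst ble_iff) (auto simp: uf)
      then have "ble A (cyl A (\<rho> j) (gv A \<rho> v s)) (bplus A (cyl A (\<rho> j) (gv A \<rho> v t)) (gv A \<rho> v ?q))"
        using cyl_mono[of "gv A \<rho> v s" "bplus A (gv A \<rho> v t) (gv A \<rho> v p)" "\<rho> j"] i by (simp add: cyl_pl q)
      then show ?thesis using that(1) g(2,3) i by (subst (asm) ble_iff) (auto simp: uf)
    qed
    show "gv A \<rho> v (TCyl j s) \<in> H \<longleftrightarrow> gv A \<rho> v (TCyl j t) \<in> H"
      using *[of s t] *[of t s] D(4)[OF gD] by blast
  qed (use D nul_TCyl in auto)
qed

lemma teqv_tsub: "s \<approx> t \<Longrightarrow> tsub j k s \<approx> tsub j k t"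
  unfolding tsub_def tmt_def by (intro teqv_TCyl teqv_TNeg teqv_TPlus teqv_refl)

lemma F_cong: "s \<approx> t \<Longrightarrow> s \<in> F \<longleftrightarrow> t \<in> F"
proof -
  have "t \<in> F" if st: "s \<approx> t" "s \<in> F" for s t
  proof (rule ccontr)
    assume "t \<notin> F"
    then have c: "con {s, TNeg t}" using F_TNeg st(2) by (intro conF) auto
    obtain D p where D: "finite D" "BG \<subseteq> D" "nul p"
      "\<And>\<rho> v H. good D \<rho> v \<Longrightarrow> ufilter A H \<Longrightarrow> gv A \<rho> v p \<notin> H \<Longrightarrow> gv A \<rho> v s \<in> H \<longleftrightarrow> gv A \<rho> v t \<in> H"
      using st(1) unfolding teqv_def by metis
    obtain \<rho> v H where g: "good (D \<union> BG) \<rho> v" and H: "ufilter A H"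
      "\<forall>q\<in>{s, TNeg t}. gv A \<rho> v q \<in> H" "gv A \<rho> v p \<notin> H"
      using conX[OF c D(1,3)] by blast
    have "gv A \<rho> v s \<in> H" "gv A \<rho> v (TNeg t) \<in> H" using H(2) by blast+
    moreover have "good D \<rho> v" using g by (rule good_mono[rotated]) auto
    ultimately show False using D(4) H good_in[OF g] by (simp add: uf)
  qed
  then show "s \<approx> t \<Longrightarrow> s \<in> F \<longleftrightarrow> t \<in> F" using teqv_sym by blast
qed

lemma TVar_teqv:
  assumes "tinds q \<subseteq> BG" "x \<in> carr A" "gv A \<rho>0 v0 q = x"
  shows "TVar x \<approx> q"
proof (rule teqvI[OF finite.emptyI])
  \<comment> \<open>The symmetric difference of the generator and q, which the diagram declares to
    be 0.\<close>
  let ?p = "TPlus (tmt (TVar x) (TNeg q)) (tmt q (TNeg (TVar x)))"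
  show "nul ?p" using assms by (simp add: nul_def gv_tmt v0_def zero_eq pl_zero)
  fix \<rho> v H assume "good {} \<rho> v" "ufilter A H" "gv A \<rho> v ?p \<notin> H"
  then show "gv A \<rho> v (TVar x) \<in> H \<longleftrightarrow> gv A \<rho> v q \<in> H"
    using good_in[of "{}" \<rho> v] good_in[of "{}" \<rho> v "TVar x"] by (auto simp: uf gv_tmt)
qed

lemma tsub_TPlus: "tsub j k (TPlus s t) \<approx> TPlus (tsub j k s) (tsub j k t)"
  by (rule teqv_eqI[of "{}"]) (auto simp: gv_tsub sub_pl)

lemma tsub_TNeg: "j \<noteq> k \<Longrightarrow> tsub j k (TNeg t) \<approx> TNeg (tsub j k t)"
  by (rule teqv_eqI[of "{j, k}"]) (auto simp: gv_tsub good_neq sub_ng)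

lemma tsub_TCyl_other: "j \<noteq> k \<Longrightarrow> l \<noteq> j \<Longrightarrow> l \<noteq> k \<Longrightarrow> tsub j k (TCyl l t) \<approx> TCyl l (tsub j k t)"
  by (rule teqv_eqI[of "{j, k, l}"]) (auto simp: gv_tsub good_neq sub_cyl_other)

lemma tsub_TCyl_same: "j \<noteq> k \<Longrightarrow> tsub j k (TCyl j t) \<approx> TCyl j t"
  by (rule teqv_eqI[of "{j, k}"]) (auto simp: gv_tsub good_neq sub_cyl_same)

lemma tsub_tsub: "j \<noteq> l \<Longrightarrow> j \<noteq> k \<Longrightarrow> j \<noteq> m \<Longrightarrow> l \<noteq> k \<Longrightarrow> l \<noteq> m \<Longrightarrow>
  tsub j k (tsub l m t) \<approx> tsub l m (tsub j k t)"
  by (rule teqv_eqI[of "{j, k, l, m}"]) (auto simp: gv_tsub good_neq sub_sub_comm)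

lemma tsub_TDiag:
  assumes "j \<noteq> k"
  shows "tsub j k (TDiag l m) \<approx> TDiag (if l = j then k else l) (if m = j then k else m)"
proof (rule teqv_eqI[of "{j, k, l, m}"])
  fix \<rho> v assume g: "good {j, k, l, m} \<rho> v"
  note n = good_neq[OF g]
  have jk: "\<rho> j \<noteq> \<rho> k" using assms n by blast
  have l: "l \<noteq> j \<Longrightarrow> \<rho> j \<noteq> \<rho> l" and m: "m \<noteq> j \<Longrightarrow> \<rho> j \<noteq> \<rho> m" using n by blast+
  show "gv A \<rho> v (tsub j k (TDiag l m)) = gv A \<rho> v (TDiag (if l = j then k else l) (if m = j then k else m))"
    using sub_diag[OF jk l] sub_diag[OF jk m] sub_diag_other[OF jk l m] jk sub_one diag_sym[of "\<rho> j" "\<rho> l"]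
      diag_sym[of "\<rho> k" "\<rho> l"]
    by (cases "l = j"; cases "m = j") (auto simp: gv_tsub diag_refl)
qed auto

lemma TDiag_sym: "TDiag j k \<in> F \<Longrightarrow> TDiag k j \<in> F"
  by (erule F_mono[of _ "{}"]) (simp_all add: diag_sym ble_iff)

lemma TDiag_trans: "TDiag j k \<in> F \<Longrightarrow> TDiag k l \<in> F \<Longrightarrow> TDiag j l \<in> F"
  by (erule (1) F_mono2[of _ _ "{}"]) (auto simp: ble_iff uf intro: diag_trans)

primrec isW :: "('i, 'a) ix \<Rightarrow> bool" where
  "isW (Base i) = False"
| "isW (Wit j t) = True"

lemma Base_neq: "isW k \<Longrightarrow> Base i \<noteq> k"
  by auto

lemma hax_witness: "TCyl j t \<in> F \<Longrightarrow> tsub j (Wit j t) t \<in> F"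
  using haxF[of j t] by (simp add: hax_def F_TPlus F_TNeg)

text \<open>One representative for each class of indices identified by F. Choosing it among the
  witnesses keeps it distinct from all \<open>Base\<close> indices, so that substituting it never
  interferes with another substitution.\<close>

definition rp :: "('i, 'a) ix \<Rightarrow> ('i, 'a) ix" where
  "rp k = (SOME w. isW w \<and> TDiag k w \<in> F)"

lemma rp_ex: "\<exists>w. isW w \<and> TDiag k w \<in> F"
proof -
  obtain i :: 'i where "Base i \<noteq> k" using other_index by (metis ix.inject(1))
  let ?l = "Base i :: ('i, 'a) ix"
  \<comment> \<open>The law c_l d_lk = 1 has a witness, and the Henkin axiom identifies that witness
    with k.\<close>
  let ?w = "Wit ?l (TDiag ?l k)"
  have "TCyl ?l (TDiag ?l k) \<in> F"
  proof (rule F_entails[of "{?l, k}" "{}"])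
    fix \<rho> v H assume g: "good {?l, k} \<rho> v" and H: "ufilter A H"
    have "\<rho> ?l \<noteq> \<rho> k" using good_neq[OF g] \<open>?l \<noteq> k\<close> by blast
    then show "gv A \<rho> v (TCyl ?l (TDiag ?l k)) \<in> H" using H by (simp add: cyl_diag uf)
  qed auto
  then have "tsub ?l ?w (TDiag ?l k) \<in> F" by (rule hax_witness)
  then have "TDiag ?w k \<in> F" using F_cong[OF tsub_TDiag[of ?l ?w ?l k]] \<open>?l \<noteq> k\<close> by auto
  then show ?thesis using TDiag_sym by (intro exI[of _ ?w]) auto
qed

lemma rp: "isW (rp k)" "TDiag k (rp k) \<in> F"
  using someI_ex[OF rp_ex[of k]] by (auto simp: rp_def)

lemma rp_eq: "TDiag j k \<in> F \<longleftrightarrow> rp j = rp k"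
proof
  assume "TDiag j k \<in> F"
  then have "TDiag j w \<in> F \<longleftrightarrow> TDiag k w \<in> F" for w using TDiag_sym TDiag_trans by blast
  then show "rp j = rp k" by (simp add: rp_def)
next
  assume "rp j = rp k"
  then show "TDiag j k \<in> F" using rp(2)[of j] rp(2)[of k] TDiag_sym TDiag_trans by metis
qed

lemma rp_rp: "rp (rp k) = rp k"
  using rp(2)[of k] rp_eq by metis

text \<open>A simultaneous substitution carried out in steps; as long as the values of
  \<open>\<sigma>\<close> are witness indices, the steps commute.\<close>

primrec Sb :: "('i \<Rightarrow> ('i, 'a) ix) \<Rightarrow> 'i list \<Rightarrow> ('i, 'a) tm \<Rightarrow> ('i, 'a) tm" where
  "Sb \<sigma> [] t = t"
| "Sb \<sigma> (\<gamma> # gs) t = tsub (Base \<gamma>) (\<sigma> \<gamma>) (Sb \<sigma> gs t)"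

lemma Sb_cong: "s \<approx> t \<Longrightarrow> Sb \<sigma> gs s \<approx> Sb \<sigma> gs t"
  by (induction gs) (auto intro: teqv_tsub)

lemma Sb_agree: "(\<And>\<gamma>. \<gamma> \<in> set gs \<Longrightarrow> \<sigma> \<gamma> = \<tau> \<gamma>) \<Longrightarrow> Sb \<sigma> gs t = Sb \<tau> gs t"
  by (induction gs) auto

context
  fixes \<sigma> :: "'i \<Rightarrow> ('i, 'a) ix"
  assumes \<sigma>: "\<And>\<gamma>. isW (\<sigma> \<gamma>)"
begin

lemma Sb_TPlus: "Sb \<sigma> gs (TPlus s t) \<approx> TPlus (Sb \<sigma> gs s) (Sb \<sigma> gs t)"
  by (induction gs) (auto intro: teqv_refl teqv_trans[OF teqv_tsub tsub_TPlus])

lemma Sb_TNeg: "Sb \<sigma> gs (TNeg t) \<approx> TNeg (Sb \<sigma> gs t)"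
  by (induction gs) (auto intro: teqv_refl teqv_trans[OF teqv_tsub tsub_TNeg[OF Base_neq[OF \<sigma>]]])

lemma Sb_TCyl_other: "\<gamma> \<notin> set gs \<Longrightarrow> Sb \<sigma> gs (TCyl (Base \<gamma>) t) \<approx> TCyl (Base \<gamma>) (Sb \<sigma> gs t)"
proof (induction gs)
  case (Cons \<delta> gs)
  have "tsub (Base \<delta>) (\<sigma> \<delta>) (Sb \<sigma> gs (TCyl (Base \<gamma>) t)) \<approx> tsub (Base \<delta>) (\<sigma> \<delta>) (TCyl (Base \<gamma>) (Sb \<sigma> gs t))"
    using Cons by (intro teqv_tsub) auto
  also have "\<dots> \<approx> TCyl (Base \<gamma>) (tsub (Base \<delta>) (\<sigma> \<delta>) (Sb \<sigma> gs t))"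
    using Cons.prems \<sigma> Base_neq by (intro tsub_TCyl_other) auto
  finally show ?case by simp
qed (simp add: teqv_refl)

lemma Sb_move: "distinct gs \<Longrightarrow> \<gamma> \<in> set gs \<Longrightarrow>
  Sb \<sigma> gs t \<approx> tsub (Base \<gamma>) (\<sigma> \<gamma>) (Sb \<sigma> (remove1 \<gamma> gs) t)"
proof (induction gs)
  case (Cons \<delta> gs)
  show ?case
  proof (cases "\<delta> = \<gamma>")
    case True then show ?thesis by (simp add: teqv_refl)
  next
    case False
    have "Sb \<sigma> (\<delta> # gs) t \<approx> tsub (Base \<delta>) (\<sigma> \<delta>) (tsub (Base \<gamma>) (\<sigma> \<gamma>) (Sb \<sigma> (remove1 \<gamma> gs) t))"
      using Cons False by (auto intro: teqv_tsub)
    also have "\<dots> \<approx> tsub (Base \<gamma>) (\<sigma> \<gamma>) (tsub (Base \<delta>) (\<sigma> \<delta>) (Sb \<sigma> (remove1 \<gamma> gs) t))"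
      using False \<sigma> Base_neq by (intro tsub_tsub) auto
    finally show ?thesis using False by simp
  qed
qed simp

text \<open>The cylindrification binds \<open>\<gamma>\<close>: once the step at
  \<open>\<gamma>\<close> has been moved to the front it acts trivially.\<close>

lemma Sb_TCyl:
  assumes gs: "distinct gs" "\<gamma> \<in> set gs"
  shows "Sb \<sigma> gs (TCyl (Base \<gamma>) t) \<approx> TCyl (Base \<gamma>) (Sb \<sigma> (remove1 \<gamma> gs) t)"
proof -
  have "Sb \<sigma> gs (TCyl (Base \<gamma>) t) \<approx> tsub (Base \<gamma>) (\<sigma> \<gamma>) (Sb \<sigma> (remove1 \<gamma> gs) (TCyl (Base \<gamma>) t))"
    by (rule Sb_move[OF gs])
  also have "\<dots> \<approx> tsub (Base \<gamma>) (\<sigma> \<gamma>) (TCyl (Base \<gamma>) (Sb \<sigma> (remove1 \<gamma> gs) t))"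
    using gs by (intro teqv_tsub Sb_TCyl_other) simp
  also have "\<dots> \<approx> TCyl (Base \<gamma>) (Sb \<sigma> (remove1 \<gamma> gs) t)"
    using \<sigma> Base_neq by (intro tsub_TCyl_same) auto
  finally show ?thesis .
qed

definition st :: "'i list \<Rightarrow> ('i, 'a) ix \<Rightarrow> ('i, 'a) ix" where
  "st gs j = (if j \<in> Base ` set gs then \<sigma> (\<rho>0 j) else j)"

lemma Sb_TDiag: "distinct gs \<Longrightarrow> Sb \<sigma> gs (TDiag j k) \<approx> TDiag (st gs j) (st gs k)"
proof (induction gs)
  case Nil then show ?case by (simp add: st_def teqv_refl)
next
  case (Cons \<gamma> gs)
  have s: "(if st gs j = Base \<gamma> then \<sigma> \<gamma> else st gs j) = st (\<gamma> # gs) j" for j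
    using Cons.prems \<sigma> by (auto simp: st_def dest: Base_neq[of _ \<gamma>] split: if_splits)
      (metis Base_neq \<sigma>)+
  have "Sb \<sigma> (\<gamma> # gs) (TDiag j k) \<approx> tsub (Base \<gamma>) (\<sigma> \<gamma>) (TDiag (st gs j) (st gs k))"
    using Cons by (auto intro: teqv_tsub)
  also have "\<dots> \<approx> TDiag (st (\<gamma> # gs) j) (st (\<gamma> # gs) k)"
    using tsub_TDiag[of "Base \<gamma>" "\<sigma> \<gamma>" "st gs j" "st gs k"] \<sigma> Base_neq unfolding s by auto
  finally show ?case .
qed

text \<open>Replacing an index by an equal one preserves truth. This provides the sequence that
  shows the image of \<open>a\<close> to be nonempty.\<close>

lemma Sb_self:
  assumes "\<And>\<gamma>. TDiag (Base \<gamma>) (\<sigma> \<gamma>) \<in> F" "t \<in> F"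
  shows "Sb \<sigma> gs t \<in> F"
proof (induction gs)
  case (Cons \<gamma> gs)
  show ?case unfolding Sb.simps
    by (rule F_mono2[OF assms(1)[of \<gamma>] Cons.IH finite.emptyI]) (use good_in in \<open>simp add: gv_tsub diag_le_sub\<close>)
qed (simp add: assms)

end

text \<open>Forwards this is the Henkin axiom, with the witness exchanged for its representative by
  \<open>diag_sub_le\<close>; backwards, every substitution instance of t lies below c_j t.\<close>

lemma TCyl_iff: "TCyl j t \<in> F \<longleftrightarrow> (\<exists>k\<in>range rp. tsub j k t \<in> F)" if j: "j = Base \<gamma>"
proof
  let ?w = "Wit j t"
  assume "TCyl j t \<in> F"
  then have "tsub j ?w t \<in> F" by (rule hax_witness)
  have "tsub j (rp ?w) t \<in> F"
  proof (rule F_mono2[OF rp(2)[of ?w] \<open>tsub j ?w t \<in> F\<close>, of "{j, ?w, rp ?w}"])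
    fix \<rho> v assume g: "good {j, ?w, rp ?w} \<rho> v"
    have "\<rho> j \<noteq> \<rho> ?w" "\<rho> j \<noteq> \<rho> (rp ?w)"
      using good_neq[OF g] Base_neq[OF rp(1)] j by blast+
    then show "ble A (bmult A (gv A \<rho> v (TDiag ?w (rp ?w))) (gv A \<rho> v (tsub j ?w t))) (gv A \<rho> v (tsub j (rp ?w) t))"
      using diag_sub_le good_in[OF g] by (simp add: gv_tsub)
  qed auto
  then show "\<exists>k\<in>range rp. tsub j k t \<in> F" by blast
next
  assume "\<exists>k\<in>range rp. tsub j k t \<in> F"
  then obtain k where "tsub j k t \<in> F" by blast
  then show "TCyl j t \<in> F"
  proof (rule F_mono[OF _ finite.emptyI])
    fix \<rho> v assume g: "good {} \<rho> v"
    show "ble A (gv A \<rho> v (tsub j k t)) (gv A \<rho> v (TCyl j t))"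
      unfolding gv_tsub sub_def gv.simps using good_in[OF g] by (intro cyl_mono) (auto simp: ble_iff uf)
  qed
qed

end

text \<open>Base points are the classes of Henkin indices. A sequence belongs to h x if substituting
  its entries for the indices of \<open>\<Gamma>\<close> in the generator x gives a member of F; the
  diagram allows x to be replaced by any term over \<open>\<Gamma>\<close> with value x.\<close>

lemma (in henkin) henkin_representation:
  obtains W :: "('a + 'i) set" and h where "reduct_hom \<Gamma> A (full_set_alg W (seqs W)) h" "h a \<noteq> {}"
proof -
  obtain F where "TVar a \<in> F" "\<And>j t. hax j t \<in> F" "\<And>X. finite X \<Longrightarrow> X \<subseteq> F \<Longrightarrow> con X"
    "\<And>t. t \<in> F \<or> TNeg t \<in> F" using henkin_set by blast
  then interpret henkin_model A \<Gamma> a F by unfold_locales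
  obtain enc :: "('i, 'a) ix \<Rightarrow> 'a + 'i" where enc: "inj enc" using ix_embeds[OF inf] by blast
  obtain gs where gs: "distinct gs" "set gs = \<Gamma>" using finite_distinct_list[OF \<Gamma>] by blast
  define W where "W = enc ` range rp"
  define \<sigma> :: "('i \<Rightarrow> 'a + 'i) \<Rightarrow> 'i \<Rightarrow> ('i, 'a) ix" where "\<sigma> s \<gamma> = inv enc (s \<gamma>)" for s \<gamma>
  define h where "h x = {s \<in> seqs W. Sb (\<sigma> s) gs (TVar x) \<in> F}" for x
  have \<sigma>r: "\<sigma> s \<gamma> \<in> range rp" if "s \<in> seqs W" for s \<gamma>
  proof -
    have "s \<gamma> \<in> enc ` range rp" using that by (simp add: seqs_def W_def)
    then show ?thesis using enc by (auto simp: \<sigma>_def)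
  qed
  have \<sigma>W: "isW (\<sigma> s \<gamma>)" if "s \<in> seqs W" for s \<gamma>
    using \<sigma>r[OF that, of \<gamma>] rp(1) by auto
  have hx: "s \<in> h x \<longleftrightarrow> Sb (\<sigma> s) gs t \<in> F"
    if "s \<in> seqs W" "x \<in> carr A" "tinds t \<subseteq> BG" "gv A \<rho>0 v0 t = x" for s x t
    using that F_cong[OF Sb_cong[OF TVar_teqv[OF that(3,2,4)]]] by (simp add: h_def)
  have hs: "h x \<subseteq> seqs W" for x by (auto simp: h_def)
  have "h (bplus A x y) = h x \<union> h y" if "x \<in> carr A" "y \<in> carr A" for x y
  proof (intro set_eqI)
    fix s
    show "s \<in> h (bplus A x y) \<longleftrightarrow> s \<in> h x \<union> h y"
      using hx[of s "bplus A x y" "TPlus (TVar x) (TVar y)"] that hs F_cong[OF Sb_TPlus[OF \<sigma>W]]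
      by (cases "s \<in> seqs W") (auto simp: v0_def F_TPlus h_def)
  qed
  moreover have "h (bneg A x) = seqs W - h x" if "x \<in> carr A" for x
  proof (intro set_eqI)
    fix s
    show "s \<in> h (bneg A x) \<longleftrightarrow> s \<in> seqs W - h x"
      using hx[of s "bneg A x" "TNeg (TVar x)"] that hs F_cong[OF Sb_TNeg[OF \<sigma>W]]
      by (cases "s \<in> seqs W") (auto simp: v0_def F_TNeg h_def)
  qed
  moreover have "h (diag A i j) = {s \<in> seqs W. s i = s j}" if ij: "i \<in> \<Gamma>" "j \<in> \<Gamma>" for i j
  proof (intro set_eqI)
    fix s
    have "s \<in> h (diag A i j) \<longleftrightarrow> s i = s j" if s: "s \<in> seqs W"
    proof -
      have "s \<in> h (diag A i j) \<longleftrightarrow> TDiag (st (\<sigma> s) gs (Base i)) (st (\<sigma> s) gs (Base j)) \<in> F"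
        using hx[OF s, of "diag A i j" "TDiag (Base i) (Base j)"] F_cong[OF Sb_TDiag[OF \<sigma>W[OF s] gs(1)]] ij by auto
      also have "\<dots> \<longleftrightarrow> TDiag (\<sigma> s i) (\<sigma> s j) \<in> F" using ij gs by (simp add: st_def[OF \<sigma>W[OF s]])
      also have "\<dots> \<longleftrightarrow> \<sigma> s i = \<sigma> s j"
        using \<sigma>r[OF s, of i] \<sigma>r[OF s, of j] rp_rp by (auto simp: rp_eq)
      also have "\<dots> \<longleftrightarrow> s i = s j"
      proof -
        have "s i \<in> range enc" "s j \<in> range enc" using s by (auto simp: seqs_def W_def)
        then show ?thesis unfolding \<sigma>_def by (metis f_inv_into_f)
      qed
      finally show ?thesis .
    qed
    then show "s \<in> h (diag A i j) \<longleftrightarrow> s \<in> {s \<in> seqs W. s i = s j}" using hs by blast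
  qed
  moreover have "h (cyl A \<gamma> x) = cyl (full_set_alg W (seqs W)) \<gamma> (h x)" if g: "\<gamma> \<in> \<Gamma>" and x: "x \<in> carr A" for \<gamma> x
  proof (intro set_eqI)
    fix s
    have "s \<in> h (cyl A \<gamma> x) \<longleftrightarrow> (\<exists>u\<in>W. s(\<gamma> := u) \<in> h x)" if s: "s \<in> seqs W"
    proof -
      let ?T = "Sb (\<sigma> s) (remove1 \<gamma> gs) (TVar x)"
      have "s \<in> h (cyl A \<gamma> x) \<longleftrightarrow> Sb (\<sigma> s) gs (TCyl (Base \<gamma>) (TVar x)) \<in> F"
        using g x by (intro hx[OF s]) (auto simp: v0_def)
      also have "\<dots> \<longleftrightarrow> TCyl (Base \<gamma>) ?T \<in> F" using gs g by (intro F_cong Sb_TCyl \<sigma>W[OF s]) auto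
      also have "\<dots> \<longleftrightarrow> (\<exists>k\<in>range rp. tsub (Base \<gamma>) k ?T \<in> F)" using TCyl_iff by blast
      also have "\<dots> \<longleftrightarrow> (\<exists>k\<in>range rp. s(\<gamma> := enc k) \<in> h x)"
      proof (intro bex_cong refl)
        fix k assume k: "k \<in> range rp"
        have s': "s(\<gamma> := enc k) \<in> seqs W" using s k by (auto simp: seqs_def W_def)
        let ?\<tau> = "\<sigma> (s(\<gamma> := enc k))"
        have "?T = Sb ?\<tau> (remove1 \<gamma> gs) (TVar x)"
          using gs by (intro Sb_agree) (auto simp: \<sigma>_def)
        moreover have "?\<tau> \<gamma> = k" using enc by (simp add: \<sigma>_def)
        ultimately have "tsub (Base \<gamma>) k ?T \<in> F \<longleftrightarrow> Sb ?\<tau> gs (TVar x) \<in> F"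
          using F_cong[OF Sb_move[OF \<sigma>W[OF s'] gs(1), where \<gamma> = \<gamma> and t = "TVar x"]] g gs(2) by simp
        then show "tsub (Base \<gamma>) k ?T \<in> F \<longleftrightarrow> s(\<gamma> := enc k) \<in> h x" using s' by (simp add: h_def)
      qed
      finally show ?thesis by (simp add: W_def)
    qed
    then show "s \<in> h (cyl A \<gamma> x) \<longleftrightarrow> s \<in> cyl (full_set_alg W (seqs W)) \<gamma> (h x)"
      using hs unfolding cyl_full_seqs[OF hs] by blast
  qed
  ultimately have hom: "reduct_hom \<Gamma> A (full_set_alg W (seqs W)) h"
    using hs by (auto simp: reduct_hom_def)
  \<comment> \<open>Every index is sent to its own class.\<close>
  let ?s = "\<lambda>\<gamma>. enc (rp (Base \<gamma>))"
  have s: "?s \<in> seqs W" by (auto simp: seqs_def W_def)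
  have "\<sigma> ?s \<gamma> = rp (Base \<gamma>)" for \<gamma> using enc by (simp add: \<sigma>_def)
  then have "Sb (\<sigma> ?s) gs (TVar a) \<in> F" using aF rp by (intro Sb_self) auto
  then have "?s \<in> h a" using s by (simp add: h_def)
  then show thesis using hom that by blast
qed

section \<open>Representability of inductive algebras\<close>

lemma list_embeds:
  assumes "infinite (UNIV :: 'x set)"
  obtains f :: "'x list \<Rightarrow> 'x" where "inj f"
proof -
  obtain p :: "nat \<Rightarrow> 'x \<Rightarrow> 'x \<Rightarrow> 'x"
    where p: "\<And>m x y n x' y'. p m x y = p n x' y' \<longleftrightarrow> m = n \<and> x = x' \<and> y = y'"
    using infinite_pairing[OF assms] by metis
  define f where "f = rec_list (p 0 undefined undefined) (\<lambda>x _ r. p 1 x r)"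
  have f: "f [] = p 0 undefined undefined" "\<And>x xs. f (x # xs) = p 1 x (f xs)" by (simp_all add: f_def)
  have "f xs = f ys \<Longrightarrow> xs = ys" for xs ys
  proof (induction xs arbitrary: ys)
    case Nil then show ?case by (cases ys) (auto simp: f p)
  next
    case (Cons x xs) then show ?case by (cases ys) (auto simp: f p)
  qed
  then show thesis using that[of f] by (auto simp: inj_def)
qed

text \<open>Indexing the ultraproduct by \<open>'i\<close> itself gives its elements the type
  \<open>'i \<Rightarrow> 'a + 'i\<close> that \<open>RCA\<close> allows.\<close>

lemma finite_sets_enumerated:
  assumes "infinite (UNIV :: 'i set)"
  obtains g :: "'i \<Rightarrow> 'i set" where "\<And>k. finite (g k)" "\<And>\<Gamma>. finite \<Gamma> \<Longrightarrow> \<exists>k. g k = \<Gamma>"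
proof -
  obtain f :: "'i list \<Rightarrow> 'i" where "inj f" using list_embeds[OF assms] by blast
  then have "\<exists>k. set (inv f k) = \<Gamma>" if "finite \<Gamma>" for \<Gamma> :: "'i set"
    using finite_list[OF that] by (metis inv_f_f)
  then show thesis using that[of "\<lambda>k. set (inv f k)"] by auto
qed

text \<open>By the first clause almost every factor represents the operations with any given
  index.\<close>

definition fine_ultrafilter :: "('i \<Rightarrow> 'i set) \<Rightarrow> 'i set set \<Rightarrow> bool" where
  "fine_ultrafilter g F \<longleftrightarrow> (\<forall>i. {k. i \<in> g k} \<in> F) \<and> (\<forall>S. - S \<in> F \<longleftrightarrow> S \<notin> F) \<and>
    (\<forall>S T. S \<in> F \<longrightarrow> T \<in> F \<longrightarrow> S \<inter> T \<in> F) \<and> (\<forall>S T. S \<in> F \<longrightarrow> S \<subseteq> T \<longrightarrow> T \<in> F)"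

lemma fine_ultrafilter_exists:
  fixes g :: "'i \<Rightarrow> 'i set"
  assumes g: "\<And>\<Gamma>. finite \<Gamma> \<Longrightarrow> \<exists>k. g k = \<Gamma>"
  shows "\<exists>F. fine_ultrafilter g F"
proof -
  let ?S = "range (\<lambda>i. {k. i \<in> g k})"
  have S: "\<Inter>X \<noteq> {}" if X: "finite X" "X \<subseteq> ?S" for X
  proof -
    obtain I where I: "finite I" "X = (\<lambda>i. {k. i \<in> g k}) ` I" using finite_subset_image[OF X] by blast
    obtain k where "g k = I" using g[OF I(1)] by blast
    then have "k \<in> \<Inter>X" using I(2) by auto
    then show ?thesis by blast
  qed
  obtain F where F: "?S \<subseteq> F" "F \<subseteq> UNIV" "\<And>X. finite X \<Longrightarrow> X \<subseteq> F \<Longrightarrow> \<Inter>X \<noteq> {}"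
    "\<And>A. A \<in> UNIV \<Longrightarrow> A \<in> F \<or> - A \<in> F"
  proof (rule maximal_consistent_set[of "\<lambda>X. \<Inter>X \<noteq> {}" UNIV uminus ?S])
    show "\<Inter>Y \<noteq> {}" if "Y \<subseteq> X" "\<Inter>X \<noteq> {}" for X Y :: "'i set set" using that by blast
    show "\<Inter>(insert A X) \<noteq> {} \<or> \<Inter>(insert (- A) X) \<noteq> {}" if "\<Inter>X \<noteq> {}" for A and X :: "'i set set"
      using that by blast
    show "\<Inter>X \<noteq> {}" if "finite X" "X \<subseteq> ?S" for X using S[OF that] .
  qed auto
  have n: "- A \<in> F \<longleftrightarrow> A \<notin> F" for A
    using F(3)[of "{A, - A}"] F(4)[of A] by auto
  have i: "A \<inter> B \<in> F" if "A \<in> F" "B \<in> F" for A B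
    using F(3)[of "{A, B, - (A \<inter> B)}"] n[of "A \<inter> B"] that by auto
  have m: "B \<in> F" if "A \<in> F" "A \<subseteq> B" for A B
    using F(3)[of "{A, - B}"] n[of B] that by auto
  have "{k. i \<in> g k} \<in> F" for i using F(1) by auto
  then show ?thesis unfolding fine_ultrafilter_def using n i m by (intro exI[of _ F] conjI allI impI)
qed

lemma Ind_representation:
  fixes A :: "('i, 'a) cyl_alg"
  assumes inf: "infinite (UNIV :: 'i set)" and A: "A \<in> Ind" and a: "a \<in> carr A" "a \<noteq> bzero A"
  shows "\<exists>(U :: ('i \<Rightarrow> 'a + 'i) set) H. reduct_hom UNIV A (full_set_alg U (seqs U)) H \<and> H a \<noteq> {}"
proof -
  interpret inductive_alg A using A inf by unfold_locales
  obtain g :: "'i \<Rightarrow> 'i set" where g: "\<And>k. finite (g k)" "\<And>\<Gamma>. finite \<Gamma> \<Longrightarrow> \<exists>k. g k = \<Gamma>"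
    using finite_sets_enumerated[OF inf] by blast
  obtain F where F: "fine_ultrafilter g F"
    using fine_ultrafilter_exists[OF g(2)] by (rule exE)
  have Fg: "{k. i \<in> g k} \<in> F" for i using F by (simp add: fine_ultrafilter_def)
  have Fn: "- S \<in> F \<longleftrightarrow> S \<notin> F" for S using F by (simp add: fine_ultrafilter_def)
  have Fi: "S \<inter> T \<in> F" if "S \<in> F" "T \<in> F" for S T using F that by (simp add: fine_ultrafilter_def)
  have Fm: "T \<in> F" if "S \<in> F" "S \<subseteq> T" for S T using F that unfolding fine_ultrafilter_def by metis
  have Fu: "A \<union> B \<in> F \<longleftrightarrow> A \<in> F \<or> B \<in> F" for A B
    using Fn[of "A \<union> B"] Fn[of A] Fn[of B] Fi[of "- A" "- B"] Fm[of A "A \<union> B"] Fm[of B "A \<union> B"]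
    unfolding Compl_Un by blast
  have Fc: "A \<in> F \<longleftrightarrow> B \<in> F" if "C \<in> F" "A \<inter> C = B \<inter> C" for A B C
    using Fi[of A C] Fi[of B C] Fm[of "A \<inter> C" B] Fm[of "B \<inter> C" A] that by blast
  have "\<exists>(W :: ('a + 'i) set) h. reduct_hom (g k) A (full_set_alg W (seqs W)) h \<and> h a \<noteq> {}" for k
  proof -
    interpret henkin A "g k" a using g a by unfold_locales auto
    show ?thesis using henkin_representation by metis
  qed
  then obtain W :: "'i \<Rightarrow> ('a + 'i) set" and h
    where h: "\<And>k. reduct_hom (g k) A (full_set_alg (W k) (seqs (W k))) (h k)" "\<And>k. h k a \<noteq> {}"
    by metis
  have hsub: "h k x \<subseteq> seqs (W k)" if "x \<in> carr A" for k x
    using h(1)[of k] that by (auto simp: reduct_hom_def)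
  have "\<exists>t. t \<in> h k a" for k using h(2)[of k] by blast
  then obtain t where t: "\<And>k. t k \<in> h k a" by metis
  have tW: "t k i \<in> W k" for k i using t[of k] hsub[OF a(1), of k] by (auto simp: seqs_def)
  define \<Pi> where "\<Pi> = {f. \<forall>k. f k \<in> W k}"
  define sim where "sim f f' \<longleftrightarrow> {k. f k = f' k} \<in> F" for f f' :: "'i \<Rightarrow> 'a + 'i"
  have "UNIV \<in> F" using Fm[OF Fg] by blast
  then have sim_refl: "sim f f" for f by (simp add: sim_def)
  have sim_sym: "sim f f' \<Longrightarrow> sim f' f" for f f' by (simp add: sim_def eq_commute)
  have sim_trans: "sim f f''" if "sim f f'" "sim f' f''" for f f' f''
    using Fi[OF that[unfolded sim_def]] unfolding sim_def by (rule Fm) auto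
  \<comment> \<open>The base has to consist of functions, so classes are replaced by chosen
    members.\<close>
  define canon where "canon f = (SOME f'. f' \<in> \<Pi> \<and> sim f f')" for f
  have canon: "canon f \<in> \<Pi>" "sim f (canon f)" if "f \<in> \<Pi>" for f
    using someI[of "\<lambda>f'. f' \<in> \<Pi> \<and> sim f f'" f] that sim_refl by (auto simp: canon_def)
  have canon_eq: "canon f = canon f'" if "sim f f'" for f f'
  proof -
    have "sim f f'' = sim f' f''" for f'' using that sim_sym sim_trans by blast
    then show ?thesis by (simp add: canon_def)
  qed
  define U where "U = canon ` \<Pi>"
  have U\<Pi>: "u \<in> \<Pi>" if "u \<in> U" for u using that canon by (auto simp: U_def)
  have U_eq: "u = u'" if "u \<in> U" "u' \<in> U" "sim u u'" for u u'
  proof -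
    obtain f f' where f: "f \<in> \<Pi>" "u = canon f" "f' \<in> \<Pi>" "u' = canon f'"
      using \<open>u \<in> U\<close> \<open>u' \<in> U\<close> by (auto simp: U_def)
    then have "sim f f'" using canon sim_sym sim_trans that(3) by metis
    then show ?thesis using canon_eq f by simp
  qed
  define f where "f i k = t k i" for i k
  have f\<Pi>: "f i \<in> \<Pi>" for i using tW by (auto simp: f_def \<Pi>_def)
  \<comment> \<open>The entry at i may be read through another member of its class, chosen
    separately for each i. The class of \<open>f i\<close> is read as \<open>f i\<close> itself;
    hence the sequence of these classes gives exactly \<open>t k\<close> in every factor. With one
    fixed member per class, infinitely many coordinates would have to agree simultaneously, which an
    ultrafilter does not guarantee.\<close>
  define ch where "ch i u = (if u = canon (f i) then f i else u)" for i u
  have ch: "ch i u \<in> \<Pi>" "sim (ch i u) u" if "u \<in> U" for i u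
    using U\<Pi>[OF that] f\<Pi> canon(2)[OF f\<Pi>] sim_refl by (auto simp: ch_def)
  define at where "at s k i = ch i (s i) k" for s k i
  have at_in: "at s k \<in> seqs (W k)" if "s \<in> seqs U" for s k
    using ch(1) that by (auto simp: at_def seqs_def \<Pi>_def)
  have at_upd: "at (s(i := u)) k = (at s k)(i := ch i u k)" for s i u k
    by (auto simp: at_def)
  define H where "H x = {s \<in> seqs U. {k. at s k \<in> h k x} \<in> F}" for x
  have Hs: "H x \<subseteq> seqs U" for x by (auto simp: H_def)
  have hp: "h k (bplus A x y) = h k x \<union> h k y" "h k (bneg A x) = seqs (W k) - h k x"
    if "x \<in> carr A" "y \<in> carr A" for k x y using h(1)[of k] that by (auto simp: reduct_hom_def)
  have hc: "h k (cyl A i x) = {s \<in> seqs (W k). \<exists>w\<in>W k. s(i := w) \<in> h k x}"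
    if "x \<in> carr A" "i \<in> g k" for k i x
    using h(1)[of k] that cyl_full_seqs[OF hsub[OF that(1)]] by (auto simp: reduct_hom_def)
  have hd: "h k (diag A i j) = {s \<in> seqs (W k). s i = s j}" if "i \<in> g k" "j \<in> g k" for k i j
    using h(1)[of k] that by (auto simp: reduct_hom_def)
  have "H (bplus A x y) = H x \<union> H y" if "x \<in> carr A" "y \<in> carr A" for x y
    using hp(1)[OF that] by (auto simp: H_def Fu Collect_disj_eq)
  moreover have "H (bneg A x) = seqs U - H x" if x: "x \<in> carr A" for x
  proof -
    have "{k. at s k \<in> h k (bneg A x)} = - {k. at s k \<in> h k x}" if "s \<in> seqs U" for s
      using hp(2)[OF x x] at_in[OF that] by auto
    then show ?thesis by (auto simp: H_def Fn)
  qed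
  moreover have "H (diag A i j) = {s \<in> seqs U. s i = s j}" for i j
  proof -
    have "{k. at s k \<in> h k (diag A i j)} \<in> F \<longleftrightarrow> s i = s j" if s: "s \<in> seqs U" for s
    proof -
      have si: "s i \<in> U" "s j \<in> U" using s by (auto simp: seqs_def)
      have "{k. at s k \<in> h k (diag A i j)} \<in> F \<longleftrightarrow> sim (ch i (s i)) (ch j (s j))"
        unfolding sim_def using Fi[OF Fg[of i] Fg[of j]]
        by (rule Fc) (use hd at_in[OF s] in \<open>auto simp: at_def\<close>)
      also have "\<dots> \<longleftrightarrow> sim (s i) (s j)" using ch(2)[OF si(1)] ch(2)[OF si(2)] sim_sym sim_trans by blast
      also have "\<dots> \<longleftrightarrow> s i = s j" using U_eq si sim_refl by auto
      finally show ?thesis .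
    qed
    then show ?thesis by (auto simp: H_def)
  qed
  moreover have "H (cyl A i x) = cyl (full_set_alg U (seqs U)) i (H x)" if x: "x \<in> carr A" for i x
  proof -
    have "{k. at s k \<in> h k (cyl A i x)} \<in> F \<longleftrightarrow> (\<exists>u\<in>U. s(i := u) \<in> H x)" if s: "s \<in> seqs U" for s
    proof
      let ?P = "\<lambda>k w. w \<in> W k \<and> (at s k)(i := w) \<in> h k x"
      let ?K = "{k. \<exists>w. ?P k w}"
      assume "{k. at s k \<in> h k (cyl A i x)} \<in> F"
      then have "{k. at s k \<in> h k (cyl A i x)} \<inter> {k. i \<in> g k} \<in> F" using Fi Fg by blast
      then have K: "?K \<in> F" by (rule Fm) (use hc x in auto)
      \<comment> \<open>Witnesses are chosen factor by factor; the value off \<open>?K\<close> only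
        keeps r inside \<open>\<Pi>\<close>.\<close>
      define r where "r k = (if k \<in> ?K then SOME w. ?P k w else t k i)" for k
      have r: "?P k (r k)" if "k \<in> ?K" for k
        using that someI_ex[of "?P k"] by (simp add: r_def)
      have r\<Pi>: "r \<in> \<Pi>" using r tW by (auto simp: \<Pi>_def r_def)
      let ?u = "canon r"
      have u: "?u \<in> U" using r\<Pi> by (simp add: U_def)
      have "sim r (ch i ?u)" using canon(2)[OF r\<Pi>] ch(2)[OF u] sim_sym sim_trans by blast
      then have "?K \<inter> {k. r k = ch i ?u k} \<in> F" using K Fi by (simp add: sim_def)
      then have "{k. at (s(i := ?u)) k \<in> h k x} \<in> F"
      proof (rule Fm, intro subsetI)
        fix k assume "k \<in> ?K \<inter> {k. r k = ch i ?u k}"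
        then have "k \<in> ?K" "r k = ch i ?u k" by auto
        then show "k \<in> {k. at (s(i := ?u)) k \<in> h k x}" using r[of k] by (simp add: at_upd)
      qed
      moreover have "s(i := ?u) \<in> seqs U" using s u by (auto simp: seqs_def)
      ultimately show "\<exists>u\<in>U. s(i := u) \<in> H x" using u by (auto simp: H_def)
    next
      assume "\<exists>u\<in>U. s(i := u) \<in> H x"
      then obtain u where u: "u \<in> U" "{k. at (s(i := u)) k \<in> h k x} \<in> F" by (auto simp: H_def)
      then have "{k. at (s(i := u)) k \<in> h k x} \<inter> {k. i \<in> g k} \<in> F" using Fi Fg by blast
      then show "{k. at s k \<in> h k (cyl A i x)} \<in> F"
      proof (rule Fm, intro subsetI)
        fix k assume k: "k \<in> {k. at (s(i := u)) k \<in> h k x} \<inter> {k. i \<in> g k}"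
        have "ch i u k \<in> W k" using ch(1)[OF u(1)] by (simp add: \<Pi>_def)
        then show "k \<in> {k. at s k \<in> h k (cyl A i x)}"
          using k hc[OF x, of i k] at_in[OF s] by (auto simp: at_upd)
      qed
    qed
    then show ?thesis unfolding cyl_full_seqs[OF Hs] by (auto simp: H_def)
  qed
  ultimately have "reduct_hom UNIV A (full_set_alg U (seqs U)) H"
    using Hs by (auto simp: reduct_hom_def)
  moreover have "(\<lambda>i. canon (f i)) \<in> H a"
  proof -
    have "at (\<lambda>i. canon (f i)) k = t k" for k by (auto simp: at_def ch_def f_def)
    then show ?thesis using t f\<Pi> \<open>UNIV \<in> F\<close> by (auto simp: H_def seqs_def U_def)
  qed
  ultimately show ?thesis by blast
qed

text \<open>Representations that separate single elements are joined over disjoint copies {a}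
  \<times> U a of their bases, one for each nonzero a.\<close>

lemma RCA_if_separated:
  fixes A :: "('i, 'a) cyl_alg"
  assumes inf: "infinite (UNIV :: 'i set)" and A: "A \<in> CA"
    and sep: "\<And>a. a \<in> carr A \<Longrightarrow> a \<noteq> bzero A \<Longrightarrow>
      \<exists>(U :: ('i \<Rightarrow> 'a + 'i) set) H. reduct_hom UNIV A (full_set_alg U (seqs U)) H \<and> H a \<noteq> {}"
  shows "A \<in> RCA"
proof -
  interpret cylindric A using A inf by unfold_locales
  define N where "N = carr A - {bzero A}"
  obtain U :: "'a \<Rightarrow> ('i \<Rightarrow> 'a + 'i) set" and H
    where H: "\<And>a. a \<in> N \<Longrightarrow> reduct_hom UNIV A (full_set_alg (U a) (seqs (U a))) (H a)" "\<And>a. a \<in> N \<Longrightarrow> H a a \<noteq> {}"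
    using sep unfolding N_def by (metis Diff_iff singletonI)
  define W where "W a = {a} \<times> U a" for a
  define K where "K = W ` N"
  define V :: "('i \<Rightarrow> 'a \<times> ('i \<Rightarrow> 'a + 'i)) set" where "V = (\<Union>X\<in>K. seqs X)"
  define h where "h x = {s. \<exists>a\<in>N. s \<in> seqs (W a) \<and> snd \<circ> s \<in> H a x}" for x
  have Hs: "H a x \<subseteq> seqs (U a)" if "a \<in> N" "x \<in> carr A" for a x
    using H(1)[OF that(1)] that(2) by (auto simp: reduct_hom_def)
  have fst: "fst (s i) = a" if "s \<in> seqs (W a)" for s a i
  proof -
    have "s i \<in> W a" using that by (simp add: seqs_def)
    then show ?thesis by (auto simp: W_def)
  qed
  have V: "V = (\<Union>a\<in>N. seqs (W a))" by (auto simp: V_def K_def)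
  have hx: "s \<in> h x \<longleftrightarrow> snd \<circ> s \<in> H a x" if "a \<in> N" "s \<in> seqs (W a)" for s a x
  proof -
    have "b = a" if "s \<in> seqs (W b)" for b using fst[OF that] fst[OF \<open>s \<in> seqs (W a)\<close>] by simp
    then show ?thesis using that unfolding h_def mem_Collect_eq by blast
  qed
  have hV: "h x \<subseteq> V" for x by (auto simp: h_def V)
  have snd: "snd \<circ> s \<in> seqs (U a)" if "s \<in> seqs (W a)" for s a
  proof -
    have "s i \<in> W a" for i using that by (simp add: seqs_def)
    then have "snd (s i) \<in> U a" for i unfolding W_def by (metis mem_Times_iff)
    then show ?thesis by (simp add: seqs_def)
  qed
  let ?B = "full_set_alg (\<Union>K) V"
  have eqV: "X = Y" if "X \<subseteq> V" "Y \<subseteq> V" "\<And>a s. a \<in> N \<Longrightarrow> s \<in> seqs (W a) \<Longrightarrow> s \<in> X \<longleftrightarrow> s \<in> Y" for X Y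
    using that unfolding V by blast
  have plus: "h (bplus A x y) = h x \<union> h y" if "x \<in> carr A" "y \<in> carr A" for x y
  proof (rule eqV)
    fix a and s :: "'i \<Rightarrow> 'a \<times> ('i \<Rightarrow> 'a + 'i)" assume a: "a \<in> N" "s \<in> seqs (W a)"
    then show "s \<in> h (bplus A x y) \<longleftrightarrow> s \<in> h x \<union> h y"
      using H(1)[OF a(1)] that by (simp add: hx reduct_hom_def)
  qed (use hV in auto)
  have neg: "h (bneg A x) = V - h x" if "x \<in> carr A" for x
  proof (rule eqV)
    fix a and s :: "'i \<Rightarrow> 'a \<times> ('i \<Rightarrow> 'a + 'i)" assume a: "a \<in> N" "s \<in> seqs (W a)"
    have "s \<in> V" using a by (auto simp: V)
    then show "s \<in> h (bneg A x) \<longleftrightarrow> s \<in> V - h x"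
      using H(1)[OF a(1)] that snd[OF a(2)] a by (simp add: hx reduct_hom_def)
  qed (use hV in auto)
  have diag: "h (diag A i j) = {s \<in> V. s i = s j}" for i j
  proof (rule eqV)
    fix a and s :: "'i \<Rightarrow> 'a \<times> ('i \<Rightarrow> 'a + 'i)" assume a: "a \<in> N" "s \<in> seqs (W a)"
    have "s \<in> V" using a by (auto simp: V)
    then show "s \<in> h (diag A i j) \<longleftrightarrow> s \<in> {s \<in> V. s i = s j}"
      using H(1)[OF a(1)] snd[OF a(2)] a fst[OF a(2)] by (simp add: hx reduct_hom_def prod_eq_iff)
  qed (use hV in auto)
  have cyl: "h (cyl A i x) = cyl ?B i (h x)" if x: "x \<in> carr A" for i x
  proof (rule eqV)
    show "cyl ?B i (h x) \<subseteq> V" by (auto simp: full_set_alg_def)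
    fix a and s :: "'i \<Rightarrow> 'a \<times> ('i \<Rightarrow> 'a + 'i)" assume a: "a \<in> N" "s \<in> seqs (W a)"
    have "s \<in> h (cyl A i x) \<longleftrightarrow> snd \<circ> s \<in> cyl (full_set_alg (U a) (seqs (U a))) i (H a x)"
      using H(1)[OF a(1)] x a by (simp add: hx reduct_hom_def)
    also have "\<dots> \<longleftrightarrow> (\<exists>u\<in>U a. (snd \<circ> s)(i := u) \<in> H a x)"
      unfolding cyl_full_seqs[OF Hs[OF a(1) x]] using snd[OF a(2)] by simp
    also have "\<dots> \<longleftrightarrow> s \<in> cyl ?B i (h x)"
    proof
      assume "\<exists>u\<in>U a. (snd \<circ> s)(i := u) \<in> H a x"
      then obtain u where u: "u \<in> U a" "(snd \<circ> s)(i := u) \<in> H a x" by blast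
      let ?s = "s(i := (a, u))"
      have s': "?s \<in> seqs (W a)" using a(2) u(1) by (auto simp: seqs_def W_def)
      have "snd \<circ> ?s = (snd \<circ> s)(i := u)" by auto
      then have "?s \<in> h x" using u(2) hx[OF a(1) s', of x] by simp
      moreover have "s i \<in> \<Union>K" using a by (auto simp: K_def seqs_def)
      moreover have "s = ?s(i := s i)" "s \<in> V" using a by (auto simp: V)
      ultimately show "s \<in> cyl ?B i (h x)"
        unfolding full_set_alg_def cyl_alg.simps mem_Collect_eq
        by (intro exI[of _ ?s] exI[of _ "s i"] conjI) simp_all
    next
      assume "s \<in> cyl ?B i (h x)"
      then obtain r u where r: "s = r(i := u)" "r \<in> h x" by (auto simp: full_set_alg_def)
      then obtain b where b: "b \<in> N" "r \<in> seqs (W b)" "snd \<circ> r \<in> H b x" by (auto simp: h_def)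
      \<comment> \<open>The coordinate j is untouched by the change at i and carries the label of
        the component, so cylindrification stays within one component.\<close>
      obtain j where j: "j \<noteq> i" using other_index[of i] by metis
      have "b = a" using fst[OF b(2), of j] fst[OF a(2), of j] r(1) j by simp
      moreover have "(snd \<circ> s)(i := snd (r i)) = snd \<circ> r" using r(1) by auto
      moreover have "snd (r i) \<in> U b" using snd[OF b(2)] by (simp add: seqs_def)
      ultimately show "\<exists>u\<in>U a. (snd \<circ> s)(i := u) \<in> H a x" using b(3) by metis
    qed
    finally show "s \<in> h (cyl A i x) \<longleftrightarrow> s \<in> cyl ?B i (h x)" .
  qed (rule hV)
  have inj: "inj_on h (carr A)"
  proof (rule inj_onI)
    \<comment> \<open>A nonzero difference of x and y owns a component in which its image is
      nonempty, which h x = h y forbids.\<close>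
    have z: "bmult A x (bneg A y) = bzero A" if xy: "x \<in> carr A" "y \<in> carr A" "h x = h y" for x y
    proof (rule ccontr)
      let ?z = "bmult A x (bneg A y)"
      assume "?z \<noteq> bzero A"
      then have zN: "?z \<in> N" using xy by (simp add: N_def)
      then obtain r where r: "r \<in> H ?z ?z" using H(2) by blast
      let ?s = "\<lambda>i. (?z, r i)"
      have "r \<in> seqs (U ?z)" using r Hs[OF zN, of ?z] xy by auto
      then have "?s \<in> seqs (W ?z)" by (simp add: seqs_def W_def)
      then have "?s \<in> h ?z" using hx[OF zN, of ?s ?z] r by (simp add: comp_def)
      then show False using xy by (auto simp: bmult_def plus neg)
    qed
    fix x y assume xy: "x \<in> carr A" "y \<in> carr A" "h x = h y"
    then have "bmult A x y = x" "bmult A y x = y" using z mt_neg_zero_imp by metis+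
    then show "x = y" using mt_comm xy by metis
  qed
  let ?C = "?B\<lparr>carr := h ` carr A\<rparr>"
  have ops: "bplus ?C = bplus ?B" "bneg ?C = bneg ?B" "cyl ?C = cyl ?B" "diag ?C = diag ?B" "carr ?C = h ` carr A"
    by simp_all
  have "closed_ops ?C"
    unfolding closed_ops_def ops
    using nonempty by (auto simp flip: plus neg diag cyl)
  then have sub: "is_subalgebra ?C ?B"
    unfolding is_subalgebra_def using hV by (intro exI[of _ "h ` carr A"]) auto
  have iso: "cyl_iso A ?C h"
    unfolding cyl_iso_def reduct_hom_def ops
    using plus neg diag cyl inj by (auto simp: bij_betw_def)
  have "\<forall>X\<in>K. \<forall>X'\<in>K. X \<noteq> X' \<longrightarrow> (seqs X :: ('i \<Rightarrow> 'a \<times> ('i \<Rightarrow> 'a + 'i)) set) \<inter> seqs X' = {}"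
  proof (intro ballI impI)
    fix X X' assume "X \<in> K" "X' \<in> K" "X \<noteq> X'"
    then obtain a b where ab: "X = W a" "X' = W b" "a \<noteq> b" by (auto simp: K_def)
    have False if "s \<in> seqs (W a)" "s \<in> seqs (W b)" for s :: "'i \<Rightarrow> 'a \<times> ('i \<Rightarrow> 'a + 'i)"
      using fst[OF that(1)] fst[OF that(2)] ab(3) by simp
    then show "(seqs X :: ('i \<Rightarrow> 'a \<times> ('i \<Rightarrow> 'a + 'i)) set) \<inter> seqs X' = {}" using ab by blast
  qed
  then show ?thesis
    unfolding RCA_def mem_Collect_eq using closed sub iso unfolding V_def by blast
qed

lemma Ind_subset_RCA:
  fixes A :: "('i, 'a) cyl_alg"
  assumes "infinite (UNIV :: 'i set)" "A \<in> Ind"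
  shows "A \<in> RCA"
  using Ind_representation[OF assms] assms by (intro RCA_if_separated) (auto simp: Ind_def)

section \<open>Homomorphisms, isomorphic copies, products and set algebras\<close>

lemma reduct_hom_comp:
  "reduct_hom \<Gamma> A B f \<Longrightarrow> reduct_hom \<Gamma> B C g \<Longrightarrow> reduct_hom \<Gamma> A C (g \<circ> f)"
  by (simp add: reduct_hom_def)

lemma reduct_hom_mono: "\<Gamma> \<subseteq> \<Delta> \<Longrightarrow> reduct_hom \<Delta> A B f \<Longrightarrow> reduct_hom \<Gamma> A B f"
  by (simp add: reduct_hom_def subset_iff)

lemma reduct_hom_zero:
  assumes h: "reduct_hom \<Gamma> A B h" and A: "closed_ops A" "boolean_alg A" and B: "closed_ops B" "boolean_alg B"
  shows "h (bzero A) = bzero B"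
proof -
  interpret A: bool_alg A using A by unfold_locales
  interpret B: bool_alg B using B by unfold_locales
  have *: "h (bmult A x y) = bmult B (h x) (h y)" if "x \<in> carr A" "y \<in> carr A" for x y
    using h that by (simp add: reduct_hom_def bmult_def)
  have "h (bmult A (bone A) (bneg A (bone A))) = bmult B (h (bone A)) (bneg B (h (bone A)))"
    using *[of "bone A" "bneg A (bone A)"] h by (simp add: reduct_hom_def)
  moreover have "h (bone A) \<in> carr B" using h by (simp add: reduct_hom_def)
  ultimately show ?thesis by (simp add: A.zero_eq B.zero_eq)
qed

lemma cyl_iso_inverse:
  assumes A: "closed_ops A" and g: "cyl_iso A B g"
  shows "cyl_iso B A (the_inv_into (carr A) g)"
proof -
  let ?f = "the_inv_into (carr A) g"
  have b: "inj_on g (carr A)" "g ` carr A = carr B" and h: "reduct_hom UNIV A B g"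
    using g by (auto simp: cyl_iso_def bij_betw_def)
  have f: "?f (g x) = x" if "x \<in> carr A" for x by (rule the_inv_into_f_f[OF b(1) that])
  have c: "\<And>x y. x \<in> carr A \<Longrightarrow> y \<in> carr A \<Longrightarrow> bplus A x y \<in> carr A"
    "\<And>x. x \<in> carr A \<Longrightarrow> bneg A x \<in> carr A" "\<And>i x. x \<in> carr A \<Longrightarrow> cyl A i x \<in> carr A" "\<And>i j. diag A i j \<in> carr A"
    using A by (auto simp: closed_ops_def)
  have gh: "\<And>x y. x \<in> carr A \<Longrightarrow> y \<in> carr A \<Longrightarrow> bplus B (g x) (g y) = g (bplus A x y)"
    "\<And>x. x \<in> carr A \<Longrightarrow> bneg B (g x) = g (bneg A x)" "\<And>i x. x \<in> carr A \<Longrightarrow> cyl B i (g x) = g (cyl A i x)"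
    "\<And>i j. diag B i j = g (diag A i j)"
    using h by (auto simp: reduct_hom_def)
  have "bij_betw ?f (g ` carr A) (carr A)"
    using b by (intro bij_betw_the_inv_into) (simp add: bij_betw_def)
  then show ?thesis
    unfolding cyl_iso_def reduct_hom_def b(2)[symmetric] by (simp add: f gh c)
qed

lemma cyl_iso_valid:
  fixes A :: "('i, 'a) cyl_alg" and B :: "('i, 'b) cyl_alg"
  assumes A: "closed_ops A" and g: "cyl_iso A B g"
  shows "valid A e \<longleftrightarrow> valid B e"
proof -
  have h: "reduct_hom UNIV A B g" and b: "inj_on g (carr A)" "g ` carr A = carr B"
    using g by (auto simp: cyl_iso_def bij_betw_def)
  have t: "tval B (g \<circ> v) t = g (tval A v t)" if "\<And>n. v n \<in> carr A" for v t
    by (rule tval_hom[OF h A that]) auto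
  show ?thesis
  proof
    assume e: "valid A e"
    show "valid B e" unfolding valid_def
    proof (intro allI impI)
      fix w :: "nat \<Rightarrow> 'b" assume "\<forall>n. w n \<in> carr B"
      then have "\<forall>n. \<exists>x\<in>carr A. w n = g x" unfolding b(2)[symmetric] by auto
      then obtain v where v: "\<And>n. v n \<in> carr A" "\<And>n. w n = g (v n)" by metis
      then have "w = g \<circ> v" by auto
      then show "tval B w (fst e) = tval B w (snd e)" using t[OF v(1)] validD[OF e v(1)] by simp
    qed
  next
    assume e: "valid B e"
    show "valid A e" unfolding valid_def
    proof (intro allI impI)
      fix v :: "nat \<Rightarrow> 'a" assume v: "\<forall>n. v n \<in> carr A"
      then have "tval B (g \<circ> v) (fst e) = tval B (g \<circ> v) (snd e)"
        using b(2) by (intro validD[OF e]) auto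
      then have "g (tval A v (fst e)) = g (tval A v (snd e))" using t v by simp
      then show "tval A v (fst e) = tval A v (snd e)"
        by (rule inj_onD[OF b(1)]) (use v tval_in[OF A, of v] in auto)
    qed
  qed
qed

text \<open>The counterexamples arise as products and are moved to the type required of them by this
  transport.\<close>

lemma isomorphic_copy:
  assumes A: "closed_ops A" and g: "inj_on g (carr A)"
  obtains B where "closed_ops B" "cyl_iso A B g"
proof -
  let ?f = "the_inv_into (carr A) g"
  have f: "?f (g x) = x" if "x \<in> carr A" for x by (rule the_inv_into_f_f[OF g that])
  define B where "B = \<lparr>carr = g ` carr A, bplus = (\<lambda>x y. g (bplus A (?f x) (?f y))),
    bneg = (\<lambda>x. g (bneg A (?f x))), cyl = (\<lambda>i x. g (cyl A i (?f x))), diag = (\<lambda>i j. g (diag A i j))\<rparr>"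
  have "closed_ops B" using A by (auto simp: closed_ops_def B_def f)
  moreover have "cyl_iso A B g"
    using g by (auto simp: cyl_iso_def reduct_hom_def B_def f bij_betw_def)
  ultimately show thesis by (rule that)
qed

lemma Edc_iso:
  assumes A: "A \<in> CA" and g: "cyl_iso A B g" and B: "B \<in> Edc"
  shows "A \<in> Edc"
proof -
  have cA: "closed_ops A" "boolean_alg A" and cB: "closed_ops B" "boolean_alg B" and BCA: "B \<in> CA"
    using A B by (auto simp: CA_def Edc_def)
  define f where "f = the_inv_into (carr A) g"
  have f: "cyl_iso B A f" unfolding f_def by (rule cyl_iso_inverse[OF cA(1) g])
  have gh: "reduct_hom UNIV A B g" and fh: "reduct_hom UNIV B A f"
    and inj: "inj_on g (carr A)" and injf: "inj_on f (carr B)"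
    using g f by (auto simp: cyl_iso_def bij_betw_def)
  have "\<exists>\<kappa> h. \<kappa> \<notin> \<Gamma> \<and> reduct_hom \<Gamma> A A h \<and> h x \<noteq> bzero A \<and> (\<forall>a\<in>carr A. cyl A \<kappa> (h a) = h a)"
    if x: "finite \<Gamma>" "x \<in> carr A" "x \<noteq> bzero A" for \<Gamma> x
  proof -
    interpret bool_alg A using cA by unfold_locales
    interpret B: bool_alg B using cB by unfold_locales
    have gx: "g x \<in> carr B" using gh x by (auto simp: reduct_hom_def)
    have "g x \<noteq> bzero B"
      using reduct_hom_zero[OF gh cA cB] inj_onD[OF inj, of x "bzero A"] x by auto
    then have "\<exists>\<kappa> h. \<kappa> \<notin> \<Gamma> \<and> reduct_hom \<Gamma> B B h \<and> h (g x) \<noteq> bzero B \<and> (\<forall>a\<in>carr B. cyl B \<kappa> (h a) = h a)"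
      using B x(1) gx unfolding Edc_def by simp
    then obtain k h where h: "k \<notin> \<Gamma>" "reduct_hom \<Gamma> B B h" "h (g x) \<noteq> bzero B"
      "\<And>a. a \<in> carr B \<Longrightarrow> cyl B k (h a) = h a"
      by auto
    let ?h = "f \<circ> (h \<circ> g)"
    have "reduct_hom \<Gamma> A A ?h"
      using reduct_hom_mono[OF subset_UNIV gh] reduct_hom_mono[OF subset_UNIV fh] h(2) reduct_hom_comp by metis
    moreover have "?h x \<noteq> bzero A"
    proof
      assume "?h x = bzero A"
      then have "f (h (g x)) = f (bzero B)" using reduct_hom_zero[OF fh cB cA] by simp
      moreover have "h (g x) \<in> carr B" using h(2) gx by (auto simp: reduct_hom_def)
      ultimately show False using h(3) inj_onD[OF injf] by auto
    qed
    moreover have "cyl A k (?h a) = ?h a" if "a \<in> carr A" for a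
    proof -
      have ga: "g a \<in> carr B" using gh that by (auto simp: reduct_hom_def)
      then have "h (g a) \<in> carr B" using h(2) by (auto simp: reduct_hom_def)
      then have "f (cyl B k (h (g a))) = cyl A k (f (h (g a)))" using fh by (auto simp: reduct_hom_def)
      then show ?thesis using h(4)[OF ga] by simp
    qed
    ultimately show ?thesis using h(1) by blast
  qed
  then show ?thesis using A by (auto simp: Edc_def)
qed

definition prod_alg :: "('r \<Rightarrow> ('i, 'b) cyl_alg) \<Rightarrow> ('i, 'r \<Rightarrow> 'b) cyl_alg" where
  "prod_alg As = \<lparr>carr = {f. \<forall>r. f r \<in> carr (As r)},
    bplus = (\<lambda>f g r. bplus (As r) (f r) (g r)), bneg = (\<lambda>f r. bneg (As r) (f r)),
    cyl = (\<lambda>i f r. cyl (As r) i (f r)), diag = (\<lambda>i j r. diag (As r) i j)\<rparr>"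

lemma prod_alg_sel [simp]:
  "carr (prod_alg As) = {f. \<forall>r. f r \<in> carr (As r)}"
  "bplus (prod_alg As) f g = (\<lambda>r. bplus (As r) (f r) (g r))"
  "bneg (prod_alg As) f = (\<lambda>r. bneg (As r) (f r))"
  "cyl (prod_alg As) i f = (\<lambda>r. cyl (As r) i (f r))"
  "diag (prod_alg As) i j = (\<lambda>r. diag (As r) i j)"
  by (simp_all add: prod_alg_def)

lemma closed_prod_alg:
  assumes "\<And>r. closed_ops (As r)"
  shows "closed_ops (prod_alg As)"
proof -
  have "\<forall>r. \<exists>x. x \<in> carr (As r)" using assms unfolding closed_ops_def by blast
  then have "\<exists>f. \<forall>r. f r \<in> carr (As r)" by metis
  then show ?thesis using assms unfolding closed_ops_def by simp
qed

lemma proj_hom: "reduct_hom UNIV (prod_alg As) (As r) (\<lambda>f. f r)"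
  by (auto simp: reduct_hom_def)

lemma tval_prod_alg: "tval (prod_alg As) v t r = tval (As r) (\<lambda>n. v n r) t"
  by (induction t) auto

lemma valid_prod_alg:
  fixes As :: "'r \<Rightarrow> ('i, 'b) cyl_alg"
  assumes "\<And>r. closed_ops (As r)"
  shows "valid (prod_alg As) e \<longleftrightarrow> (\<forall>r. valid (As r) e)"
proof (intro iffI allI)
  fix r assume e: "valid (prod_alg As) e"
  have "\<forall>r. \<exists>x. x \<in> carr (As r)" using assms unfolding closed_ops_def by blast
  then obtain z where z: "\<And>r. z r \<in> carr (As r)" by metis
  show "valid (As r) e" unfolding valid_def
  proof (intro allI impI)
    fix v :: "nat \<Rightarrow> 'b" assume v: "\<forall>n. v n \<in> carr (As r)"
    have "tval (prod_alg As) (\<lambda>n. z(r := v n)) (fst e) r = tval (prod_alg As) (\<lambda>n. z(r := v n)) (snd e) r"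
      by (rule arg_cong[OF validD[OF e], of _ "\<lambda>f. f r"]) (use v z in auto)
    then show "tval (As r) v (fst e) = tval (As r) v (snd e)" by (simp add: tval_prod_alg)
  qed
next
  assume "\<forall>r. valid (As r) e"
  then show "valid (prod_alg As) e" unfolding valid_def by (auto intro!: ext simp: tval_prod_alg)
qed

text \<open>An equation holds here exactly when its renaming holds in A, so a product over all
  permutations is symmetric.\<close>

definition reindex :: "('i \<Rightarrow> 'i) \<Rightarrow> ('i, 'a) cyl_alg \<Rightarrow> ('i, 'a) cyl_alg" where
  "reindex \<rho> A = \<lparr>carr = carr A, bplus = bplus A, bneg = bneg A,
    cyl = (\<lambda>i. cyl A (\<rho> i)), diag = (\<lambda>i j. diag A (\<rho> i) (\<rho> j))\<rparr>"

lemma tval_reindex: "tval (reindex \<rho> A) v t = tval A v (rename \<rho> t)"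
  by (induction t) (auto simp: reindex_def)

lemma valid_reindex: "valid (reindex \<rho> A) e \<longleftrightarrow> valid A (eq_rename \<rho> e)"
  unfolding valid_def eq_rename_def tval_reindex by (simp add: reindex_def)

lemma closed_reindex: "closed_ops A \<Longrightarrow> closed_ops (reindex \<rho> A)"
  by (simp add: closed_ops_def reindex_def)


definition set_alg :: "('i \<Rightarrow> 'u) set set \<Rightarrow> ('i, ('i \<Rightarrow> 'u) set) cyl_alg" where
  "set_alg S = \<lparr>carr = S, bplus = (\<union>), bneg = uminus, cyl = (\<lambda>i X. {s. \<exists>u. s(i := u) \<in> X}),
    diag = (\<lambda>i j. {s. s i = s j})\<rparr>"

lemma set_alg_sel [simp]:
  "carr (set_alg S) = S" "bplus (set_alg S) X Y = X \<union> Y" "bneg (set_alg S) X = - X"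
  "cyl (set_alg S) i X = {s. \<exists>u. s(i := u) \<in> X}" "diag (set_alg S) i j = {s. s i = s j}"
  by (simp_all add: set_alg_def)

lemma bmult_set_alg [simp]: "bmult (set_alg S) X Y = X \<inter> Y"
  by (simp add: bmult_def)

lemma bone_set_alg: "closed_ops (set_alg S) \<Longrightarrow> bone (set_alg S) = UNIV"
proof -
  assume c: "closed_ops (set_alg S)"
  then obtain X where X: "X \<in> S" by (auto simp: closed_ops_def)
  then have "X \<union> - X \<in> S" using c unfolding closed_ops_def set_alg_sel by blast
  then have "UNIV \<in> S" by simp
  then show ?thesis unfolding bone_def set_alg_sel by (intro the_equality) auto
qed

lemma set_alg_CA:
  fixes S :: "('i \<Rightarrow> 'u) set set"
  assumes "closed_ops (set_alg S)"
  shows "set_alg S \<in> CA"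
proof -
  have b: "boolean_alg (set_alg S)" by (rule boolean_algI[OF assms]) auto
  have c: "{s. \<exists>u v. (s(i := u, j := v)) \<in> X} = {s. \<exists>u v. (s(j := u, i := v)) \<in> X}"
    if "i \<noteq> j" for i j and X :: "('i \<Rightarrow> 'u) set"
    using that by (metis fun_upd_twist)
  have e: "X \<subseteq> {s. \<exists>u. s(i := u) \<in> X}" for i and X :: "('i \<Rightarrow> 'u) set"
    by (metis (mono_tags, lifting) fun_upd_triv mem_Collect_eq subsetI)
  have d: "{s. s i = s j} \<inter> {s. \<exists>u. s(i := u) \<in> {s. s i = s j} \<inter> X} = {s. s i = s j} \<inter> X"
    if "i \<noteq> j" for i j and X :: "('i \<Rightarrow> 'u) set"
  proof -
    have "(\<exists>u. s(i := u) \<in> {s. s i = s j} \<inter> X) \<longleftrightarrow> s \<in> X" if s: "s i = s j" for s :: "'i \<Rightarrow> 'u"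
    proof -
      have "s(i := s j) = s" using s by (metis fun_upd_triv)
      moreover have "s(i := u) \<in> {s. s i = s j} \<inter> X \<longleftrightarrow> u = s j \<and> s(i := u) \<in> X" for u
        using \<open>i \<noteq> j\<close> by auto
      ultimately show ?thesis by auto
    qed
    then show ?thesis by blast
  qed
  show ?thesis unfolding CA_def mem_Collect_eq
  proof (intro conjI allI impI ballI assms b)
    fix i j k :: 'i and X Y :: "('i \<Rightarrow> 'u) set" assume ij: "i \<noteq> j \<and> j \<noteq> k \<and> i \<noteq> k" and "X \<in> carr (set_alg S)" "Y \<in> carr (set_alg S)"
    show "cyl (set_alg S) i (cyl (set_alg S) j X) = cyl (set_alg S) j (cyl (set_alg S) i X)"
      using c[of i j X] ij by simp
    show "ble (set_alg S) X (cyl (set_alg S) i X)"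
      using e[of X i] by (auto simp: ble_def)
    show "bmult (set_alg S) (diag (set_alg S) i j) (cyl (set_alg S) i (bmult (set_alg S) (diag (set_alg S) i j) X)) =
       bmult (set_alg S) (diag (set_alg S) i j) X"
      using d[of i j X] ij by simp
  qed (auto simp: bone_set_alg[OF assms])
qed

lemma tval_set_alg: "tval (set_alg S) v t = tval (set_alg S') v t"
  by (induction t) auto

lemma valid_subalgebra: "S \<subseteq> S' \<Longrightarrow> valid (set_alg S') e \<Longrightarrow> valid (set_alg S) e"
  unfolding valid_def set_alg_sel by (metis subsetD tval_set_alg)

lemma closed_full: "closed_ops (set_alg UNIV)"
  by (simp add: closed_ops_def)

text \<open>Fix a point s. \<open>mix\<close> freezes the coordinates outside e at their values in
  s, and preimages under it form an endomorphism h of the reduct to the indices of e whose values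
  are all c_i-closed. Because \<open>mix s = s\<close>, passing to h does not alter membership of
  s.\<close>

lemma set_alg_UNIV_Ind: "set_alg (UNIV :: ('i \<Rightarrow> 'u) set set) \<in> Ind"
proof -
  let ?A = "set_alg (UNIV :: ('i \<Rightarrow> 'u) set set)"
  have "tval ?A v (fst e) = tval ?A v (snd e)"
    if e: "i \<notin> eq_inds e" "valid ?A (eq_cyl_vars i e)" for e i v
  proof (rule set_eqI)
    fix s :: "'i \<Rightarrow> 'u"
    define mix where "mix r = (\<lambda>k. if k \<in> eq_inds e then r k else s k)" for r
    define h where "h Y = {r. mix r \<in> Y}" for Y
    have mu: "mix (r(k := u)) = (if k \<in> eq_inds e then (mix r)(k := u) else mix r)" for r k u
      by (auto simp: mix_def)
    have hom: "reduct_hom (eq_inds e) ?A ?A h"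
      by (auto simp: reduct_hom_def h_def mu) (auto simp: mix_def)
    have t: "tval ?A (h \<circ> v) t = h (tval ?A v t)" if "inds t \<subseteq> eq_inds e" for t
      by (rule tval_hom[OF hom closed_full _ that]) simp
    have "(\<lambda>n. cyl ?A i ((h \<circ> v) n)) = h \<circ> v" using e(1) by (auto simp: h_def mu)
    then have "tval ?A (h \<circ> v) (fst e) = tval ?A (h \<circ> v) (snd e)"
      using validD[OF e(2), of "h \<circ> v"] by (simp add: eq_cyl_vars_def tval_cyl_vars)
    then have "h (tval ?A v (fst e)) = h (tval ?A v (snd e))" by (simp add: t eq_inds_def)
    moreover have "mix s = s" by (auto simp: mix_def)
    ultimately show "s \<in> tval ?A v (fst e) \<longleftrightarrow> s \<in> tval ?A v (snd e)"
      unfolding h_def set_eq_iff mem_Collect_eq by metis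
  qed
  then show ?thesis using set_alg_CA[OF closed_full] by (auto simp: Ind_def valid_def)
qed

lemma set_alg_representation:
  fixes g :: "'u \<Rightarrow> 'w" and S :: "('i \<Rightarrow> 'u) set set"
  assumes g: "inj g"
  shows "reduct_hom UNIV (set_alg S) (full_set_alg (range g) (seqs (range g)))
    (\<lambda>X. {s \<in> seqs (range g). inv g \<circ> s \<in> X})"
proof -
  let ?h = "\<lambda>X :: ('i \<Rightarrow> 'u) set. {s \<in> seqs (range g). inv g \<circ> s \<in> X}"
  have 1: "?h (cyl (set_alg S) i X) = {s \<in> seqs (range g). \<exists>w\<in>range g. s(i := w) \<in> ?h X}" for i and X :: "('i \<Rightarrow> 'u) set"
  proof -
    have "inv g \<circ> s(i := g u) = (inv g \<circ> s)(i := u)" for u and s :: "'i \<Rightarrow> 'w" using g by auto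
    moreover have "s(i := g u) \<in> seqs (range g)" if "s \<in> seqs (range g)" for u and s :: "'i \<Rightarrow> 'w"
      using that by (auto simp: seqs_def)
    ultimately show ?thesis by auto
  qed
  have 2: "inv g (s i) = inv g (s j) \<longleftrightarrow> s i = s j" if "s \<in> seqs (range g)" for s :: "'i \<Rightarrow> 'w" and i j
  proof -
    have "s i \<in> range g" "s j \<in> range g" using that by (auto simp: seqs_def)
    then show ?thesis by (metis f_inv_into_f)
  qed
  have 3: "{s \<in> seqs (range g). inv g \<circ> s \<in> X} \<subseteq> seqs (range g)" for X :: "('i \<Rightarrow> 'u) set" by auto
  show ?thesis unfolding reduct_hom_def cyl_full_seqs[OF 3] unfolding 1 by (auto simp: 2)
qed

section \<open>Generic functions on sequences\<close>

lemma Cantor_ordLeq: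
  fixes B :: "'i set set"
  assumes "(card_of B, card_of (UNIV :: 'i set)) \<in> ordLeq"
  shows "\<not> (\<exists>f :: 'i set \<Rightarrow> 'i set. inj f \<and> range f \<subseteq> B)"
proof
  assume "\<exists>f :: 'i set \<Rightarrow> 'i set. inj f \<and> range f \<subseteq> B"
  then obtain f :: "'i set \<Rightarrow> 'i set" where f: "inj f" "range f \<subseteq> B" by blast
  obtain b :: "'i set \<Rightarrow> 'i" where b: "inj_on b B" using assms unfolding card_of_ordLeq[symmetric] by auto
  have "inj (b \<circ> f)" using f b by (auto intro: comp_inj_on inj_on_subset)
  then have "surj (inv (b \<circ> f))" by (rule inj_imp_surj_inv)
  then show False using Cantors_theorem[of "UNIV :: 'i set"] by (metis Pow_UNIV)
qed

lemma seq_embeds: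
  assumes "infinite (UNIV :: 'i set)"
  obtains f :: "('i \<Rightarrow> 'i set) \<Rightarrow> 'i set" where "inj f"
proof -
  obtain p :: "nat \<Rightarrow> 'i \<Rightarrow> 'i \<Rightarrow> 'i"
    where p: "\<And>m x y n x' y'. p m x y = p n x' y' \<longleftrightarrow> m = n \<and> x = x' \<and> y = y'"
    using infinite_pairing[OF assms] by metis
  define f :: "('i \<Rightarrow> 'i set) \<Rightarrow> 'i set" where "f r = {z. \<exists>i x. z = p 0 i x \<and> x \<in> r i}" for r
  have f: "r i = {x. p 0 i x \<in> f r}" for r i by (auto simp: f_def p)
  have "inj f"
  proof (intro injI ext)
    fix r r' i assume "f r = f r'"
    then show "r i = r' i" using f[of r i] f[of r' i] by simp
  qed
  then show thesis by (rule that)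
qed

text \<open>A subset of \<open>'i\<close> codes a sort, a finite table and a padding set. The
  padding takes 2^|\<alpha>| values, so |\<alpha>| forbidden codes never exhaust those with a given
  sort and table.\<close>

lemma tokens_exist:
  assumes inf: "infinite (UNIV :: 'i set)"
  obtains srt :: "'i set \<Rightarrow> 'i" and tab :: "'i set \<Rightarrow> (('i \<Rightarrow> 'i set) \<times> 'i) list"
  where "\<And>\<sigma> l B. (card_of B, card_of (UNIV :: 'i set)) \<in> ordLeq \<Longrightarrow> \<exists>u. u \<notin> B \<and> srt u = \<sigma> \<and> tab u = l"
proof -
  obtain p :: "nat \<Rightarrow> 'i \<Rightarrow> 'i \<Rightarrow> 'i"
    where p: "\<And>m x y n x' y'. p m x y = p n x' y' \<longleftrightarrow> m = n \<and> x = x' \<and> y = y'"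
    using infinite_pairing[OF inf] by metis
  obtain sq :: "('i \<Rightarrow> 'i set) \<Rightarrow> 'i set" where sq: "inj sq" using seq_embeds[OF inf] by blast
  have "infinite (UNIV :: 'i set set)" using inf by (simp add: Finite_Set.finite_set)
  then obtain li :: "'i set list \<Rightarrow> 'i set" where li: "inj li" using list_embeds by blast
  define e3 where "e3 X Y Z = {z. (\<exists>x\<in>X. z = p 0 x x) \<or> (\<exists>x\<in>Y. z = p 1 x x) \<or> (\<exists>x\<in>Z. z = p 2 x x)}" for X Y Z
  have e3: "e3 X Y Z = e3 X' Y' Z' \<longleftrightarrow> X = X' \<and> Y = Y' \<and> Z = Z'" for X Y Z X' Y' Z'
  proof -
    have "X = {x. p 0 x x \<in> e3 X Y Z}" "Y = {x. p 1 x x \<in> e3 X Y Z}" "Z = {x. p 2 x x \<in> e3 X Y Z}" for X Y Z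
      by (auto simp: e3_def p)
    then show ?thesis by metis
  qed
  define en where "en = (\<lambda>(r, v). e3 (sq r) {v} {})"
  have "inj en" using sq by (auto simp: inj_def en_def e3)
  then have "inj (map en)" by simp
  define tok where "tok \<sigma> l pad = e3 {\<sigma>} (li (map en l)) pad" for \<sigma> l pad
  have tok: "tok \<sigma> l pad = tok \<sigma>' l' pad' \<longleftrightarrow> \<sigma> = \<sigma>' \<and> l = l' \<and> pad = pad'" for \<sigma> l pad \<sigma>' l' pad'
    using li \<open>inj (map en)\<close> by (auto simp: tok_def e3 inj_eq)
  define dec where "dec u = (SOME x. \<exists>pad. u = tok (fst x) (snd x) pad)" for u
  have dec: "dec (tok \<sigma> l pad) = (\<sigma>, l)" for \<sigma> l pad
    unfolding dec_def by (rule some_equality) (auto simp: tok)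
  show thesis
  proof (rule that[of "fst \<circ> dec" "snd \<circ> dec"])
    fix \<sigma> l and B :: "'i set set" assume "(card_of B, card_of (UNIV :: 'i set)) \<in> ordLeq"
    moreover have "inj (tok \<sigma> l)" by (auto simp: inj_def tok)
    ultimately obtain pad where "tok \<sigma> l pad \<notin> B" using Cantor_ordLeq by blast
    then show "\<exists>u. u \<notin> B \<and> (fst \<circ> dec) u = \<sigma> \<and> (snd \<circ> dec) u = l"
      by (intro exI[of _ "tok \<sigma> l pad"]) (simp add: dec)
  qed
qed

text \<open>The value of \<open>F\<close> at \<open>t(k := u)\<close> is read off from a finite table coded in \<open>u\<close>. The tables of
  the other entries of \<open>t\<close> also mention this sequence only for \<open>|\<alpha>|\<close> many \<open>u\<close>, which are avoided.\<close>

lemma generic_function: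
  assumes inf: "infinite (UNIV :: 'i set)"
  obtains srt :: "'i set \<Rightarrow> 'i" and F :: "('i \<Rightarrow> 'i set) \<Rightarrow> 'i"
  where "\<And>k \<sigma> P q B. finite P \<Longrightarrow> (\<And>t. t \<in> P \<Longrightarrow> t k = {}) \<Longrightarrow>
    (card_of B, card_of (UNIV :: 'i set)) \<in> ordLeq \<Longrightarrow>
    \<exists>u. u \<notin> B \<and> srt u = \<sigma> \<and> (\<forall>t\<in>P. F (t(k := u)) = q t)"
proof -
  obtain srt :: "'i set \<Rightarrow> 'i" and tab :: "'i set \<Rightarrow> (('i \<Rightarrow> 'i set) \<times> 'i) list"
    where tk: "\<And>\<sigma> l B. (card_of B, card_of (UNIV :: 'i set)) \<in> ordLeq \<Longrightarrow> \<exists>u. u \<notin> B \<and> srt u = \<sigma> \<and> tab u = l"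
    using tokens_exist[OF inf] by metis
  \<comment> \<open>The entry being read is blanked by \<open>{}\<close>, which allows its table to
    be fixed before its code is known.\<close>
  define hit where "hit s k v \<longleftrightarrow> map_of (tab (s k)) (s(k := {})) = Some v" for s k v
  define F where "F s = (SOME v. \<exists>k. hit s k v)" for s
  have "\<exists>u. u \<notin> B \<and> srt u = \<sigma> \<and> (\<forall>t\<in>P. F (t(k := u)) = q t)"
    if P: "finite P" "\<And>t. t \<in> P \<Longrightarrow> t k = {}" and B: "(card_of B, card_of (UNIV :: 'i set)) \<in> ordLeq" for k \<sigma> P q B
  proof -
    obtain ps where ps: "set ps = P" using finite_list[OF P(1)] by blast
    define l where "l = map (\<lambda>t. (t, q t)) ps"
    have l: "map_of l t = Some (q t)" if "t \<in> P" for t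
      using that ps by (simp add: l_def map_of_map_restrict)
    \<comment> \<open>What the table at another place k' mentions at place k. If u avoids all these
      finite sets, no table except that of u applies, and the value of F is unambiguous.\<close>
    define C where "C k' = (\<Union>t\<in>P. (\<lambda>r. r k) ` dom (map_of (tab (t k'))))" for k'
    have "finite (C k')" for k' using P(1) by (auto simp: C_def finite_dom_map_of)
    then have "(card_of (C k'), card_of (UNIV :: 'i set)) \<in> ordLeq" for k'
      using inf by (intro ordLess_imp_ordLeq finite_ordLess_infinite card_of_Well_order) (simp_all add: Field_card_of)
    then have "(card_of (\<Union>k'\<in>UNIV. C k'), card_of (UNIV :: 'i set)) \<in> ordLeq"
      using inf by (intro card_of_UNION_ordLeq_infinite) (auto intro: card_of_mono1)
    then have "(card_of (B \<union> (\<Union>k'. C k')), card_of (UNIV :: 'i set)) \<in> ordLeq"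
      using inf B by (intro card_of_Un_ordLeq_infinite_Field card_of_Card_order) (simp_all add: Field_card_of)
    then obtain u where u: "u \<notin> B \<union> (\<Union>k'. C k')" "srt u = \<sigma>" "tab u = l" using tk by metis
    have "F (t(k := u)) = q t" if t: "t \<in> P" for t
    proof -
      have "hit (t(k := u)) k (q t)"
        using l[OF t] u(3) P(2)[OF t] by (simp add: hit_def fun_upd_idem)
      moreover have "v = q t" if h: "hit (t(k := u)) k' v" for k' v
      proof (cases "k' = k")
        case True
        then show ?thesis using h l[OF t] u(3) P(2)[OF t] by (simp add: hit_def fun_upd_idem)
      next
        case False
        then have "(t(k := u))(k' := {}) \<in> dom (map_of (tab (t k')))" using h by (auto simp: hit_def)
        then have "u \<in> C k'" using t False unfolding C_def by (force intro: image_eqI[rotated])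
        then show ?thesis using u(1) by blast
      qed
      ultimately show ?thesis unfolding F_def by (intro some_equality) blast+
    qed
    then show ?thesis using u by blast
  qed
  then show thesis by (rule that)
qed

section \<open>An inductive algebra that is not endo-dimension-complemented\<close>

primrec code_ca :: "(nat \<Rightarrow> 'x \<Rightarrow> 'x \<Rightarrow> 'x) \<Rightarrow> 'x ca_term \<Rightarrow> 'x" where
  "code_ca p (Var n) = p (n + 4) undefined undefined"
| "code_ca p (Plus s t) = p 0 (code_ca p s) (code_ca p t)"
| "code_ca p (Neg t) = p 1 (code_ca p t) (code_ca p t)"
| "code_ca p (Cyl i t) = p 2 i (code_ca p t)"
| "code_ca p (Diag i j) = p 3 i j"

lemma ca_term_embeds:
  assumes "infinite (UNIV :: 'i set)"
  obtains f :: "'i ca_term \<Rightarrow> 'i" where "inj f"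
proof -
  obtain p :: "nat \<Rightarrow> 'i \<Rightarrow> 'i \<Rightarrow> 'i"
    where p: "\<And>m x y n x' y'. p m x y = p n x' y' \<longleftrightarrow> m = n \<and> x = x' \<and> y = y'"
    using infinite_pairing[OF assms] by metis
  have "code_ca p s = code_ca p t \<Longrightarrow> s = t" for s t
    by (induction s arbitrary: t; case_tac t) (auto simp: p)
  then show thesis using that[of "code_ca p"] by (auto simp: inj_def)
qed

text \<open>A family of sets of sequences becomes one such set by interleaving each member with the
  label of its component; products thereby return to the type of their factors.\<close>

lemma function_embeds:
  fixes e :: "'r \<Rightarrow> 'i \<Rightarrow> 'i set"
  assumes inf: "infinite (UNIV :: 'i set)" and e: "inj e"
  obtains g :: "('r \<Rightarrow> ('i \<Rightarrow> 'i set) set) \<Rightarrow> ('i \<Rightarrow> 'i set) set" where "inj g"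
proof -
  obtain p :: "nat \<Rightarrow> 'i \<Rightarrow> 'i \<Rightarrow> 'i"
    where p: "\<And>m x y n x' y'. p m x y = p n x' y' \<longleftrightarrow> m = n \<and> x = x' \<and> y = y'"
    using infinite_pairing[OF inf] by metis
  define pr where "pr r s = (\<lambda>i. p 0 i ` e r i \<union> p 1 i ` s i)" for r and s :: "'i \<Rightarrow> 'i set"
  have pr1: "{x. p 0 i x \<in> pr r s i} = e r i" and pr2: "{x. p 1 i x \<in> pr r s i} = s i" for r s i
    by (auto simp: pr_def p)
  have pr: "pr r s = pr r' s' \<longleftrightarrow> r = r' \<and> s = s'" for r s r' s'
  proof
    assume "pr r s = pr r' s'"
    then have "e r i = e r' i" "s i = s' i" for i using pr1[of i r s] pr1[of i r' s'] pr2[of i r s] pr2[of i r' s'] by auto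
    then have "e r = e r'" "s = s'" by auto
    then show "r = r' \<and> s = s'" using e by (auto dest: injD)
  qed simp
  define g where "g f = {z. \<exists>r s. z = pr r s \<and> s \<in> f r}" for f :: "'r \<Rightarrow> ('i \<Rightarrow> 'i set) set"
  have g: "f r = {s. pr r s \<in> g f}" for f r by (auto simp: g_def pr)
  have "inj g"
  proof (intro injI ext)
    fix f f' r assume "g f = g f'"
    then show "f r = f' r" using g[of f r] g[of f' r] by simp
  qed
  then show thesis by (rule that)
qed

locale splitting =
  fixes F :: "('i \<Rightarrow> 'i set) \<Rightarrow> 'i"
  assumes inf: "infinite (UNIV :: 'i set)"
    and F: "(card_of B, card_of (UNIV :: 'i set)) \<in> ordLeq \<Longrightarrow> \<exists>u. u \<notin> B \<and> F (t(k := u)) = v"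
begin

definition Inj :: "('i \<Rightarrow> 'i set) set" where "Inj = {s. inj s}"

definition X :: "'i set \<Rightarrow> ('i \<Rightarrow> 'i set) set" where "X T = {s. inj s \<and> F s \<in> T}"

text \<open>The subalgebra generated by \<open>Inj\<close> alone; being given by terms, it has only
  |\<alpha>| elements.\<close>

abbreviation tv :: "'i ca_term \<Rightarrow> ('i \<Rightarrow> 'i set) set" where
  "tv \<equiv> tval (set_alg UNIV) (\<lambda>_. Inj)"

text \<open>A normal form: the subalgebra generated by \<open>Inj\<close> is kept off
  \<open>Inj\<close>, and inside \<open>Inj\<close> any union of pieces is allowed.\<close>

definition S :: "('i \<Rightarrow> 'i set) set set" where
  "S = {(tv t - Inj) \<union> X T | t T. True}"

lemma F_range: "\<exists>u. u \<notin> range s \<and> F (t(k := u)) = v" for s :: "'i \<Rightarrow> 'i set"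
  by (rule F) (rule card_of_image)

text \<open>All injective sequences have the same kernel, so this makes \<open>Inj\<close> an atom
  of the subalgebra it generates.\<close>

lemma tv_kernel: "(\<And>i j. s i = s j \<longleftrightarrow> s' i = s' j) \<Longrightarrow> s \<in> tv t \<longleftrightarrow> s' \<in> tv t"
proof (induction t arbitrary: s s')
  case (Var n)
  then show ?case by (auto simp: Inj_def inj_def)
next
  case (Cyl i t)
  have *: "s' \<in> tv (Cyl i t)" if ker: "\<And>i j. s i = s j \<longleftrightarrow> s' i = s' j" and s: "s \<in> tv (Cyl i t)" for s s'
  proof -
    obtain u where u: "s(i := u) \<in> tv t" using s by auto
    \<comment> \<open>u' imitates the equalities of u with the other entries. A genuinely new u
      calls for a value outside the range of s', which exists because the base is larger than the
      dimension.\<close>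
    have "\<exists>u'. \<forall>j. j \<noteq> i \<longrightarrow> (u = s j \<longleftrightarrow> u' = s' j)"
    proof (cases "\<exists>j. j \<noteq> i \<and> u = s j")
      case True
      then obtain j where j: "j \<noteq> i" "u = s j" by blast
      show ?thesis by (intro exI[of _ "s' j"]) (simp only: j(2) ker simp_thms)
    next
      case False
      obtain u' where "u' \<notin> range s'" using F_range[of s' s i undefined] by blast
      then have "u' \<noteq> s' j" for j by blast
      then show ?thesis using False by (intro exI[of _ u']) auto
    qed
    then obtain u' where u': "\<And>j. j \<noteq> i \<Longrightarrow> u = s j \<longleftrightarrow> u' = s' j" by metis
    then have "\<And>j. j \<noteq> i \<Longrightarrow> s j = u \<longleftrightarrow> s' j = u'" by metis
    then have "(s(i := u)) k = (s(i := u)) j \<longleftrightarrow> (s'(i := u')) k = (s'(i := u')) j" for k j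
      using ker u' by (cases "k = i"; cases "j = i") simp_all
    then have "s'(i := u') \<in> tv t" using Cyl.IH[of "s(i := u)" "s'(i := u')"] u by blast
    then show ?thesis by auto
  qed
  show ?case using *[of s s'] *[of s' s] Cyl.prems by blast
next
  case (Plus t1 t2)
  show ?case using Plus.IH[OF Plus.prems] by simp
next
  case (Neg t)
  show ?case using Neg.IH[OF Neg.prems] by simp
next
  case (Diag i j)
  show ?case using Diag[of i j] by simp
qed

lemma Inj_atom: "Inj \<subseteq> tv t \<or> Inj \<inter> tv t = {}"
proof -
  have "s \<in> tv t \<longleftrightarrow> s' \<in> tv t" if "s \<in> Inj" "s' \<in> Inj" for s s'
    by (rule tv_kernel) (use that in \<open>auto simp: Inj_def inj_eq\<close>)
  then show ?thesis by blast
qed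

lemma tv_in_S: "tv t \<in> S"
proof -
  have "tv t = (tv t - Inj) \<union> X (if Inj \<subseteq> tv t then UNIV else {})"
    using Inj_atom[of t] by (auto simp: X_def Inj_def)
  then show ?thesis unfolding S_def by blast
qed

text \<open>An entry that completes s to an injective sequence can be traded for one outside the
  range of s at which F takes a prescribed value. Cylindrification thus cannot tell nonempty unions
  of pieces apart.\<close>

lemma cyl_X: "T \<noteq> {} \<Longrightarrow> {s. \<exists>u. s(i := u) \<in> X T} = {s. \<exists>u. s(i := u) \<in> Inj}"
proof (intro set_eqI iffI)
  fix s assume "T \<noteq> {}" "s \<in> {s. \<exists>u. s(i := u) \<in> Inj}"
  then obtain v u where u: "v \<in> T" "inj (s(i := u))" by (auto simp: Inj_def)
  obtain u' where u': "u' \<notin> range s" "F (s(i := u')) = v" using F_range[of s s i v] by blast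
  have off: "s j = s k \<Longrightarrow> j = k" if "j \<noteq> i" "k \<noteq> i" for j k
    using injD[OF u(2), of j k] that by auto
  have ne: "u' \<noteq> s j" "s j \<noteq> u'" for j using u'(1) by auto
  have "inj (s(i := u'))"
  proof (intro injI)
    fix j k assume jk: "(s(i := u')) j = (s(i := u')) k"
    show "j = k"
    proof (cases "j = i \<or> k = i")
      case True
      then show ?thesis using jk ne by (cases "j = i"; cases "k = i") simp_all
    next
      case False
      then show ?thesis using jk off by simp
    qed
  qed
  then show "s \<in> {s. \<exists>u. s(i := u) \<in> X T}" using u u' by (auto simp: X_def)
qed (auto simp: X_def Inj_def)

lemma closed_S: "closed_ops (set_alg S)"
  unfolding closed_ops_def set_alg_sel
proof (intro conjI ballI allI)
  show "S \<noteq> {}" using tv_in_S by blast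
next
  fix x y assume "x \<in> S" "y \<in> S"
  then obtain t T t' T' where xy: "x = (tv t - Inj) \<union> X T" "y = (tv t' - Inj) \<union> X T'"
    by (auto simp: S_def)
  have "x \<union> y = (tv (Plus t t') - Inj) \<union> X (T \<union> T')" unfolding xy by (auto simp: X_def)
  then show "x \<union> y \<in> S" unfolding S_def by blast
next
  fix x assume "x \<in> S"
  then obtain t T where x: "x = (tv t - Inj) \<union> X T" by (auto simp: S_def)
  have "- x = (tv (Neg t) - Inj) \<union> X (- T)" unfolding x by (auto simp: X_def Inj_def)
  then show "- x \<in> S" unfolding S_def by blast
next
  fix i x assume "x \<in> S"
  then obtain t T where x: "x = (tv t - Inj) \<union> X T" by (auto simp: S_def)
  \<comment> \<open>\<open>Var 0\<close> denotes \<open>Inj\<close>, so this term cuts it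
    off.\<close>
  let ?m = "Neg (Plus (Neg t) (Var 0))"
  have m: "tv ?m = tv t - Inj" by auto
  have "{s. \<exists>u. s(i := u) \<in> x} = {s. \<exists>u. s(i := u) \<in> tv t - Inj} \<union> {s. \<exists>u. s(i := u) \<in> X T}"
    unfolding x by blast
  also have "\<dots> = tv (if T = {} then Cyl i ?m else Plus (Cyl i ?m) (Cyl i (Var 0)))"
    unfolding m[symmetric] using cyl_X[of T i] by (auto simp: X_def)
  finally show "{s. \<exists>u. s(i := u) \<in> x} \<in> S" using tv_in_S by simp
next
  fix i j
  show "{s. s i = s j} \<in> S" using tv_in_S[of "Diag i j"] by simp
qed

text \<open>A closed element contains either nothing of \<open>Inj\<close> or all of it, so in both
  cases the pieces disappear and a term describes it.\<close>

lemma cyl_closed_in_S: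
  assumes y: "y \<in> S" "{s. \<exists>u. s(i := u) \<in> y} = y"
  shows "\<exists>t. y = tv t"
proof -
  obtain t T where t: "y = (tv t - Inj) \<union> X T" using y(1) by (auto simp: S_def)
  show ?thesis
  proof (cases "T = {}")
    case True
    then have "y = tv (Neg (Plus (Neg t) (Var 0)))" unfolding t by (auto simp: X_def)
    then show ?thesis by blast
  next
    case False
    have "s \<in> y" if s: "s \<in> Inj" for s
    proof -
      have "s(i := s i) \<in> Inj" using s by simp
      then have "\<exists>u. s(i := u) \<in> X T" using cyl_X[OF False, of i] by blast
      then show ?thesis using y(2) t by blast
    qed
    then have "y = tv (Plus t (Var 0))" unfolding t by (auto simp: X_def Inj_def)
    then show ?thesis by blast
  qed
qed

end

lemma Ind_not_Edc:
  assumes inf: "infinite (UNIV :: 'i set)"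
  shows "\<exists>A :: ('i, ('i \<Rightarrow> 'i set) set) cyl_alg. A \<in> Ind \<and> A \<notin> Edc"
proof -
  obtain srt :: "'i set \<Rightarrow> 'i" and F :: "('i \<Rightarrow> 'i set) \<Rightarrow> 'i"
    where F: "\<And>k \<sigma> P q B. finite P \<Longrightarrow> (\<And>t. t \<in> P \<Longrightarrow> t k = {}) \<Longrightarrow>
    (card_of B, card_of (UNIV :: 'i set)) \<in> ordLeq \<Longrightarrow>
    \<exists>u. u \<notin> B \<and> srt u = \<sigma> \<and> (\<forall>t\<in>P. F (t(k := u)) = q t)"
    using generic_function[OF inf] by metis
  interpret splitting F
  proof unfold_locales
    fix B :: "'i set set" and t k v assume "(card_of B, card_of (UNIV :: 'i set)) \<in> ordLeq"
    from F[of "{t(k := {})}" k B undefined "\<lambda>_. v", OF _ _ this]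
    show "\<exists>u. u \<notin> B \<and> F (t(k := u)) = v" by auto
  qed (rule inf)
  let ?U = "set_alg (UNIV :: ('i \<Rightarrow> 'i set) set set)"
  \<comment> \<open>A locally finite algebra with the equations of the full set algebra, all of
    whose elements are named by terms.\<close>
  obtain B and f :: "'i ca_term \<Rightarrow> 'i ca_term set"
    where B: "B \<in> (Lf :: ('i, 'i ca_term set) cyl_alg set)" "Eq ?U = Eq B" "carr B = range f"
    using Ind_has_Lf[OF inf set_alg_UNIV_Ind] by metis
  obtain c :: "'i ca_term \<Rightarrow> 'i" where c: "inj c" using ca_term_embeds[OF inf] by blast
  define \<gamma> where "\<gamma> Y = {\<lambda>_ :: 'i. c ` Y}" for Y
  have "inj \<gamma>" using c by (auto simp: inj_def \<gamma>_def fun_eq_iff inj_image_eq_iff)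
  have cB: "closed_ops B" "B \<in> Ind" using B(1) Lf_subset_Ind[OF inf] by (auto simp: Lf_def CA_def)
  obtain B' where B': "closed_ops B'" "cyl_iso B B' \<gamma>"
    using isomorphic_copy[OF cB(1) inj_on_subset[OF \<open>inj \<gamma>\<close> subset_UNIV]] by blast
  have cB': "carr B' = \<gamma> ` range f" using B'(2) B(3) by (auto simp: cyl_iso_def bij_betw_def)
  have vB: "valid ?U e \<longleftrightarrow> valid B' e" for e
  proof -
    have "e \<in> Eq ?U \<longleftrightarrow> e \<in> Eq B" using B(2) by simp
    then show ?thesis using cyl_iso_valid[OF cB(1) B'(2)] by (simp add: Eq_def)
  qed
  have UCA: "?U \<in> CA" using set_alg_UNIV_Ind by (auto simp: Ind_def)
  have B'CA: "B' \<in> CA" using vB by (intro CA_if_Eq[OF UCA inf B'(1)]) simp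
  \<comment> \<open>\<open>set_alg S\<close> inherits the equations of the full set algebra but
    could satisfy more; the factor B' refutes whatever the full algebra refutes.\<close>
  define As where "As b = (if b then set_alg S else B')" for b
  have As: "As True = set_alg S" "As False = B'" by (simp_all add: As_def)
  let ?A = "prod_alg As"
  have cAs: "closed_ops (As b)" for b using closed_S B'(1) by (simp add: As_def)
  have vA: "valid ?A e \<longleftrightarrow> valid ?U e" for e
    unfolding valid_prod_alg[OF cAs] all_bool_eq As using vB[of e] valid_subalgebra[of S UNIV e] by blast
  have ACA: "?A \<in> CA" using vA by (intro CA_if_Eq[OF UCA inf closed_prod_alg[OF cAs]]) simp
  have "?A \<in> Ind"
    by (rule Ind_if_Eq[OF ACA cB(2)]) (use vA B(2) in \<open>auto simp: Eq_def set_eq_iff\<close>)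
  interpret A: cylindric ?A using ACA inf by unfold_locales
  interpret B': cylindric B' using B'CA inf by unfold_locales
  have "?A \<notin> Edc"
  proof
    assume Edc: "?A \<in> Edc"
    define x where "x T = (\<lambda>b. if b then X T else bzero B')" for T
    have XS: "X T \<in> S" for T
    proof -
      have "X T = (tv (Neg (Plus (Var 0) (Neg (Var 0)))) - Inj) \<union> X T" by auto
      then show ?thesis unfolding S_def by blast
    qed
    have xA: "x T \<in> carr ?A" for T using XS by (simp add: x_def As_def)
    have "bzero (As b) = bzero ?A b" for b
      using reduct_hom_zero[OF proj_hom[of As b] A.closed A.bool cAs] 
      by (cases b) (use set_alg_CA[OF closed_S] B'CA in \<open>auto simp: CA_def As_def\<close>)
    then have zA: "bzero ?A True = {}"
      using set_alg_CA[OF closed_S] bone_set_alg[OF closed_S] As(1) by (metis bzero_def set_alg_sel(3) Compl_UNIV_eq)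
    have "(\<lambda>i. {i}) \<in> X UNIV" by (auto simp: X_def inj_def)
    then have "x UNIV \<noteq> bzero ?A" using zA by (auto simp: x_def dest: fun_cong[of _ _ True])
    obtain i0 :: 'i where True by blast
    obtain \<kappa> h where h: "\<kappa> \<notin> {i0}" "reduct_hom {i0} ?A ?A h" "h (x UNIV) \<noteq> bzero ?A"
      "\<And>a. a \<in> carr ?A \<Longrightarrow> cyl ?A \<kappa> (h a) = h a"
    proof -
      have "\<exists>\<kappa> h. \<kappa> \<notin> {i0} \<and> reduct_hom {i0} ?A ?A h \<and> h (x UNIV) \<noteq> bzero ?A \<and> (\<forall>a\<in>carr ?A. cyl ?A \<kappa> (h a) = h a)"
        using Edc xA \<open>x UNIV \<noteq> bzero ?A\<close> unfolding Edc_def by blast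
      then show ?thesis using that by blast
    qed
    have hA: "h a \<in> carr ?A" if "a \<in> carr ?A" for a using h(2) that by (simp add: reduct_hom_def del: prod_alg_sel)
    have hp: "h (bplus ?A a b) = bplus ?A (h a) (h b)" "h (bneg ?A a) = bneg ?A (h a)" "h (cyl ?A i0 a) = cyl ?A i0 (h a)"
      if "a \<in> carr ?A" "b \<in> carr ?A" for a b using h(2) that by (simp_all add: reduct_hom_def del: prod_alg_sel)
    have hm: "h (bmult ?A a b) = bmult ?A (h a) (h b)" if "a \<in> carr ?A" "b \<in> carr ?A" for a b
      using that hp A.ng_in A.pl_in by (simp add: bmult_def del: prod_alg_sel)
    \<comment> \<open>If h identified two unions it would kill that of the symmetric difference
      \<open>?D\<close>. This has the same c_i0 as the union of all pieces, and h respects c_i0, so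
      h would kill x UNIV as well.\<close>
    have inj: "T = T'" if eq: "h (x T) = h (x T')" for T T'
    proof (rule ccontr)
      assume "T \<noteq> T'"
      let ?D = "(T - T') \<union> (T' - T)"
      let ?y = "bplus ?A (bmult ?A (x T) (bneg ?A (x T'))) (bmult ?A (x T') (bneg ?A (x T)))"
      have "?D \<noteq> {}" using \<open>T \<noteq> T'\<close> by blast
      have y: "?y = x ?D"
      proof
        fix b
        show "?y b = x ?D b"
        proof (cases b)
          case True
          have "X T \<inter> - X T' \<union> X T' \<inter> - X T = X ?D" by (auto simp: X_def)
          then show ?thesis using True by (simp add: x_def As_def bmult_def)
        next
          case False
          have "bplus B' (bmult B' (bzero B') (bneg B' (bzero B'))) (bmult B' (bzero B') (bneg B' (bzero B'))) = bzero B'"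
            by (simp add: B'.zero_eq B'.pl_zero)
          then show ?thesis using False by (simp add: x_def As_def bmult_def)
        qed
      qed
      have "h ?y = bzero ?A"
        using xA[of T] xA[of T'] hA[OF xA[of T]] eq
        by (simp add: hp hm A.zero_eq A.pl_zero del: prod_alg_sel)
      then have "cyl ?A i0 (h (x ?D)) = bzero ?A" unfolding y using A.cyl_zero by simp
      moreover have "cyl ?A i0 (x ?D) = cyl ?A i0 (x UNIV)"
        using cyl_X[OF \<open>?D \<noteq> {}\<close>, of i0] cyl_X[of UNIV i0] by (auto simp: x_def As_def fun_eq_iff)
      ultimately have "cyl ?A i0 (h (x UNIV)) = bzero ?A" using hp(3)[OF xA xA] by metis
      then show False using h(3) A.cyl_eq_zero[OF hA[OF xA]] by blast
    qed
    have "\<exists>t t'. h (x T) = (\<lambda>b. if b then tv t else \<gamma> (f t'))" for T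
    proof -
      have hx: "h (x T) \<in> carr ?A" using hA xA by blast
      have "cyl ?A \<kappa> (h (x T)) True = h (x T) True" using h(4)[OF xA] by simp
      moreover have "h (x T) True \<in> S" using hx As by auto (metis set_alg_sel(1))
      ultimately obtain t where "h (x T) True = tv t"
        using cyl_closed_in_S[of "h (x T) True" \<kappa>] by (auto simp: As)
      moreover have "h (x T) False \<in> \<gamma> ` range f" using hx As cB' by auto
      then obtain t' where "h (x T) False = \<gamma> (f t')" by blast
      ultimately have "h (x T) b = (if b then tv t else \<gamma> (f t'))" for b by (cases b) auto
      then show ?thesis by blast
    qed
    then obtain t t' where t: "\<And>T. h (x T) = (\<lambda>b. if b then tv (t T) else \<gamma> (f (t' T)))" by metis
    \<comment> \<open>\<open>Plus\<close> merely pairs the two terms naming the components; the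
      result would inject the power set of \<open>'i\<close> into \<open>'i\<close>.\<close>
    have "inj (\<lambda>T. c (Plus (t T) (t' T)))"
    proof (rule injI)
      fix T T' assume "c (Plus (t T) (t' T)) = c (Plus (t T') (t' T'))"
      then have "t T = t T'" "t' T = t' T'" using injD[OF c] by blast+
      then have "h (x T) = h (x T')" by (simp only: t)
      then show "T = T'" by (rule inj)
    qed
    then have "surj (inv (\<lambda>T. c (Plus (t T) (t' T))))" by (rule inj_imp_surj_inv)
    then show False using Cantors_theorem[of "UNIV :: 'i set"] by (metis Pow_UNIV)
  qed
  obtain g :: "(bool \<Rightarrow> ('i \<Rightarrow> 'i set) set) \<Rightarrow> ('i \<Rightarrow> 'i set) set" where g: "inj g"
    by (rule function_embeds[OF inf, of "\<lambda>b _. if b then UNIV else {}"]) (auto simp: inj_def fun_eq_iff)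
  obtain A' where A': "closed_ops A'" "cyl_iso ?A A' g"
    using isomorphic_copy[OF A.closed inj_on_subset[OF g subset_UNIV]] by blast
  have vA': "valid A' e \<longleftrightarrow> valid ?A e" for e using cyl_iso_valid[OF A.closed A'(2)] by blast
  have "A' \<in> CA" using vA' by (intro CA_if_Eq[OF ACA inf A'(1)]) simp
  then have "A' \<in> Ind" using \<open>?A \<in> Ind\<close> by (rule Ind_if_Eq) (auto simp: Eq_def vA')
  moreover have "A' \<notin> Edc" using Edc_iso[OF ACA A'(2)] \<open>?A \<notin> Edc\<close> by blast
  ultimately show ?thesis by blast
qed

section \<open>A symmetric representable algebra that is not inductive\<close>

definition tmeet :: "'i ca_term \<Rightarrow> 'i ca_term \<Rightarrow> 'i ca_term" where
  "tmeet s t = Neg (Plus (Neg s) (Neg t))"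

definition tsubst :: "'i \<Rightarrow> 'i \<Rightarrow> 'i ca_term \<Rightarrow> 'i ca_term" where
  "tsubst i j t = Cyl i (tmeet (Diag i j) t)"

text \<open>\<open>order_term a b c\<close> holds at \<open>s\<close> if the relation that \<open>c\<^sub>c x\<^sub>0\<close> induces on the coordinates \<open>a, b\<close>
  of \<open>s\<close> is nonempty, irreflexive, transitive and serial on its range.\<close>

definition order_term :: "'i \<Rightarrow> 'i \<Rightarrow> 'i \<Rightarrow> 'i ca_term" where
  "order_term a b c = (let x = Cyl c (Var 0) in
     tmeet (tmeet (Cyl a (Cyl b x)) (Neg (Cyl a (Cyl b (tmeet x (Diag a b))))))
       (tmeet (Neg (Cyl a (Cyl b (Cyl c (tmeet (tmeet (tsubst b c x) (tsubst a c x)) (Neg x))))))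
         (Neg (Cyl a (Cyl b (tmeet x (Neg (tsubst a b (Cyl b x)))))))))"

definition zero_term :: "'i ca_term" where
  "zero_term = Neg (Plus (Var 0) (Neg (Var 0)))"

definition order_eq :: "'i \<Rightarrow> 'i \<Rightarrow> 'i \<Rightarrow> 'i equation" where
  "order_eq a b c = (order_term a b c, zero_term)"

lemma order_eq_rename: "eq_rename \<rho> (order_eq a b c) = order_eq (\<rho> a) (\<rho> b) (\<rho> c)"
  by (simp add: eq_rename_def order_eq_def order_term_def zero_term_def tmeet_def tsubst_def Let_def)

lemma order_eq_inds: "eq_inds (order_eq a b c) \<subseteq> {a, b, c}"
  by (auto simp: eq_inds_def order_eq_def order_term_def zero_term_def tmeet_def tsubst_def Let_def)

lemma rename_cyl_vars: "eq_rename \<rho> (eq_cyl_vars i e) = eq_cyl_vars (\<rho> i) (eq_rename \<rho> e)"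
proof -
  have "rename \<rho> (cyl_vars i t) = cyl_vars (\<rho> i) (rename \<rho> t)" for t by (induction t) auto
  then show ?thesis by (simp add: eq_rename_def eq_cyl_vars_def)
qed

lemma tval_tmeet [simp]: "tval (set_alg S) v (tmeet s t) = tval (set_alg S) v s \<inter> tval (set_alg S) v t"
  by (simp add: tmeet_def)

lemma tval_tsubst: "i \<noteq> j \<Longrightarrow> s \<in> tval (set_alg S) v (tsubst i j t) \<longleftrightarrow> s(i := s j) \<in> tval (set_alg S) v t"
  by (auto simp: tsubst_def)

lemma tval_zero_term [simp]: "tval (set_alg S) v zero_term = {}"
  by (simp add: zero_term_def)

lemma order_term_iff:
  fixes S :: "('i \<Rightarrow> 'u) set set" and s :: "'i \<Rightarrow> 'u" and v
  assumes abc: "a \<noteq> b" "a \<noteq> c" "b \<noteq> c"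
  defines "Z \<equiv> {s. \<exists>u. s(c := u) \<in> v 0}"
  defines "R \<equiv> \<lambda>u w. s(a := u, b := w) \<in> Z"
  shows "s \<in> tval (set_alg S) v (order_term a b c) \<longleftrightarrow>
    (\<exists>u w. R u w) \<and> (\<forall>u. \<not> R u u) \<and> (\<forall>u w z. R u w \<longrightarrow> R w z \<longrightarrow> R u z) \<and> (\<forall>u w. R u w \<longrightarrow> (\<exists>z. R w z))"
proof -
  let ?x = "Cyl c (Var 0) :: 'i ca_term"
  let ?tv = "tval (set_alg S) v"
  have x: "?tv ?x = Z" by (simp add: Z_def)
  have Zc: "r(c := u) \<in> Z \<longleftrightarrow> r \<in> Z" for r u by (simp add: Z_def)
  have 1: "s \<in> ?tv (Cyl a (Cyl b ?x)) \<longleftrightarrow> (\<exists>u w. R u w)" by (simp add: R_def Z_def)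
  have 2: "s \<in> ?tv (Cyl a (Cyl b (tmeet ?x (Diag a b)))) \<longleftrightarrow> (\<exists>u. R u u)"
    unfolding tval.simps(4)[of _ _ a] tval.simps(4)[of _ _ b] tval_tmeet x R_def using abc by auto
  have sb: "s(a := u, b := w, c := z) \<in> ?tv (tsubst b c ?x) \<longleftrightarrow> R u z" for u w z
  proof -
    have "(s(a := u, b := w, c := z))(b := z) = (s(a := u, b := z))(c := z)" using abc by (auto simp: fun_eq_iff)
    then show ?thesis unfolding tval_tsubst[OF abc(3)] x R_def using Zc by simp
  qed
  have sa: "s(a := u, b := w, c := z) \<in> ?tv (tsubst a c ?x) \<longleftrightarrow> R z w" for u w z
  proof -
    have "(s(a := u, b := w, c := z))(a := z) = (s(a := z, b := w))(c := z)" using abc by (auto simp: fun_eq_iff)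
    then show ?thesis unfolding tval_tsubst[OF abc(2)] x R_def using Zc by simp
  qed
  have 3: "s \<in> ?tv (Cyl a (Cyl b (Cyl c (tmeet (tmeet (tsubst b c ?x) (tsubst a c ?x)) (Neg ?x))))) \<longleftrightarrow>
    (\<exists>u w z. R u z \<and> R z w \<and> \<not> R u w)"
  proof -
    have "s(a := u, b := w, c := z) \<in> ?tv (tmeet (tmeet (tsubst b c ?x) (tsubst a c ?x)) (Neg ?x))
      \<longleftrightarrow> R u z \<and> R z w \<and> \<not> R u w" for u w z
      unfolding tval_tmeet tval.simps(3) x Int_iff sb sa using Zc by (simp add: R_def)
    then show ?thesis unfolding tval.simps(4)[of _ _ a] tval.simps(4)[of _ _ b] tval.simps(4)[of _ _ c "tmeet _ _"]
      by (simp del: tval_tmeet)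
  qed
  have 4: "s \<in> ?tv (Cyl a (Cyl b (tmeet ?x (Neg (tsubst a b (Cyl b ?x)))))) \<longleftrightarrow> (\<exists>u w. R u w \<and> \<not> (\<exists>z. R w z))"
  proof -
    have "s(a := u, b := w) \<in> ?tv (tsubst a b (Cyl b ?x)) \<longleftrightarrow> (\<exists>z. R w z)" for u w
    proof -
      have "(s(a := u, b := w))(a := w, b := z) = s(a := w, b := z)" for z using abc by (auto simp: fun_eq_iff)
      then show ?thesis unfolding tval_tsubst[OF abc(1)] tval.simps(4)[of _ _ b] x R_def by simp
    qed
    then have "s(a := u, b := w) \<in> ?tv (tmeet ?x (Neg (tsubst a b (Cyl b ?x)))) \<longleftrightarrow> R u w \<and> \<not> (\<exists>z. R w z)" for u w
      unfolding tval_tmeet tval.simps(3) x by (simp add: R_def)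
    then show ?thesis unfolding tval.simps(4)[of _ _ a] tval.simps(4)[of _ _ b "tmeet _ _"]
      by (simp del: tval_tmeet)
  qed
  show ?thesis
    unfolding order_term_def Let_def tval_tmeet tval.simps(3) Int_iff set_alg_sel Compl_iff 1 2 3 4 by blast
qed

section \<open>Orders that depend on the tail of a sequence\<close>

text \<open>Seriality gives an infinite ascending chain, and two of its members share a colour.
  Between these the relation is symmetric, contrary to transitivity and irreflexivity.\<close>

lemma no_almost_symmetric_order:
  fixes R :: "'u \<Rightarrow> 'u \<Rightarrow> bool" and col :: "'u \<Rightarrow> 'x"
  assumes ne: "R u0 w0" and irr: "\<And>u. \<not> R u u" and tr: "\<And>u w z. R u w \<Longrightarrow> R w z \<Longrightarrow> R u z"
    and ser: "\<And>u w. R u w \<Longrightarrow> \<exists>z. R w z"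
    and fin: "finite (range col)" and col: "\<And>u w. col u = col w \<Longrightarrow> u \<noteq> w \<Longrightarrow> R u w \<Longrightarrow> R w u"
  shows False
proof -
  have "\<exists>r. \<forall>n. (\<exists>u. R u (r n)) \<and> R (r n) (r (Suc n))"
    by (rule dependent_nat_choice[of "\<lambda>_ x. \<exists>u. R u x" "\<lambda>_. R"]) (use ne ser in blast)+
  then obtain r where r: "\<And>n. R (r n) (r (Suc n))" by metis
  have lt: "m < n \<Longrightarrow> R (r m) (r n)" for m n
  proof (induction n)
    case (Suc n)
    then show ?case using r[of n] tr by (cases "m = n") auto
  qed simp
  have "\<not> inj (col \<circ> r)"
  proof
    assume "inj (col \<circ> r)"
    then have "infinite (range (col \<circ> r))" using finite_imageD infinite_UNIV_nat by blast
    moreover have "range (col \<circ> r) \<subseteq> range col" by auto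
    ultimately show False using fin finite_subset by blast
  qed
  then obtain m n where mn: "m \<noteq> n" "col (r m) = col (r n)" by (auto simp: inj_def)
  have False if "m < n" "col (r m) = col (r n)" for m n
  proof -
    have "R (r m) (r n)" using lt that by blast
    moreover have "r m \<noteq> r n" using calculation irr by metis
    ultimately show False using col[OF that(2)] tr irr by blast
  qed
  then show False using mn by (metis linorder_neqE_nat)
qed

text \<open>Entries of sort \<open>i\<^sub>0\<close> form the ordered set; an entry of sort \<open>j \<noteq> i\<^sub>0, i\<^sub>1, i\<^sub>2\<close> contributes to
  the choice of the order if it occurs in a sequence that has entries of all these sorts.\<close>

locale ordered_tails =
  fixes srt :: "'i set \<Rightarrow> 'i" and F :: "('i \<Rightarrow> 'i set) \<Rightarrow> 'i" and i0 i1 i2 :: 'i and \<phi> :: "'i \<Rightarrow> nat"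
  assumes inf: "infinite (UNIV :: 'i set)" and dist: "i0 \<noteq> i1" "i0 \<noteq> i2" "i1 \<noteq> i2" and \<phi>: "surj \<phi>"
    and F: "finite P \<Longrightarrow> (\<And>t. t \<in> P \<Longrightarrow> t k = {}) \<Longrightarrow> (card_of B, card_of (UNIV :: 'i set)) \<in> ordLeq \<Longrightarrow>
      \<exists>u. u \<notin> B \<and> srt u = \<sigma> \<and> (\<forall>t\<in>P. F (t(k := u)) = q t)"
begin

text \<open>The gap of two is the point: with one coordinate barred, the remaining ones can
  represent all these sorts and still repeat one; with two barred, no repetition is
  possible.\<close>

definition J :: "'i set \<Rightarrow> 'i set" where "J \<Delta> = \<Delta> - {i1, i2}"

definition gd :: "'i set \<Rightarrow> ('i \<Rightarrow> 'i set) \<Rightarrow> bool" where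
  "gd \<Delta> s \<longleftrightarrow> (\<forall>k. k \<notin> \<Delta> \<longrightarrow> srt (s k) = k)"

text \<open>All sorts outside \<open>J \<Delta>\<close> are merged into \<open>i1\<close>, which is
  never in \<open>J \<Delta>\<close>; for finite \<open>\<Delta>\<close> only finitely many sorts
  remain.\<close>

definition srD :: "'i set \<Rightarrow> 'i set \<Rightarrow> 'i" where
  "srD \<Delta> x = (if srt x \<in> J \<Delta> then srt x else i1)"

text \<open>e is a transversal: for every sort it selects a coordinate in \<open>\<Delta>\<close>
  with an entry of that sort.\<close>

definition tr :: "'i set \<Rightarrow> ('i \<Rightarrow> 'i set) \<Rightarrow> ('i \<Rightarrow> 'i) \<Rightarrow> bool" where
  "tr \<Delta> s e \<longleftrightarrow> (\<forall>j\<in>J \<Delta>. e j \<in> \<Delta> \<and> srt (s (e j)) = j)"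

text \<open>The rearranged sequence: the selected entry of sort j moves to place j, the places i1
  and i2 are blanked, the tail stays.\<close>

definition ag :: "'i set \<Rightarrow> ('i \<Rightarrow> 'i set) \<Rightarrow> ('i \<Rightarrow> 'i) \<Rightarrow> 'i \<Rightarrow> 'i set" where
  "ag \<Delta> s e = (\<lambda>k. if k \<notin> \<Delta> then s k else if k = i1 \<or> k = i2 then {} else s (e k))"

text \<open>Indiscernibility of sequences: the tails themselves may differ, and only their sorts and
  the values of F on rearrangements are compared.\<close>

definition E :: "'i set \<Rightarrow> ('i \<Rightarrow> 'i set) \<Rightarrow> ('i \<Rightarrow> 'i set) \<Rightarrow> bool" where
  "E \<Delta> s s' \<longleftrightarrow> (\<forall>l\<in>\<Delta>. \<forall>m\<in>\<Delta>. s l = s m \<longleftrightarrow> s' l = s' m) \<and> (gd \<Delta> s \<longleftrightarrow> gd \<Delta> s') \<and>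
    (gd \<Delta> s \<longrightarrow> (\<forall>l\<in>\<Delta>. srD \<Delta> (s l) = srD \<Delta> (s' l)) \<and>
      (\<forall>e. tr \<Delta> s e \<longrightarrow> \<phi> (F (ag \<Delta> s e)) = \<phi> (F (ag \<Delta> s' e))))"

definition ok :: "'i set \<Rightarrow> bool" where "ok \<Delta> \<longleftrightarrow> finite \<Delta> \<and> {i0, i1, i2} \<subseteq> \<Delta>"

definition inv_under :: "'i set \<Rightarrow> ('i \<Rightarrow> 'i set) set \<Rightarrow> bool" where
  "inv_under \<Delta> Y \<longleftrightarrow> (\<forall>s s'. E \<Delta> s s' \<longrightarrow> (s \<in> Y \<longleftrightarrow> s' \<in> Y))"

definition S0 :: "('i \<Rightarrow> 'i set) set set" where
  "S0 = {Y. \<exists>\<Delta>. ok \<Delta> \<and> inv_under \<Delta> Y}"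

lemma F_finite:
  assumes "finite P" "\<And>t. t \<in> P \<Longrightarrow> t k = {}" "finite B"
  shows "\<exists>u. u \<notin> B \<and> srt u = \<sigma> \<and> (\<forall>t\<in>P. F (t(k := u)) = q t)"
proof (rule F[OF assms(1,2)])
  show "(card_of B, card_of (UNIV :: 'i set)) \<in> ordLeq"
    using inf assms(3) by (intro ordLess_imp_ordLeq finite_ordLess_infinite card_of_Well_order) (simp_all add: Field_card_of)
qed

lemma srD_iff: "j \<in> J \<Delta> \<Longrightarrow> srt x = j \<longleftrightarrow> srD \<Delta> x = j"
  by (auto simp: srD_def J_def)

lemma tr_cong:
  assumes "\<And>l. l \<in> \<Delta> \<Longrightarrow> srD \<Delta> (s l) = srD \<Delta> (s' l)"
  shows "tr \<Delta> s e \<longleftrightarrow> tr \<Delta> s' e"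
  using assms srD_iff[of _ \<Delta>] unfolding tr_def by metis

lemma E_sym: "E \<Delta> s s' \<Longrightarrow> E \<Delta> s' s"
  unfolding E_def using tr_cong[of \<Delta> s s'] by metis

lemma E_reindex:
  assumes E: "E \<Delta> s s'" and \<iota>: "\<And>l. l \<in> \<Delta> \<Longrightarrow> \<iota> l \<in> \<Delta>" "\<And>k. k \<notin> \<Delta> \<Longrightarrow> \<iota> k = k"
  shows "E \<Delta> (s \<circ> \<iota>) (s' \<circ> \<iota>)"
proof -
  have g: "gd \<Delta> (s \<circ> \<iota>) \<longleftrightarrow> gd \<Delta> s" for s using \<iota>(2) by (auto simp: gd_def)
  have a: "ag \<Delta> (s \<circ> \<iota>) e = ag \<Delta> s (\<iota> \<circ> e)" for s e using \<iota>(2) by (auto simp: ag_def fun_eq_iff)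
  have t: "tr \<Delta> (s \<circ> \<iota>) e \<Longrightarrow> tr \<Delta> s (\<iota> \<circ> e)" for s e using \<iota>(1) by (auto simp: tr_def)
  show ?thesis using E t unfolding E_def g a by (auto simp: \<iota>(1))
qed

text \<open>The step of a back-and-forth argument, needed for closure under cylindrification. A
  repeated entry is copied; for a new one, genericity of F supplies u' with the required sort and
  values.\<close>

lemma E_extend:
  assumes ok: "ok \<Delta>" and E: "E \<Delta> s s'" and i: "i \<in> \<Delta>"
  shows "\<exists>u'. E \<Delta> (s(i := u)) (s'(i := u'))"
proof (cases "u \<in> s ` (\<Delta> - {i})")
  case True
  then obtain l where l: "l \<in> \<Delta>" "u = s l" by blast
  have "E \<Delta> (s \<circ> id(i := l)) (s' \<circ> id(i := l))"
    by (rule E_reindex[OF E]) (use l i in \<open>auto split: if_splits\<close>)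
  moreover have "r \<circ> id(i := l) = r(i := r l)" for r :: "'i \<Rightarrow> 'i set" by (auto simp: fun_eq_iff)
  ultimately show ?thesis using l by auto
next
  case False
  have fin: "finite \<Delta>" and I: "i0 \<in> \<Delta>" "i1 \<in> \<Delta>" "i2 \<in> \<Delta>" using ok by (auto simp: ok_def)
  have gdu: "gd \<Delta> (r(i := x)) \<longleftrightarrow> gd \<Delta> r" for r x using i by (auto simp: gd_def)
  have eqs: "s l = s m \<longleftrightarrow> s' l = s' m" if "l \<in> \<Delta>" "m \<in> \<Delta>" for l m using E that by (auto simp: E_def)
  have eqs': "(s(i := u)) l = (s(i := u)) m \<longleftrightarrow> (s'(i := u')) l = (s'(i := u')) m"
    if "u' \<notin> s' ` \<Delta>" "l \<in> \<Delta>" "m \<in> \<Delta>" for u' l m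
  proof -
    have "u' \<noteq> s' k" "s' k \<noteq> u'" if "k \<in> \<Delta>" for k using \<open>u' \<notin> s' ` \<Delta>\<close> that by auto
    moreover have "u \<noteq> s k" "s k \<noteq> u" if "k \<in> \<Delta>" "k \<noteq> i" for k using False that by auto
    ultimately show ?thesis using eqs[OF that(2,3)] that(2,3) by (cases "l = i"; cases "m = i") simp_all
  qed
  show ?thesis
  proof (cases "gd \<Delta> s")
    case ng: False
    obtain u' where "u' \<notin> s' ` \<Delta>" using F_finite[of "{}" i "s' ` \<Delta>" i] fin by auto
    then show ?thesis using ng E eqs' unfolding E_def gdu by blast
  next
    case gd: True
    have srDs: "srD \<Delta> (s l) = srD \<Delta> (s' l)" if "l \<in> \<Delta>" for l using E gd that by (auto simp: E_def)
    have vals: "\<phi> (F (ag \<Delta> s e)) = \<phi> (F (ag \<Delta> s' e))" if "tr \<Delta> s e" for e using E gd that by (auto simp: E_def)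
    define j where "j = srD \<Delta> u"
    have j: "j \<in> \<Delta>" "j \<in> J \<Delta> \<Longrightarrow> srt u = j" "srt u \<in> J \<Delta> \<Longrightarrow> j = srt u"
      using I by (auto simp: j_def srD_def J_def split: if_splits)
    define okE where "okE e \<longleftrightarrow> (\<forall>k\<in>J \<Delta> - {j}. e k \<in> \<Delta> - {i})" for e
    \<comment> \<open>The rearrangements of s' that will receive the new entry at place j, with that
      place blanked. They differ only in finitely many places with finitely many values, so F may be
      prescribed on all of them.\<close>
    define P where "P = (\<lambda>e. (ag \<Delta> s' e)(j := {})) ` Collect okE"
    define q where "q t = F ((ag \<Delta> s (SOME e. okE e \<and> (ag \<Delta> s' e)(j := {}) = t))(j := u))" for t
    have "finite P"
    proof (rule finite_subset)
      let ?B = "insert {} (s' ` \<Delta>)"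
      let ?Q = "{f. \<forall>x. (x \<in> \<Delta> \<longrightarrow> f x \<in> ?B) \<and> (x \<notin> \<Delta> \<longrightarrow> f x = {})}"
      have "finite ?Q" using fin by (intro finite_set_of_finite_funs) auto
      then show "finite ((\<lambda>f k. if k \<in> \<Delta> then f k else s' k) ` ?Q)" by (rule finite_imageI)
      show "P \<subseteq> (\<lambda>f k. if k \<in> \<Delta> then f k else s' k) ` ?Q"
      proof
        fix t assume "t \<in> P"
        then obtain e where e: "okE e" "t = (ag \<Delta> s' e)(j := {})" by (auto simp: P_def)
        have "t k \<in> ?B" if "k \<in> \<Delta>" for k
          using that e by (auto simp: ag_def okE_def J_def)
        moreover have "t k = s' k" if "k \<notin> \<Delta>" for k using that e j(1) by (auto simp: ag_def)
        ultimately show "t \<in> (\<lambda>f k. if k \<in> \<Delta> then f k else s' k) ` ?Q"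
          by (intro image_eqI[of _ _ "\<lambda>k. if k \<in> \<Delta> then t k else {}"]) (auto simp: fun_eq_iff)
      qed
    qed
    then have "\<exists>u'. u' \<notin> s' ` \<Delta> \<and> srt u' = j \<and> (\<forall>t\<in>P. F (t(j := u')) = q t)"
      by (rule F_finite) (auto simp: P_def fin)
    then obtain u' where u': "u' \<notin> s' ` \<Delta>" "srt u' = j" "\<And>t. t \<in> P \<Longrightarrow> F (t(j := u')) = q t"
      by blast
    \<comment> \<open>Selections with the same rearrangement of s' also agree for s, since both
      sequences have the same equalities on \<open>\<Delta>\<close>; so the choice hidden in q is
      harmless.\<close>
    have key: "F ((ag \<Delta> s' e)(j := u')) = F ((ag \<Delta> s e)(j := u))" if e: "okE e" for e
    proof -
      let ?t = "(ag \<Delta> s' e)(j := {})"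
      let ?g = "SOME e. okE e \<and> (ag \<Delta> s' e)(j := {}) = ?t"
      have g: "okE ?g" "(ag \<Delta> s' ?g)(j := {}) = ?t"
        using someI[of "\<lambda>e. okE e \<and> (ag \<Delta> s' e)(j := {}) = ?t" e] e by auto
      have "((ag \<Delta> s ?g)(j := u)) k = ((ag \<Delta> s e)(j := u)) k" for k
      proof (cases "k \<in> J \<Delta> - {j}")
        case True
        then have "s' (?g k) = s' (e k)" using fun_cong[OF g(2), of k] by (auto simp: ag_def J_def)
        then have "s (?g k) = s (e k)" using eqs g(1) e True by (auto simp: okE_def)
        then show ?thesis using True by (auto simp: ag_def J_def)
      next
        case False
        then show ?thesis by (auto simp: ag_def J_def)
      qed
      then have "(ag \<Delta> s ?g)(j := u) = (ag \<Delta> s e)(j := u)" by blast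
      then show ?thesis using u'(3)[of ?t] e by (simp add: P_def q_def)
    qed
    have srDu: "srD \<Delta> u' = srD \<Delta> u" using u'(2) by (auto simp: srD_def j_def J_def)
    have "\<phi> (F (ag \<Delta> (s(i := u)) e)) = \<phi> (F (ag \<Delta> (s'(i := u')) e))" if e: "tr \<Delta> (s(i := u)) e" for e
    proof (cases "j \<in> J \<Delta> \<and> e j = i")
      case True
      have ne: "e k \<noteq> i" if "k \<in> J \<Delta> - {j}" for k using e that j(2) True by (auto simp: tr_def)
      then have "okE e" using e by (auto simp: okE_def tr_def)
      moreover have "ag \<Delta> (r(i := x)) e = (ag \<Delta> r e)(j := x)" for r x
        using True ne i by (auto simp: ag_def J_def fun_eq_iff)
      ultimately show ?thesis using key by simp
    next
      case False
      have ne: "e k \<noteq> i" if "k \<in> J \<Delta>" for k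
      proof
        assume "e k = i"
        then have "srt u = k" using e that by (auto simp: tr_def)
        then show False using False j(3) that \<open>e k = i\<close> by auto
      qed
      have "ag \<Delta> (r(i := x)) e = ag \<Delta> r e" for r x
        using ne i by (auto simp: ag_def J_def fun_eq_iff)
      moreover have "tr \<Delta> s e" using e ne by (simp add: tr_def)
      ultimately show ?thesis using vals by simp
    qed
    moreover have "srD \<Delta> ((s(i := u)) l) = srD \<Delta> ((s'(i := u')) l)" if "l \<in> \<Delta>" for l
      using srDs srDu that by simp
    ultimately have "E \<Delta> (s(i := u)) (s'(i := u'))"
      using eqs'[OF u'(1)] E unfolding E_def gdu by blast
    then show ?thesis by blast
  qed
qed

text \<open>Lets sets with different supports be compared over a common one. A transversal for the
  smaller set extends to the larger one without changing the rearranged sequence.\<close>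

lemma E_mono:
  assumes \<Delta>: "ok \<Delta>" "\<Delta> \<subseteq> \<Delta>'" and E: "E \<Delta>' s s'"
  shows "E \<Delta> s s'"
proof -
  have I: "i0 \<in> \<Delta>" "i1 \<in> \<Delta>" "i2 \<in> \<Delta>" using \<Delta>(1) by (auto simp: ok_def)
  have J: "J \<Delta> \<subseteq> J \<Delta>'" "k \<in> \<Delta>' - \<Delta> \<Longrightarrow> k \<in> J \<Delta>'" for k using \<Delta>(2) I by (auto simp: J_def)
  have gD: "gd \<Delta> s \<longleftrightarrow> gd \<Delta>' s \<and> (\<forall>k\<in>\<Delta>' - \<Delta>. srt (s k) = k)" for s
    using \<Delta>(2) by (auto simp: gd_def)
  have sr: "srD \<Delta> (s l) = srD \<Delta> (s' l)" if "srD \<Delta>' (s l) = srD \<Delta>' (s' l)" for l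
    using that J(1) I by (auto simp: srD_def J_def split: if_splits)
  have g: "gd \<Delta> s \<longleftrightarrow> gd \<Delta> s'"
  proof (cases "gd \<Delta>' s")
    case True
    then have "srt (s k) = k \<longleftrightarrow> srt (s' k) = k" if "k \<in> \<Delta>' - \<Delta>" for k
      using that E J(2)[OF that] srD_iff[of k \<Delta>'] by (auto simp: E_def)
    then show ?thesis using E True unfolding gD by (auto simp: E_def)
  next
    case False
    then show ?thesis using E unfolding gD by (auto simp: E_def)
  qed
  have vals: "\<phi> (F (ag \<Delta> s e)) = \<phi> (F (ag \<Delta> s' e))" if gs: "gd \<Delta> s" and e: "tr \<Delta> s e" for e
  proof -
    \<comment> \<open>Coordinates outside \<open>\<Delta>\<close> carry their own sort and so
      represent themselves.\<close>
    let ?e = "\<lambda>k. if k \<in> \<Delta> then e k else k"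
    have "tr \<Delta>' s ?e" using e gs \<Delta>(2) by (auto simp: tr_def gd_def J_def)
    then have "\<phi> (F (ag \<Delta>' s ?e)) = \<phi> (F (ag \<Delta>' s' ?e))" using E gs unfolding gD by (auto simp: E_def)
    moreover have "ag \<Delta>' r ?e = ag \<Delta> r e" for r using \<Delta>(2) I by (auto simp: ag_def fun_eq_iff)
    ultimately show ?thesis by simp
  qed
  have "s l = s m \<longleftrightarrow> s' l = s' m" if "l \<in> \<Delta>" "m \<in> \<Delta>" for l m
    using E \<Delta>(2) that unfolding E_def by blast
  moreover have "srD \<Delta> (s l) = srD \<Delta> (s' l)" if "gd \<Delta> s" "l \<in> \<Delta>" for l
  proof (rule sr)
    have "gd \<Delta>' s" "l \<in> \<Delta>'" using that \<Delta>(2) by (auto simp: gd_def)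
    then show "srD \<Delta>' (s l) = srD \<Delta>' (s' l)" using E unfolding E_def by blast
  qed
  ultimately show ?thesis using g vals unfolding E_def by blast
qed

lemma inv_under_mono: "ok \<Delta> \<Longrightarrow> \<Delta> \<subseteq> \<Delta>' \<Longrightarrow> inv_under \<Delta> Y \<Longrightarrow> inv_under \<Delta>' Y"
  unfolding inv_under_def using E_mono by blast

lemma ok_Un: "ok \<Delta> \<Longrightarrow> finite \<Delta>' \<Longrightarrow> ok (\<Delta> \<union> \<Delta>')"
  by (auto simp: ok_def)

lemma S0_obtain:
  assumes "Y \<in> S0" "finite D"
  obtains \<Delta> where "ok \<Delta>" "D \<subseteq> \<Delta>" "inv_under \<Delta> Y"
proof -
  obtain \<Delta> where \<Delta>: "ok \<Delta>" "inv_under \<Delta> Y" using assms(1) by (auto simp: S0_def)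
  then show thesis
    using that[of "\<Delta> \<union> D"] ok_Un[OF \<Delta>(1) assms(2)] inv_under_mono[OF \<Delta>(1) _ \<Delta>(2), of "\<Delta> \<union> D"] by auto
qed

lemma closed_S0: "closed_ops (set_alg S0)"
  unfolding closed_ops_def set_alg_sel
proof (intro conjI ballI allI)
  have "ok {i0, i1, i2}" by (simp add: ok_def)
  then show "S0 \<noteq> {}" unfolding S0_def inv_under_def by blast
next
  fix X Y assume X: "X \<in> S0" and Y: "Y \<in> S0"
  obtain D where D: "ok D" "inv_under D X" using X by (auto simp: S0_def)
  obtain D' where D': "ok D'" "D \<subseteq> D'" "inv_under D' Y"
    using S0_obtain[OF Y, of D] D(1) by (auto simp: ok_def)
  then have "inv_under D' X" using inv_under_mono D by blast
  then have "inv_under D' (X \<union> Y)" using D'(3) by (auto simp: inv_under_def)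
  then show "X \<union> Y \<in> S0" using D'(1) by (auto simp: S0_def)
next
  fix X assume "X \<in> S0"
  then show "- X \<in> S0" by (auto simp: S0_def inv_under_def)
next
  fix i X assume X: "X \<in> S0"
  obtain D where D: "ok D" "{i} \<subseteq> D" "inv_under D X" using S0_obtain[OF X, of "{i}"] by auto
  have "\<exists>u. s'(i := u) \<in> X" if E: "E D s s'" and u: "s(i := u) \<in> X" for s s' u
    using E_extend[OF D(1) E, of i u] D(2,3) u unfolding inv_under_def by blast
  then have "inv_under D {s. \<exists>u. s(i := u) \<in> X}"
    unfolding inv_under_def using E_sym by blast
  then show "{s. \<exists>u. s(i := u) \<in> X} \<in> S0" using D(1) by (auto simp: S0_def)
next
  fix i j
  have "ok {i0, i1, i2, i, j}" by (simp add: ok_def)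
  moreover have "inv_under {i0, i1, i2, i, j} {s. s i = s j}" by (auto simp: inv_under_def E_def)
  ultimately show "{s. s i = s j} \<in> S0" by (auto simp: S0_def)
qed

text \<open>The entries at i0 and i1 are compared by the number that F assigns when each is placed
  at i0 before the same tail; the order is pulled back from the natural numbers.\<close>

definition X :: "('i \<Rightarrow> 'i set) set" where
  "X = {s. gd {i0, i1, i2} s \<and> srt (s i0) = i0 \<and> srt (s i1) = i0 \<and>
     \<phi> (F (ag {i0, i1, i2} s (\<lambda>_. i0))) < \<phi> (F (ag {i0, i1, i2} s (\<lambda>_. i1)))}"

lemma X_in_S0: "X \<in> S0"
proof -
  let ?D = "{i0, i1, i2}"
  have J: "J ?D = {i0}" using dist by (auto simp: J_def)
  have "s' \<in> X" if E: "E ?D s s'" and s: "s \<in> X" for s s'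
  proof -
    have g: "gd ?D s" using s by (simp add: X_def)
    have "srt (s l) = i0 \<longleftrightarrow> srt (s' l) = i0" if "l \<in> ?D" for l
    proof -
      have "srD ?D (s l) = srD ?D (s' l)" using E g that unfolding E_def by blast
      then show ?thesis using srD_iff[of i0 ?D "s l"] srD_iff[of i0 ?D "s' l"] J by simp
    qed
    moreover have "\<phi> (F (ag ?D s (\<lambda>_. l))) = \<phi> (F (ag ?D s' (\<lambda>_. l)))" if "l \<in> ?D" "srt (s l) = i0" for l
    proof -
      have "tr ?D s (\<lambda>_. l)" using that by (simp add: tr_def J)
      then show ?thesis using E g unfolding E_def by blast
    qed
    moreover have "gd ?D s'" using E g unfolding E_def by blast
    ultimately show ?thesis using s unfolding X_def mem_Collect_eq by (metis insertCI)
  qed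
  then have "inv_under ?D X" unfolding inv_under_def using E_sym by blast
  then show ?thesis unfolding S0_def mem_Collect_eq by (intro exI[of _ ?D]) (simp add: ok_def)
qed

text \<open>If the coordinates \<open>c, d\<close> are not available, then too few are left to represent all sorts
  besides two entries of equal sort.\<close>

lemma finite_symmetric_classes:
  assumes Y: "Y \<in> S0" "\<And>s u. s(c := u) \<in> Y \<longleftrightarrow> s \<in> Y" "\<And>s u. s(d := u) \<in> Y \<longleftrightarrow> s \<in> Y"
    and abcd: "distinct [a, b, c, d]"
  shows "\<exists>col :: 'i set \<Rightarrow> 'i \<times> 'i set. finite (range col) \<and>
    (\<forall>u v. col u = col v \<longrightarrow> u \<noteq> v \<longrightarrow> s(a := u, b := v) \<in> Y \<longrightarrow> s(a := v, b := u) \<in> Y)"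
proof -
  obtain \<Delta> where \<Delta>: "ok \<Delta>" "{a, b, c, d} \<subseteq> \<Delta>" "inv_under \<Delta> Y"
    using S0_obtain[OF Y(1), of "{a, b, c, d}"] by auto
  have fin: "finite \<Delta>" and I: "{i0, i1, i2} \<subseteq> \<Delta>" using \<Delta>(1) by (auto simp: ok_def)
  \<comment> \<open>An entry of sort \<open>i1\<close> can represent no sort in
    \<open>J \<Delta>\<close>; placing it at c and d bars both coordinates.\<close>
  obtain w where w: "srt w = i1" using F_finite[of "{}" i0 "{}" i1] by auto
  define r where "r = s(c := w, d := w)"
  have rY: "r(a := u, b := v) \<in> Y \<longleftrightarrow> s(a := u, b := v) \<in> Y" for u v
  proof -
    have "r(a := u, b := v) = (s(a := u, b := v))(c := w, d := w)"
      using abcd by (auto simp: r_def fun_eq_iff)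
    then show ?thesis using Y(2,3) by simp
  qed
  \<comment> \<open>The second component ensures that two different entries of one colour are both
    new.\<close>
  define col where "col u = (srD \<Delta> u, {k \<in> \<Delta> - {a, b}. r k = u})" for u
  have "range col \<subseteq> insert i1 (J \<Delta>) \<times> Pow \<Delta>" by (auto simp: col_def srD_def)
  then have "finite (range col)" by (rule finite_subset) (simp add: J_def fin)
  moreover have "s(a := v, b := u) \<in> Y" if c: "col u = col v" and ne: "u \<noteq> v" and s: "s(a := u, b := v) \<in> Y" for u v
  proof -
    have sr: "srD \<Delta> u = srD \<Delta> v" using c by (simp add: col_def)
    have nu: "r k \<noteq> u" "r k \<noteq> v" "u \<noteq> r k" "v \<noteq> r k" if "k \<in> \<Delta>" "k \<noteq> a" "k \<noteq> b" for k
    proof -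
      have "k \<in> snd (col u) \<longleftrightarrow> r k = u" "k \<in> snd (col v) \<longleftrightarrow> r k = v" using that by (auto simp: col_def)
      then show "r k \<noteq> u" "r k \<noteq> v" "u \<noteq> r k" "v \<noteq> r k" using c ne by auto
    qed
    let ?p = "r(a := u, b := v)" and ?p' = "r(a := v, b := u)"
    have ab: "a \<noteq> b" "a \<in> \<Delta>" "b \<in> \<Delta>" "c \<in> \<Delta>" "d \<in> \<Delta>" using abcd \<Delta>(2) by auto
    have "E \<Delta> ?p ?p'"
      unfolding E_def
    proof (intro conjI ballI impI allI)
      fix l m assume lm: "l \<in> \<Delta>" "m \<in> \<Delta>"
      show "?p l = ?p m \<longleftrightarrow> ?p' l = ?p' m"
        using lm nu ne ab(1) by (cases "l = a"; cases "l = b"; cases "m = a"; cases "m = b") auto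
    next
      show "gd \<Delta> ?p = gd \<Delta> ?p'" using ab by (auto simp: gd_def)
    next
      fix l assume "l \<in> \<Delta>"
      show "srD \<Delta> (?p l) = srD \<Delta> (?p' l)" using sr by simp
    next
      fix e assume e: "tr \<Delta> ?p e"
      \<comment> \<open>There is in fact no transversal: it would use every coordinate except c and
        d, hence both a and b, for different sorts, whereas u and v have the same sort.\<close>
      have "inj_on e (J \<Delta>)" using e by (auto simp: tr_def intro!: inj_onI) metis
      then have "card (e ` J \<Delta>) = card (J \<Delta>)" by (rule card_image)
      moreover have "card (J \<Delta>) = card (\<Delta> - {c, d})"
        using fin I ab dist abcd unfolding J_def by (simp add: card_Diff_subset)
      moreover have "e ` J \<Delta> \<subseteq> \<Delta> - {c, d}"
      proof
        fix k assume "k \<in> e ` J \<Delta>"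
        then obtain j where j: "j \<in> J \<Delta>" "k = e j" by blast
        then have k: "k \<in> \<Delta>" "srt (?p k) = j" using e by (auto simp: tr_def)
        have "?p c = w" "?p d = w" using abcd by (auto simp: r_def)
        then have "k \<noteq> c" "k \<noteq> d" using k(2) j(1) w by (auto simp: J_def)
        then show "k \<in> \<Delta> - {c, d}" using k(1) by blast
      qed
      ultimately have "e ` J \<Delta> = \<Delta> - {c, d}" using fin by (intro card_subset_eq) auto
      then have "a \<in> e ` J \<Delta>" "b \<in> e ` J \<Delta>" using ab abcd by auto
      then obtain j k where jk: "j \<in> J \<Delta>" "e j = a" "k \<in> J \<Delta>" "e k = b" by blast
      then have "srt u = j" "srt v = k" using e ab by (auto simp: tr_def)
      then have "j = k" using sr jk by (simp add: srD_def)
      then show "\<phi> (F (ag \<Delta> ?p e)) = \<phi> (F (ag \<Delta> ?p' e))" using jk ab by simp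
    qed
    then show ?thesis using \<Delta>(3) s rY unfolding inv_under_def by blast
  qed
  ultimately show ?thesis by (intro exI[of _ col]) blast
qed

text \<open>A c_d-closed argument induces a relation that ignores c as well as d. It is symmetric
  within finitely many colour classes and so cannot be such an order.\<close>

lemma valid_order_eq_cyl:
  assumes abcd: "distinct [a, b, c, d]"
  shows "valid (set_alg S0) (eq_cyl_vars d (order_eq a b c))"
  unfolding valid_def
proof (intro allI impI)
  fix v :: "nat \<Rightarrow> ('i \<Rightarrow> 'i set) set" assume v: "\<forall>n. v n \<in> carr (set_alg S0)"
  let ?v = "\<lambda>n. cyl (set_alg S0) d (v n)"
  let ?Z = "{s. \<exists>u. s(c := u) \<in> ?v 0}"
  have cl: "{s. \<exists>u. s(i := u) \<in> x} \<in> S0" if "x \<in> S0" for i x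
    using closed_S0 that by (simp add: closed_ops_def)
  have "?v 0 \<in> S0" using v cl by simp
  then have ZS: "?Z \<in> S0" by (rule cl)
  have Zc: "s(c := u) \<in> ?Z \<longleftrightarrow> s \<in> ?Z" for s u by simp
  have Zd: "s(d := u) \<in> ?Z \<longleftrightarrow> s \<in> ?Z" for s u using abcd by (simp add: fun_upd_twist[of d c])
  have "s \<notin> tval (set_alg S0) ?v (order_term a b c)" for s
  proof
    assume s: "s \<in> tval (set_alg S0) ?v (order_term a b c)"
    define R where "R u w \<longleftrightarrow> s(a := u, b := w) \<in> ?Z" for u w
    have R: "(\<exists>u w. R u w) \<and> (\<forall>u. \<not> R u u) \<and> (\<forall>u w z. R u w \<longrightarrow> R w z \<longrightarrow> R u z) \<and> (\<forall>u w. R u w \<longrightarrow> (\<exists>z. R w z))"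
      unfolding R_def by (rule iffD1[OF order_term_iff s]) (use abcd in auto)
    note ne = conjunct1[OF R] and irr = conjunct1[OF conjunct2[OF R]]
      and tr = conjunct1[OF conjunct2[OF conjunct2[OF R]]] and ser = conjunct2[OF conjunct2[OF conjunct2[OF R]]]
    obtain col :: "'i set \<Rightarrow> 'i \<times> 'i set" where col: "finite (range col) \<and>
      (\<forall>u v. col u = col v \<longrightarrow> u \<noteq> v \<longrightarrow> R u v \<longrightarrow> R v u)"
      using finite_symmetric_classes[OF ZS Zc Zd abcd, of s] unfolding R_def by (rule exE)
    obtain u0 w0 where "R u0 w0" using ne by blast
    then show False
    proof (rule no_almost_symmetric_order[of R u0 w0 col])
      show "R u z" if "R u w" "R w z" for u w z by (rule tr[rule_format, OF that])
      show "\<exists>z. R w z" if "R u w" for u w by (rule ser[rule_format, OF that])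
      show "R v u" if "col u = col v" "u \<noteq> v" "R u v" for u v using col that by simp
    qed (use irr col in auto)
  qed
  then show "tval (set_alg S0) v (fst (eq_cyl_vars d (order_eq a b c))) = tval (set_alg S0) v (snd (eq_cyl_vars d (order_eq a b c)))"
    unfolding eq_cyl_vars_def order_eq_def fst_conv snd_conv tval_cyl_vars by auto
qed

text \<open>At a sequence in which every entry has its own sort, X induces the comparison of the
  numbers \<open>m u\<close> on entries of sort i0; genericity makes these numbers unbounded, hence
  the relation serial.\<close>

lemma not_valid_order_eq: "\<not> valid (set_alg S0) (order_eq i0 i1 i2)"
proof
  assume v: "valid (set_alg S0) (order_eq i0 i1 i2)"
  let ?D = "{i0, i1, i2}"
  have "\<exists>x. srt x = k" for k using F_finite[of "{}" k "{}" k] by auto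
  then obtain s where s: "\<And>k. srt (s k) = k" by metis
  define t where "t = (\<lambda>k. if k \<in> ?D then {} else s k)"
  define m where "m u = \<phi> (F (t(i0 := u)))" for u
  have X_iff: "r(i0 := u, i1 := w) \<in> X \<longleftrightarrow> srt u = i0 \<and> srt w = i0 \<and> m u < m w"
    if r: "\<And>k. k \<notin> ?D \<Longrightarrow> r k = s k" for u w r
  proof -
    have "ag ?D (r(i0 := u, i1 := w)) (\<lambda>_. i0) = t(i0 := u)" "ag ?D (r(i0 := u, i1 := w)) (\<lambda>_. i1) = t(i0 := w)"
      using r dist by (auto simp: ag_def t_def fun_eq_iff)
    moreover have "gd ?D (r(i0 := u, i1 := w))" using r s by (auto simp: gd_def)
    ultimately show ?thesis using dist by (auto simp: X_def m_def)
  qed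
  have "s(i0 := u, i1 := w, i2 := z) = (s(i2 := z))(i0 := u, i1 := w)" for u w z
    using dist by (auto simp: fun_eq_iff)
  then have R: "s(i0 := u, i1 := w) \<in> {s. \<exists>z. s(i2 := z) \<in> X} \<longleftrightarrow> srt u = i0 \<and> srt w = i0 \<and> m u < m w" for u w
    using X_iff[of "s(i2 := z)" for z] by auto
  have step: "\<exists>z. srt z = i0 \<and> n < m z" for n
  proof -
    obtain x where x: "\<phi> x = Suc n" using \<phi> by (metis surjD)
    obtain z where "srt z = i0" "F (t(i0 := z)) = x"
      using F_finite[of "{t}" i0 "{}" i0 "\<lambda>_. x"] by (auto simp: t_def)
    then show ?thesis using x by (auto simp: m_def)
  qed
  have "s \<in> tval (set_alg S0) (\<lambda>_. X) (order_term i0 i1 i2)"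
    unfolding order_term_iff[OF dist] R using step by (auto intro: less_trans)
  moreover have "tval (set_alg S0) (\<lambda>_. X) (order_term i0 i1 i2) = {}"
    using validD[OF v, of "\<lambda>_. X"] X_in_S0 by (simp add: order_eq_def)
  ultimately show False by simp
qed

end

lemma Sy_RCA_not_Ind:
  assumes inf: "infinite (UNIV :: 'i set)"
  shows "\<exists>A :: ('i, ('i \<Rightarrow> 'i set) set) cyl_alg. A \<in> Sy \<and> A \<in> RCA \<and> A \<notin> Ind"
proof -
  obtain srt :: "'i set \<Rightarrow> 'i" and F :: "('i \<Rightarrow> 'i set) \<Rightarrow> 'i"
    where F: "\<And>k \<sigma> P q B. finite P \<Longrightarrow> (\<And>t. t \<in> P \<Longrightarrow> t k = {}) \<Longrightarrow>
    (card_of B, card_of (UNIV :: 'i set)) \<in> ordLeq \<Longrightarrow>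
    \<exists>u. u \<notin> B \<and> srt u = \<sigma> \<and> (\<forall>t\<in>P. F (t(k := u)) = q t)"
    using generic_function[OF inf] by metis
  obtain g :: "nat \<Rightarrow> 'i" where g: "inj g" using infinite_countable_subset[OF inf] by auto
  interpret ordered_tails srt F "g 0" "g 1" "g 2" "inv g"
    by unfold_locales (use inf F g inj_imp_surj_inv[OF g] in \<open>auto simp: inj_eq\<close>)
  let ?U = "set_alg (UNIV :: ('i \<Rightarrow> 'i set) set set)"
  \<comment> \<open>The product runs over all functions; one that is not a permutation only repeats
    the factor of the identity.\<close>
  define perm where "perm \<rho> = (if bij \<rho> then \<rho> else id)" for \<rho> :: "'i \<Rightarrow> 'i"
  have perm: "bij (perm \<rho>)" for \<rho> by (simp add: perm_def)
  have perm_bij: "perm \<rho> = \<rho>" if "bij \<rho>" for \<rho> using that by (simp add: perm_def)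
  define As where "As \<rho> = reindex (perm \<rho>) (set_alg S0)" for \<rho>
  let ?A = "prod_alg As"
  have cAs: "closed_ops (As \<rho>)" for \<rho> unfolding As_def by (rule closed_reindex[OF closed_S0])
  have vA: "valid ?A e \<longleftrightarrow> (\<forall>\<rho>. bij \<rho> \<longrightarrow> valid (set_alg S0) (eq_rename \<rho> e))" for e
  proof
    assume "valid ?A e"
    then have "valid (As \<rho>) e" for \<rho> using valid_prod_alg[of As, OF cAs] by blast
    then show "\<forall>\<rho>. bij \<rho> \<longrightarrow> valid (set_alg S0) (eq_rename \<rho> e)"
      unfolding As_def valid_reindex using perm_bij by metis
  next
    assume "\<forall>\<rho>. bij \<rho> \<longrightarrow> valid (set_alg S0) (eq_rename \<rho> e)"
    then have "valid (As \<rho>) e" for \<rho> unfolding As_def valid_reindex using perm by blast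
    then show "valid ?A e" using valid_prod_alg[of As, OF cAs] by blast
  qed
  have UInd: "?U \<in> Ind" by (rule set_alg_UNIV_Ind)
  then have USy: "?U \<in> Sy" and UCA: "?U \<in> CA" using Ind_subset_Sy[OF inf] by (auto simp: Ind_def)
  have "valid ?A e" if "valid ?U e" for e
    unfolding vA using that USy valid_subalgebra[OF subset_UNIV] unfolding Sy_def by blast
  then have ACA: "?A \<in> CA" by (rule CA_if_Eq[OF UCA inf closed_prod_alg[OF cAs]])
  interpret A: cylindric ?A using ACA inf by unfold_locales
  obtain f :: "(('i \<Rightarrow> 'i) \<Rightarrow> ('i \<Rightarrow> 'i set) set) \<Rightarrow> ('i \<Rightarrow> 'i set) set" where f: "inj f"
    by (rule function_embeds[OF inf, of "\<lambda>\<rho> i. {\<rho> i}"]) (auto simp: inj_def fun_eq_iff)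
  obtain A' where A': "closed_ops A'" "cyl_iso ?A A' f"
    using isomorphic_copy[OF A.closed inj_on_subset[OF f subset_UNIV]] by blast
  have vA': "valid A' e \<longleftrightarrow> valid ?A e" for e using cyl_iso_valid[OF A.closed A'(2)] by blast
  have A'CA: "A' \<in> CA" using vA' by (intro CA_if_Eq[OF ACA inf A'(1)]) simp
  interpret A': cylindric A' using A'CA inf by unfold_locales
  have "A' \<in> Sy"
  proof -
    have "valid A' (eq_rename \<pi> e)" if \<pi>: "bij \<pi>" and e: "valid A' e" for \<pi> e
      using e bij_comp[OF \<pi>] unfolding vA' vA eq_rename_comp by blast
    then show ?thesis using A'CA by (auto simp: Sy_def)
  qed
  moreover have "A' \<notin> Ind"
  proof
    assume Ind: "A' \<in> Ind"
    \<comment> \<open>\<open>g 3\<close> is the second barred index; the four indices stay distinct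
      under every permutation, so each factor satisfies the equation.\<close>
    have "valid A' (eq_cyl_vars (g 3) (order_eq (g 0) (g 1) (g 2)))"
      unfolding vA' vA rename_cyl_vars order_eq_rename
    proof (intro allI impI valid_order_eq_cyl)
      fix \<rho> :: "'i \<Rightarrow> 'i" assume "bij \<rho>"
      then have "inj (\<rho> \<circ> g)" using g by (simp add: bij_is_inj inj_compose)
      then have "(\<rho> \<circ> g) m = (\<rho> \<circ> g) n \<longleftrightarrow> m = n" for m n by (rule inj_eq)
      then show "distinct [\<rho> (g 0), \<rho> (g 1), \<rho> (g 2), \<rho> (g 3)]" by simp
    qed
    moreover have "g 3 \<notin> eq_inds (order_eq (g 0) (g 1) (g 2))"
      using order_eq_inds[of "g 0" "g 1" "g 2"] by (auto simp: inj_eq[OF g])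
    ultimately have "valid A' (order_eq (g 0) (g 1) (g 2))" using Ind unfolding Ind_def by blast
    then have "valid (set_alg S0) (eq_rename id (order_eq (g 0) (g 1) (g 2)))"
      unfolding vA' vA using bij_id by blast
    then show False using not_valid_order_eq by (simp add: eq_rename_id)
  qed
  moreover have "A' \<in> RCA"
  proof (rule RCA_if_separated[OF inf A'CA])
    fix a assume a: "a \<in> carr A'" "a \<noteq> bzero A'"
    let ?f = "the_inv_into (carr ?A) f"
    have f': "cyl_iso A' ?A ?f" by (rule cyl_iso_inverse[OF A.closed A'(2)])
    then have h1: "reduct_hom UNIV A' ?A ?f" and inj: "inj_on ?f (carr A')"
      by (auto simp: cyl_iso_def bij_betw_def)
    have S0CA: "set_alg S0 \<in> CA" by (rule set_alg_CA[OF closed_S0])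
    have "?f a \<noteq> (\<lambda>_. {})"
    proof
      assume eq: "?f a = (\<lambda>_. {})"
      have z: "?f (bzero A') = bzero ?A"
        by (rule reduct_hom_zero[OF h1 A'.closed A'.bool A.closed A.bool])
      have "?f a \<in> carr ?A" using h1 a(1) by (auto simp: reduct_hom_def simp del: prod_alg_sel)
      then have "bmult ?A (?f a) (bneg ?A (?f a)) = bzero ?A" by (rule A.zero_eq)
      then have "bzero ?A = (\<lambda>_. {})" unfolding eq by (simp add: bmult_def As_def reindex_def)
      then have "?f a = ?f (bzero A')" using eq z by simp
      then show False using inj_onD[OF inj] a by auto
    qed
    then obtain \<rho> where \<rho>: "?f a \<rho> \<noteq> {}" by blast
    let ?\<rho> = "perm \<rho>"
    have b: "inv ?\<rho> (?\<rho> i) = i" for i using perm by (simp add: bij_is_inj inv_f_f)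
    \<comment> \<open>Composition with the inverse permutation undoes the reindexing of this
      factor.\<close>
    have "reduct_hom UNIV (As \<rho>) ?U (\<lambda>Y. {s. s \<circ> inv ?\<rho> \<in> Y})"
    proof -
      have "(s \<circ> inv ?\<rho>)(?\<rho> i := u) = s(i := u) \<circ> inv ?\<rho>" for s :: "'i \<Rightarrow> 'i set" and i u
        using b perm by (auto simp: fun_eq_iff bij_inv_eq_iff)
      then show ?thesis by (auto simp: reduct_hom_def As_def reindex_def b)
    qed
    moreover obtain c d :: 'i where "c \<noteq> d" using A.other_index by blast
    \<comment> \<open>Characteristic functions with two distinct values, to move the base into the
      type that \<open>RCA_if_separated\<close> expects.\<close>
    define \<gamma> :: "'i set \<Rightarrow> 'i \<Rightarrow> ('i \<Rightarrow> 'i set) set + 'i" where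
      "\<gamma> Y = (\<lambda>i. Inr (if i \<in> Y then c else d))" for Y
    have \<gamma>: "inj \<gamma>"
    proof (rule injI)
      fix Y Y' assume eq: "\<gamma> Y = \<gamma> Y'"
      have "(i \<in> Y) = (i \<in> Y')" for i
      proof -
        have "\<gamma> Y i = \<gamma> Y' i" by (simp only: eq)
        then show ?thesis using \<open>c \<noteq> d\<close> unfolding \<gamma>_def by (auto split: if_splits)
      qed
      then show "Y = Y'" by blast
    qed
    note h4 = set_alg_representation[OF \<gamma>, of "UNIV :: ('i \<Rightarrow> 'i set) set set"]
    define H where "H = (\<lambda>X. {s \<in> seqs (range \<gamma>). inv \<gamma> \<circ> s \<in> X}) \<circ> ((\<lambda>Y. {s. s \<circ> inv ?\<rho> \<in> Y}) \<circ> ((\<lambda>f. f \<rho>) \<circ> ?f))"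
    have "reduct_hom UNIV A' (full_set_alg (range \<gamma>) (seqs (range \<gamma>))) H"
      unfolding H_def by (intro reduct_hom_comp[OF reduct_hom_comp[OF reduct_hom_comp[OF h1 proj_hom]] h4] calculation)
    moreover have "H a \<noteq> {}"
    proof -
      obtain s where s: "s \<in> ?f a \<rho>" using \<rho> by blast
      have e1: "inv \<gamma> \<circ> (\<gamma> \<circ> (s \<circ> ?\<rho>)) = s \<circ> ?\<rho>" using \<gamma> by (auto simp: fun_eq_iff)
      have e2: "s \<circ> ?\<rho> \<circ> inv ?\<rho> = s" using perm by (auto simp: fun_eq_iff bij_is_surj surj_f_inv_f)
      have "\<gamma> \<circ> (s \<circ> ?\<rho>) \<in> seqs (range \<gamma>)" by (auto simp: seqs_def)
      then have "\<gamma> \<circ> (s \<circ> ?\<rho>) \<in> H a"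
        unfolding H_def o_apply[of _ _ a] o_apply[of _ "(\<lambda>f. f \<rho>) \<circ> ?f" a] mem_Collect_eq e1 e2 using s by simp
      then show ?thesis by blast
    qed
    ultimately show "\<exists>(U :: ('i \<Rightarrow> ('i \<Rightarrow> 'i set) set + 'i) set) H.
        reduct_hom UNIV A' (full_set_alg U (seqs U)) H \<and> H a \<noteq> {}" by blast
  qed
  ultimately show ?thesis by blast
qed

theorem theorem4p5:
  assumes "infinite (UNIV :: 'i::wellorder set)"
  shows
    "((Edc :: ('i, 'a) cyl_alg set) \<subseteq> Ind \<and>
      (Ind :: ('i, 'a) cyl_alg set) \<subseteq> Sy \<inter> RCA \<and>
      (Edc :: ('i, ('i \<Rightarrow> 'i set) set) cyl_alg set) \<subset> Ind \<and>
      (Ind :: ('i, ('i \<Rightarrow> 'i set) set) cyl_alg set) \<subset> Sy \<inter> RCA) \<and>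
     (\<forall>A \<in> (CA :: ('i, 'a) cyl_alg set).
        (A \<in> Ind \<longleftrightarrow> (\<exists>B \<in> (Lf :: ('i, 'i ca_term set) cyl_alg set). Eq A = Eq B)) \<and>
        (\<forall>B \<in> (Lf :: ('i, 'b) cyl_alg set). Eq A = Eq B \<longrightarrow> A \<in> Ind))"
proof -
  note inf = assms
  obtain A :: "('i, ('i \<Rightarrow> 'i set) set) cyl_alg" where A: "A \<in> Ind" "A \<notin> Edc"
    using Ind_not_Edc[OF inf] by blast
  obtain B :: "('i, ('i \<Rightarrow> 'i set) set) cyl_alg" where B: "B \<in> Sy" "B \<in> RCA" "B \<notin> Ind"
    using Sy_RCA_not_Ind[OF inf] by blast
  have "(Edc :: ('i, 'a) cyl_alg set) \<subseteq> Ind" "(Edc :: ('i, ('i \<Rightarrow> 'i set) set) cyl_alg set) \<subseteq> Ind"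
    using Edc_subset_Ind[OF inf] by blast+
  moreover have "(Ind :: ('i, 'a) cyl_alg set) \<subseteq> Sy \<inter> RCA"
    "(Ind :: ('i, ('i \<Rightarrow> 'i set) set) cyl_alg set) \<subseteq> Sy \<inter> RCA"
    using Ind_subset_Sy[OF inf] Ind_subset_RCA[OF inf] by blast+
  moreover have "A \<in> Ind" if "A \<in> CA" "B \<in> Lf" "Eq A = Eq B"
    for A :: "('i, 'a) cyl_alg" and B :: "('i, 'i ca_term set) cyl_alg"
    using Ind_if_Eq[OF that(1) Lf_subset_Ind[OF inf that(2)] that(3)] .
  moreover have "A \<in> Ind" if "A \<in> CA" "B \<in> Lf" "Eq A = Eq B"
    for A :: "('i, 'a) cyl_alg" and B :: "('i, 'b) cyl_alg"
    using Ind_if_Eq[OF that(1) Lf_subset_Ind[OF inf that(2)] that(3)] .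
  moreover have "\<exists>B \<in> (Lf :: ('i, 'i ca_term set) cyl_alg set). Eq A = Eq B" if "A \<in> Ind"
    for A :: "('i, 'a) cyl_alg"
    using Ind_has_Lf[OF inf that] by blast
  ultimately show ?thesis using A B by blast
qed

end
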